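(* Consider the linear system $x_{t+1}=Ax_t+Bu_t+w_t$, $y_t=Cx_t+Du_t$, $t=0,1,\dots$, with $A\in\mathbb{R}^{n\times n}$, $B\in\mathbb{R}^{n\times m}$, $C\in\mathbb{R}^{r\times n}$, $D\in\mathbb{R}^{r\times m}$, and let $k\ge1$ be an integer. Suppose that $\|A\|_2<1$, that $x_0$ and the attacks $w_t$ satisfy the sub-Gaussian assumption with constant $\eta>0$, and that the attacks satisfy the probabilistic attack assumption with $p<\frac1{4k-2}$ (both stated in the context). Let $u_t\sim N(0,\gamma^2I_m)$ for all $t$, where $\gamma>0$. Define $q:=1-(1-p)^{2k-1}<0.5$. Let $\hat G_k$ be any solution of $$\min_{G\in\mathbb{R}^{r\times 2km}}\ \sum_{t=2k-1}^{T+2k-2}\|y_t-G\,\mathbf{U}_t^{(k)}\|_1$$ and let $G_k^*=[D\ \ CB\ \ CAB\ \cdots\ CA^{2k-2}B]$ be the true Markov parameter matrix. Given $\delta\in(0,1]$, when $$T\ge\Theta\left(\frac{k}{(1-2q)^2}\left[km\log\Bigl(\frac{km}{1-2q}\Bigr)+\log\Bigl(\frac r\delta\Bigr)\right]\right),$$ we have $$\|G_k^*-\hat G_k\|_F\le\Theta\left(\frac{\|A^{2k-1}\|_2\,\|C\|_2\,\sqrt r}{(1-\|A\|_2)(1-2q)}\cdot\Bigl(\frac{\eta}{\gamma}+\sqrt m\,\|B\|_2\Bigr)\right)$$ with probability at least $1-\delta$.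
   Context: $x_t\in\mathbb{R}^n$ is the state, $u_t\in\mathbb{R}^m$ the control input, $y_t\in\mathbb{R}^r$ the observation, and $w_t\in\mathbb{R}^n$ the attack at time $t$; $w_t=0$ when there is no attack, and at attack times $w_t$ may be chosen arbitrarily by an adversary. $\|\cdot\|_2$ of a matrix is the spectral norm, $\|\cdot\|_F$ the Frobenius norm. Let $\mathcal{F}_t=\bm{\sigma}\{x_0,w_0,\dots,w_{t-1}\}$. Sub-Gaussian norm: for a real random variable $w$, $\|w\|_{\psi_2}=\inf\{c>0:\mathbb{E}[\exp(w^2/c^2)]\le2\}$; for a random vector $w\in\mathbb{R}^d$, $\|w\|_{\psi_2}=\sup_{\|x\|_2\le1,\,x\in\mathbb{R}^d}\|w^Tx\|_{\psi_2}$. Sub-Gaussian assumption: $\|x_0\|_{\psi_2}\le\eta$ and $\|w_t\|_{\psi_2}\le\eta$ conditioned on $\mathcal{F}_t$ for all $t\ge0$ (i.e. the $\psi_2$-norm is computed with the conditional expectation given $\mathcal{F}_t$). Probabilistic attack assumption: conditioned on $\mathcal{F}_t$, $w_t$ is an attack with probability $p<\frac1{4k-2}$, meaning that there exists a sequence $(\xi_t)_{t\ge0}$ of independent Bernoulli$(p)$ variables, each $\xi_t$ independent of $\mathcal{F}_t$, such that $\{\xi_t=0\}\subseteq\{w_t=0\}$ for all $t\ge0$. The inputs $u_0,u_1,\dots$ are mutually independent, and the sequence $(u_t)$ is independent of the sequence $(\xi_t)$. For $t\ge2k-1$: $\mathbf{U}_t^{(k)}=[u_t^T\ u_{t-1}^T\cdots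 u_{t-2k+1}^T]^T\in\mathbb{R}^{2km}$. $\Theta(\cdot)$ is big-$\Theta$ notation: "$Y\ge\Theta(X)$" (resp. "$Y\le\Theta(X)$") means $Y\ge cX$ (resp. $Y\le cX$) for some suitable constant $c>0$ not depending on the quantities displayed inside the $\Theta$-expressions of the claim.
   Formalization: The sample-size condition is T ≥ c·max(1, X), where X is the displayed rate; without the floor at 1 the claim fails for k=m=r=1, A=B=C=D=0, p=0 and δ near 1, where X tends to 0 and T=1 would be allowed though the minimisers form a line. *)

theory Defs
  imports "HOL-Probability.Probability" "Jordan_Normal_Form.Matrix"
begin

unbundle no vec_syntax
unbundle no inner_syntax

definition l1_norm :: "real vec \<Rightarrow> real" where
  "l1_norm v = (\<Sum>i<dim_vec v. \<bar>v $ i\<bar>)"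

definition l2_norm :: "real vec \<Rightarrow> real" where
  "l2_norm v = sqrt (v \<bullet> v)"

definition spectral_norm :: "real mat \<Rightarrow> real" where
  "spectral_norm A = (SUP v\<in>{v \<in> carrier_vec (dim_col A). l2_norm v \<le> 1}. l2_norm (A *\<^sub>v v))"

definition frobenius_norm :: "real mat \<Rightarrow> real" where
  "frobenius_norm A = sqrt (\<Sum>i<dim_row A. \<Sum>j<dim_col A. (A $$ (i, j))\<^sup>2)"

text \<open>The Borel sigma-algebra of d-dimensional space, carried over to \<^typ>\<open>real vec\<close>.\<close>

definition borel_vec :: "nat \<Rightarrow> real vec measure" where
  "borel_vec d =
     vimage_algebra (carrier_vec d) (\<lambda>v. \<lambda>i\<in>{..<d}. v $ i) (Pi\<^sub>M {..<d} (\<lambda>_. borel))"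

text \<open>The law N(0, g^2 I) on d-dimensional space; \<^const>\<open>normal_density\<close> takes the
  standard deviation.\<close>

definition isotropic_gaussian :: "nat \<Rightarrow> real \<Rightarrow> real vec measure" where
  "isotropic_gaussian d g =
     distr (Pi\<^sub>M {..<d} (\<lambda>_. density lborel (\<lambda>z. ennreal (normal_density 0 g z))))
       (borel_vec d) (\<lambda>f. vec d f)"

definition generated_algebra :: "'a measure \<Rightarrow> 'b measure \<Rightarrow> ('a \<Rightarrow> 'b) \<Rightarrow> 'a set set" where
  "generated_algebra M N X = sets (vimage_algebra (space M) X N)"

text \<open>Existence of a measurable event on which P holds, so that P itself need not
  define a measurable set.\<close>

definition holds_with_prob_at_least :: "'a measure \<Rightarrow> real \<Rightarrow> ('a \<Rightarrow> bool) \<Rightarrow> bool" where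
  "holds_with_prob_at_least M a P \<longleftrightarrow> (\<exists>E\<in>sets M. measure M E \<ge> a \<and> (\<forall>\<omega>\<in>E. P \<omega>))"

text \<open>The norms take values in \<^typ>\<open>ennreal\<close>: the infimum of the empty set is infinite.\<close>

definition psi2_norm :: "'a measure \<Rightarrow> ('a \<Rightarrow> real) \<Rightarrow> ennreal" where
  "psi2_norm M X =
     (INF c\<in>{c::real. c > 0 \<and> (\<integral>\<^sup>+\<omega>. ennreal (exp ((X \<omega>)\<^sup>2 / c\<^sup>2)) \<partial>M) \<le> 2}. ennreal c)"

definition psi2_norm_vec :: "'a measure \<Rightarrow> nat \<Rightarrow> ('a \<Rightarrow> real vec) \<Rightarrow> ennreal" where
  "psi2_norm_vec M d X =
     (SUP v\<in>{v \<in> carrier_vec d. l2_norm v \<le> 1}. psi2_norm M (\<lambda>\<omega>. X \<omega> \<bullet> v))"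

text \<open>The conditional norm given F is a random variable. Each conditional expectation is
  determined only up to a null set depending on c, so the infimum is taken over rational c.
  Almost surely the admissible rational c form an up-closed set; up to a null set the value
  is the infimum over all positive real c of the integrals under a regular conditional law.\<close>

definition cond_psi2_norm :: "'a measure \<Rightarrow> 'a measure \<Rightarrow> ('a \<Rightarrow> real) \<Rightarrow> 'a \<Rightarrow> ennreal" where
  "cond_psi2_norm M F X \<omega> =
     (INF c\<in>{c::real. c \<in> \<rat> \<and> c > 0 \<and>
                nn_cond_exp M F (\<lambda>\<omega>'. ennreal (exp ((X \<omega>')\<^sup>2 / c\<^sup>2))) \<omega> \<le> 2}. ennreal c)"

text \<open>For a random vector the supremum over the uncountable unit ball is, for the same reason,
  the essential supremum; it is bounded by K iff each of its members is almost surely.\<close>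

definition cond_psi2_norm_vec_le ::
  "'a measure \<Rightarrow> 'a measure \<Rightarrow> nat \<Rightarrow> ('a \<Rightarrow> real vec) \<Rightarrow> real \<Rightarrow> bool" where
  "cond_psi2_norm_vec_le M F d X K \<longleftrightarrow>
     (\<forall>v\<in>carrier_vec d. l2_norm v \<le> 1 \<longrightarrow>
        (AE \<omega> in M. cond_psi2_norm M F (\<lambda>\<omega>'. X \<omega>' \<bullet> v) \<omega> \<le> ennreal K))"

definition linear_system ::
  "real mat \<Rightarrow> real mat \<Rightarrow> real mat \<Rightarrow> real mat \<Rightarrow>
   (nat \<Rightarrow> real vec) \<Rightarrow> (nat \<Rightarrow> real vec) \<Rightarrow> (nat \<Rightarrow> real vec) \<Rightarrow> (nat \<Rightarrow> real vec) \<Rightarrow> bool" where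
  "linear_system A B C D x y u w \<longleftrightarrow>
     (\<forall>t. x (Suc t) = A *\<^sub>v x t + B *\<^sub>v u t + w t \<and> y t = C *\<^sub>v x t + D *\<^sub>v u t)"

definition history ::
  "'a measure \<Rightarrow> nat \<Rightarrow> ('a \<Rightarrow> real vec) \<Rightarrow> (nat \<Rightarrow> 'a \<Rightarrow> real vec) \<Rightarrow> nat \<Rightarrow> 'a measure" where
  "history M n x0 w t =
     sigma (space M) (generated_algebra M (borel_vec n) x0 \<union>
                      (\<Union>s<t. generated_algebra M (borel_vec n) (w s)))"

definition sub_gaussian_attacks ::
  "'a measure \<Rightarrow> nat \<Rightarrow> real \<Rightarrow> ('a \<Rightarrow> real vec) \<Rightarrow> (nat \<Rightarrow> 'a \<Rightarrow> real vec) \<Rightarrow> bool" where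
  "sub_gaussian_attacks M n \<eta> x0 w \<longleftrightarrow>
     x0 \<in> M \<rightarrow>\<^sub>M borel_vec n \<and> (\<forall>t. w t \<in> M \<rightarrow>\<^sub>M borel_vec n) \<and>
     psi2_norm_vec M n x0 \<le> ennreal \<eta> \<and>
     (\<forall>t. cond_psi2_norm_vec_le M (history M n x0 w t) n (w t) \<eta>)"

definition probabilistic_attacks ::
  "'a measure \<Rightarrow> nat \<Rightarrow> real \<Rightarrow> ('a \<Rightarrow> real vec) \<Rightarrow> (nat \<Rightarrow> 'a \<Rightarrow> real vec) \<Rightarrow>
   (nat \<Rightarrow> 'a \<Rightarrow> bool) \<Rightarrow> bool" where
  "probabilistic_attacks M n p x0 w \<xi> \<longleftrightarrow>
     prob_space.indep_vars M (\<lambda>_. count_space UNIV) \<xi> UNIV \<and>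
     (\<forall>t. distr M (count_space UNIV) (\<xi> t) = measure_pmf (bernoulli_pmf p)) \<and>
     (\<forall>t. prob_space.indep_set M (generated_algebra M (count_space UNIV) (\<xi> t))
                                  (sets (history M n x0 w t))) \<and>
     (\<forall>t. \<forall>\<omega>\<in>space M. \<not> \<xi> t \<omega> \<longrightarrow> w t \<omega> = 0\<^sub>v n)"

definition gaussian_inputs :: "'a measure \<Rightarrow> nat \<Rightarrow> real \<Rightarrow> (nat \<Rightarrow> 'a \<Rightarrow> real vec) \<Rightarrow> bool" where
  "gaussian_inputs M m \<gamma> u \<longleftrightarrow>
     prob_space.indep_vars M (\<lambda>_. borel_vec m) u UNIV \<and>
     (\<forall>t. distr M (borel_vec m) (u t) = isotropic_gaussian m \<gamma>)"

definition inputs_indep_attack_times ::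
  "'a measure \<Rightarrow> nat \<Rightarrow> (nat \<Rightarrow> 'a \<Rightarrow> real vec) \<Rightarrow> (nat \<Rightarrow> 'a \<Rightarrow> bool) \<Rightarrow> bool" where
  "inputs_indep_attack_times M m u \<xi> \<longleftrightarrow>
     prob_space.indep_set M
       (generated_algebra M (Pi\<^sub>M UNIV (\<lambda>_. borel_vec m)) (\<lambda>\<omega> t. u t \<omega>))
       (generated_algebra M (Pi\<^sub>M UNIV (\<lambda>_. count_space UNIV)) (\<lambda>\<omega> t. \<xi> t \<omega>))"

definition stacked_input :: "nat \<Rightarrow> nat \<Rightarrow> (nat \<Rightarrow> real vec) \<Rightarrow> nat \<Rightarrow> real vec" where
  "stacked_input k m u t = vec (2 * k * m) (\<lambda>i. u (t - i div m) $ (i mod m))"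

definition markov_parameters ::
  "nat \<Rightarrow> nat \<Rightarrow> nat \<Rightarrow> real mat \<Rightarrow> real mat \<Rightarrow> real mat \<Rightarrow> real mat \<Rightarrow> real mat" where
  "markov_parameters k r m A B C D =
     mat r (2 * k * m) (\<lambda>(i, j).
       if j < m then D $$ (i, j)
       else (C * A ^\<^sub>m (j div m - 1) * B) $$ (i, j mod m))"

definition lad_solution ::
  "nat \<Rightarrow> nat \<Rightarrow> nat \<Rightarrow> nat \<Rightarrow> (nat \<Rightarrow> real vec) \<Rightarrow> (nat \<Rightarrow> real vec) \<Rightarrow> real mat \<Rightarrow> bool" where
  "lad_solution k r m T y u G \<longleftrightarrow>
     is_arg_min (\<lambda>G. \<Sum>t = 2 * k - 1..T + 2 * k - 2. l1_norm (y t - G *\<^sub>v stacked_input k m u t))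
       (\<lambda>G. G \<in> carrier_mat r (2 * k * m)) G"

text \<open>The sample size condition is used in the form T >= c * max 1 sample_rate. The floor at 1
  can act only if k = m = 1. There the rate can be arbitrarily small and positive
  (r = 1, p near 0, \<^term>\<open>\<delta>\<close> near 1), so that no constant c > 0 would exclude T = 1, where the
  minimisers form an unbounded set.\<close>

definition sample_rate :: "nat \<Rightarrow> nat \<Rightarrow> nat \<Rightarrow> real \<Rightarrow> real \<Rightarrow> real" where
  "sample_rate k m r q \<delta> =
     real k / (1 - 2 * q)\<^sup>2 *
       (real (k * m) * ln (real (k * m) / (1 - 2 * q)) + ln (real r / \<delta>))"

definition error_rate ::
  "nat \<Rightarrow> nat \<Rightarrow> nat \<Rightarrow> real \<Rightarrow> real \<Rightarrow> real \<Rightarrow> real mat \<Rightarrow> real mat \<Rightarrow> real mat \<Rightarrow> real" where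
  "error_rate k m r q \<eta> \<gamma> A B C =
     spectral_norm (A ^\<^sub>m (2 * k - 1)) * spectral_norm C * sqrt (real r) /
       ((1 - spectral_norm A) * (1 - 2 * q)) *
       (\<eta> / \<gamma> + sqrt (real m) * spectral_norm B)"

end

theory Submission
  imports Defs
begin

text \<open>Unrolling the recursion over \<open>2 k - 1\<close> steps writes \<open>y t\<close> as the Markov parameters applied to
  the window of the last \<open>2 k\<close> inputs, plus \<open>C A\<^sup>2\<^sup>k\<^sup>-\<^sup>1\<close> applied to the state at the start of the
  window, plus a term that vanishes when no attack falls into the window. Call such a window
  clean. A window is clean with probability \<open>1 - q > 1 / 2\<close>; write \<open>a = 1 - 2 q\<close>.

  The absolute loss splits into one loss per row, so each row of a minimiser can be compared with
  the true row separately. Let \<open>z\<close> be the error of one row. A clean window with input \<open>U\<close>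
  contributes at least \<open>\<bar>z \<bullet> U\<bar>\<close> minus twice the state term to the excess loss, and an attacked
  window at least \<open>- \<bar>z \<bullet> U\<bar>\<close>, however large the attack is. Optimality therefore bounds the sum
  of the \<open>\<bar>z \<bullet> U\<bar>\<close>, with sign + for clean and - for attacked windows, by the state terms
  (\<open>lad_error_bound\<close>). Two estimates remain.

  The signed sum is at least a constant times \<open>\<gamma> a T \<parallel>z\<parallel>\<close>, for all \<open>z\<close> at once
  (\<open>uniform_lower_bound\<close>). Only the inputs and the attack times occur in it, and these are
  independent, so the values of the attacks and their dependence on the inputs do not matter.
  For fixed \<open>z\<close> each \<open>\<bar>z \<bullet> U\<bar>\<close> is the absolute value of a normal variable, and its random sign has
  mean \<open>a\<close> (\<open>signed_normal_exp_moment\<close>); windows whose starting points agree modulo \<open>2 k\<close> are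
  independent, and the classes are averaged by Jensen's inequality (\<open>signed_sum_tail\<close>). A grid
  of mesh proportional to \<open>a / (k m)\<close> transfers the bound to all directions, and the logarithm of
  the number of its points is the term \<open>km log (km / a)\<close> of the sample size.

  The state terms add up to at most a constant times
  \<open>T \<parallel>C\<parallel> \<parallel>A\<^sup>2\<^sup>k\<^sup>-\<^sup>1\<parallel> sqrt r (\<eta> + \<gamma> sqrt m \<parallel>B\<parallel>) / (1 - \<parallel>A\<parallel>)\<close>. The state is a sum of responses to the
  initial state, the attacks and the inputs, and each response decays geometrically
  (\<open>state_sum_bound\<close>). The attacks are controlled through their conditional exponential moments
  given the past (\<open>shock_sum_tail\<close>), the inputs through independence (\<open>input_norm_sum_tail\<close>).
  Measuring an attack row by row in root mean square costs the factor \<open>sqrt r\<close> and avoids a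
  dependence on the dimension \<open>n\<close> of the state.\<close>

section \<open>Euclidean and spectral norms\<close>

lemma l2_norm_eq_L2_set: "l2_norm v = L2_set (\<lambda>i. v $ i) {..<dim_vec v}"
  by (simp add: l2_norm_def L2_set_def scalar_prod_def power2_eq_square atLeast0LessThan)

lemma l2_norm_nonneg [simp]: "0 \<le> l2_norm v"
  by (simp add: l2_norm_eq_L2_set)

lemma l2_norm_power2: "(l2_norm v)\<^sup>2 = v \<bullet> v"
  by (simp add: l2_norm_def scalar_prod_def sum_nonneg)

lemma l2_norm_smult: "l2_norm (c \<cdot>\<^sub>v v) = \<bar>c\<bar> * l2_norm v"
  by (simp add: l2_norm_eq_L2_set L2_set_def power_mult_distrib real_sqrt_mult
      flip: sum_distrib_left)

lemma l2_norm_zero [simp]: "l2_norm (0\<^sub>v n) = 0"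
  by (simp add: l2_norm_def)

lemma l2_norm_triangle:
  assumes "u \<in> carrier_vec n" "v \<in> carrier_vec n"
  shows "l2_norm (u + v) \<le> l2_norm u + l2_norm v"
proof -
  have "l2_norm (u + v) = L2_set (\<lambda>i. u $ i + v $ i) {..<n}"
    using assms by (auto simp: l2_norm_eq_L2_set intro!: L2_set_cong)
  also have "\<dots> \<le> l2_norm u + l2_norm v"
    using L2_set_triangle_ineq[of "\<lambda>i. u $ i" "\<lambda>i. v $ i" "{..<n}"] assms
    by (simp add: l2_norm_eq_L2_set)
  finally show ?thesis .
qed

lemma abs_scalar_prod_le:
  assumes "u \<in> carrier_vec n" "v \<in> carrier_vec n"
  shows "\<bar>u \<bullet> v\<bar> \<le> l2_norm u * l2_norm v"
proof -
  have "\<bar>u \<bullet> v\<bar> \<le> (\<Sum>i<n. \<bar>u $ i\<bar> * \<bar>v $ i\<bar>)"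
    using assms sum_abs[of "\<lambda>i. u $ i * v $ i" "{..<n}"]
    by (simp add: scalar_prod_def atLeast0LessThan abs_mult)
  also have "\<dots> \<le> l2_norm u * l2_norm v"
    using L2_set_mult_ineq[of "\<lambda>i. u $ i" "\<lambda>i. v $ i" "{..<n}"] assms
    by (simp add: l2_norm_eq_L2_set)
  finally show ?thesis .
qed

lemma l2_norm_eq_0:
  assumes "v \<in> carrier_vec n" "l2_norm v = 0"
  shows "v = 0\<^sub>v n"
  using assms by (auto simp: l2_norm_eq_L2_set L2_set_eq_0_iff)

lemma l2_norm_mult_mat_vec_le_rows:
  assumes "A \<in> carrier_mat r n" "v \<in> carrier_vec n"
  shows "l2_norm (A *\<^sub>v v) \<le> L2_set (\<lambda>i. l2_norm (row A i)) {..<r} * l2_norm v"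
proof -
  have "l2_norm (A *\<^sub>v v) = L2_set (\<lambda>i. \<bar>row A i \<bullet> v\<bar>) {..<r}"
    using assms by (simp add: l2_norm_eq_L2_set L2_set_def)
  also have "\<dots> \<le> L2_set (\<lambda>i. l2_norm (row A i) * l2_norm v) {..<r}"
    using assms by (intro L2_set_mono abs_scalar_prod_le[of _ n]) auto
  finally show ?thesis by (simp add: L2_set_left_distrib)
qed

lemma spectral_norm_set_bdd:
  "bdd_above ((\<lambda>v. l2_norm (A *\<^sub>v v)) ` {v \<in> carrier_vec (dim_col A). l2_norm v \<le> 1})"
proof (rule bdd_aboveI2)
  fix v assume "v \<in> {v \<in> carrier_vec (dim_col A). l2_norm v \<le> 1}"
  then have v: "v \<in> carrier_vec (dim_col A)" "l2_norm v \<le> 1" by auto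
  have "l2_norm (A *\<^sub>v v) \<le> L2_set (\<lambda>i. l2_norm (row A i)) {..<dim_row A} * l2_norm v"
    using v by (intro l2_norm_mult_mat_vec_le_rows) auto
  also have "\<dots> \<le> L2_set (\<lambda>i. l2_norm (row A i)) {..<dim_row A} * 1"
    using v by (intro mult_left_mono) auto
  finally show "l2_norm (A *\<^sub>v v) \<le> L2_set (\<lambda>i. l2_norm (row A i)) {..<dim_row A}" by simp
qed

text \<open>Normalisation without a division, so that \<open>c = 0\<close> is covered.\<close>

lemma unit_ball_factor:
  assumes "v \<in> carrier_vec n" "l2_norm v \<le> c"
  obtains e where "e \<in> carrier_vec n" "l2_norm e \<le> 1" "v = c \<cdot>\<^sub>v e"
proof (cases "c = 0")
  case True
  then have "v = 0\<^sub>v n" using assms l2_norm_nonneg[of v] by (intro l2_norm_eq_0) auto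
  moreover have "(0\<^sub>v n :: real vec) = 0 \<cdot>\<^sub>v 0\<^sub>v n" by (intro eq_vecI) auto
  ultimately show ?thesis using True that[of "0\<^sub>v n"] by simp
next
  case False
  then have "c > 0" using assms l2_norm_nonneg[of v] by linarith
  then show ?thesis using assms that[of "(1 / c) \<cdot>\<^sub>v v"]
    by (auto simp: l2_norm_smult smult_smult_assoc)
qed

lemma spectral_norm_bound:
  assumes A: "A \<in> carrier_mat r n" and v: "v \<in> carrier_vec n"
  shows "l2_norm (A *\<^sub>v v) \<le> spectral_norm A * l2_norm v"
proof -
  obtain e where e: "e \<in> carrier_vec n" "l2_norm e \<le> 1" "v = l2_norm v \<cdot>\<^sub>v e"
    using unit_ball_factor[OF v order.refl] by blast
  have "A *\<^sub>v v = l2_norm v \<cdot>\<^sub>v (A *\<^sub>v e)"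
    by (subst e(3)) (use A e(1) in auto)
  then have "l2_norm (A *\<^sub>v v) = l2_norm v * l2_norm (A *\<^sub>v e)" by (simp add: l2_norm_smult)
  also have "\<dots> \<le> l2_norm v * spectral_norm A"
    unfolding spectral_norm_def using A e
    by (intro mult_left_mono cSUP_upper spectral_norm_set_bdd) auto
  finally show ?thesis by (simp add: mult.commute)
qed

lemma spectral_norm_nonneg [simp]: "0 \<le> spectral_norm A"
proof -
  have "l2_norm (A *\<^sub>v 0\<^sub>v (dim_col A)) \<le> spectral_norm A"
    unfolding spectral_norm_def by (intro cSUP_upper spectral_norm_set_bdd) auto
  then show ?thesis using l2_norm_nonneg order_trans by blast
qed

lemma l2_norm_pow_mat_bound:
  assumes A: "A \<in> carrier_mat n n" and "v \<in> carrier_vec n"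
  shows "l2_norm ((A ^\<^sub>m j) *\<^sub>v v) \<le> spectral_norm A ^ j * l2_norm v"
  using assms(2)
proof (induction j arbitrary: v)
  case 0
  then show ?case using A by simp
next
  case (Suc j)
  have "l2_norm ((A ^\<^sub>m Suc j) *\<^sub>v v) = l2_norm ((A ^\<^sub>m j) *\<^sub>v (A *\<^sub>v v))"
    using A Suc.prems by (simp add: assoc_mult_mat_vec[of _ n n _ n])
  also have "\<dots> \<le> spectral_norm A ^ j * l2_norm (A *\<^sub>v v)"
    using A Suc.prems by (intro Suc.IH) auto
  also have "\<dots> \<le> spectral_norm A ^ j * (spectral_norm A * l2_norm v)"
    using A Suc.prems by (intro mult_left_mono spectral_norm_bound) auto
  finally show ?case by (simp add: mult_ac)
qed

text \<open>Applied to the row itself, the operator bound gives the square of the row norm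
  as one coordinate of the image.\<close>

lemma row_norm_le_operator_bound:
  assumes M: "M \<in> carrier_mat r n" and i: "i < r"
    and bd: "\<And>v. v \<in> carrier_vec n \<Longrightarrow> l2_norm (M *\<^sub>v v) \<le> c * l2_norm v" and c: "0 \<le> c"
  shows "l2_norm (row M i) \<le> c"
proof -
  let ?v = "row M i"
  have v: "?v \<in> carrier_vec n" using M by auto
  have "(l2_norm ?v)\<^sup>2 = (M *\<^sub>v ?v) $ i" using M i by (simp add: l2_norm_power2)
  also have "\<dots> \<le> l2_norm (M *\<^sub>v ?v)"
    unfolding l2_norm_eq_L2_set using M i by (intro member_le_L2_set) auto
  also have "\<dots> \<le> c * l2_norm ?v" using bd[OF v] .
  finally show ?thesis using c l2_norm_nonneg[of ?v]
    by (cases "l2_norm ?v = 0") (auto simp: power2_eq_square)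
qed

section \<open>The noise that the Markov parameters leave unexplained\<close>

lemma pow_mat_Suc_left:
  assumes "A \<in> carrier_mat n n"
  shows "A * A ^\<^sub>m j = A ^\<^sub>m Suc j"
proof (induction j)
  case (Suc j)
  have "A * A ^\<^sub>m Suc j = (A * A ^\<^sub>m j) * A"
    using assms by (simp add: assoc_mult_mat[of _ n n _ n _ n])
  then show ?case using Suc by simp
qed (use assms in simp)

lemma pow_mat_shift:
  assumes "A \<in> carrier_mat n n" "M \<in> carrier_mat r n"
  shows "M * A * A ^\<^sub>m j = M * A ^\<^sub>m Suc j"
  by (simp only: assoc_mult_mat[OF assms(2,1) pow_carrier_mat[OF assms(1)]] pow_mat_Suc_left[OF assms(1)])

lemma recursion_unrolled:
  fixes x v :: "nat \<Rightarrow> real vec"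
  assumes A: "A \<in> carrier_mat n n" and M: "M \<in> carrier_mat r n" and i: "i < r"
    and x: "\<And>t. x t \<in> carrier_vec n" and v: "\<And>t. v t \<in> carrier_vec n"
    and rec: "\<And>t. x (Suc t) = A *\<^sub>v x t + v t"
  shows "(M *\<^sub>v x (\<tau> + j)) $ i =
    ((M * A ^\<^sub>m j) *\<^sub>v x \<tau>) $ i + (\<Sum>l<j. ((M * A ^\<^sub>m l) *\<^sub>v v (\<tau> + j - 1 - l)) $ i)"
  using M
proof (induction j arbitrary: M)
  case 0
  then show ?case using A by simp
next
  case (Suc j)
  have "M *\<^sub>v x (\<tau> + Suc j) = (M * A) *\<^sub>v x (\<tau> + j) + M *\<^sub>v v (\<tau> + j)"
    using Suc.prems A x v
    by (simp add: rec mult_add_distrib_mat_vec[of _ r n] assoc_mult_mat_vec[of _ r n _ n])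
  then have "(M *\<^sub>v x (\<tau> + Suc j)) $ i = ((M * A) *\<^sub>v x (\<tau> + j)) $ i + (M *\<^sub>v v (\<tau> + j)) $ i"
    using Suc.prems i by simp
  also have "((M * A) *\<^sub>v x (\<tau> + j)) $ i = ((M * A * A ^\<^sub>m j) *\<^sub>v x \<tau>) $ i +
      (\<Sum>l<j. ((M * A * A ^\<^sub>m l) *\<^sub>v v (\<tau> + j - 1 - l)) $ i)"
    using A Suc.prems by (intro Suc.IH) auto
  finally show ?case
    using A Suc.prems
    by (simp add: pow_mat_shift[OF A Suc.prems] sum.lessThan_Suc_shift del: sum.lessThan_Suc pow_mat.simps(2))
qed

text \<open>The triangle inequality along the recursion. Moving one factor \<open>A\<close> per step from the state into
  \<open>M\<close> is what makes the induction go through, hence the arbitrary matrix \<open>M\<close>.\<close>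

lemma recursion_norm_bound:
  fixes x v :: "nat \<Rightarrow> real vec"
  assumes A: "A \<in> carrier_mat n n" and M: "M \<in> carrier_mat r n"
    and x: "\<And>t. x t \<in> carrier_vec n" and v: "\<And>t. v t \<in> carrier_vec n"
    and rec: "\<And>t. x (Suc t) = A *\<^sub>v x t + v t"
  shows "l2_norm (M *\<^sub>v x \<tau>) \<le>
    l2_norm ((M * A ^\<^sub>m \<tau>) *\<^sub>v x 0) + (\<Sum>l<\<tau>. l2_norm ((M * A ^\<^sub>m l) *\<^sub>v v (\<tau> - 1 - l)))"
  using M
proof (induction \<tau> arbitrary: M)
  case 0
  then show ?case using A by simp
next
  case (Suc \<tau>)
  have "M *\<^sub>v x (Suc \<tau>) = (M * A) *\<^sub>v x \<tau> + M *\<^sub>v v \<tau>"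
    using Suc.prems A x v
    by (simp add: rec mult_add_distrib_mat_vec[of _ r n] assoc_mult_mat_vec[of _ r n _ n])
  then have "l2_norm (M *\<^sub>v x (Suc \<tau>)) \<le> l2_norm ((M * A) *\<^sub>v x \<tau>) + l2_norm (M *\<^sub>v v \<tau>)"
    using Suc.prems A x v by (simp add: l2_norm_triangle[of _ r])
  also have "l2_norm ((M * A) *\<^sub>v x \<tau>) \<le> l2_norm ((M * A * A ^\<^sub>m \<tau>) *\<^sub>v x 0) +
      (\<Sum>l<\<tau>. l2_norm ((M * A * A ^\<^sub>m l) *\<^sub>v v (\<tau> - 1 - l)))"
    using A Suc.prems by (intro Suc.IH) auto
  finally show ?case
    using A Suc.prems
    by (simp add: pow_mat_shift[OF A Suc.prems] sum.lessThan_Suc_shift del: sum.lessThan_Suc pow_mat.simps(2))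
qed

lemma block_sum_shift:
  fixes b m :: nat
  shows "(\<Sum>j\<in>{b * m..<b * m + m}. f j) = (\<Sum>c<m. f (b * m + c))"
  using sum.shift_bounds_nat_ivl[of f 0 "b * m" m] by (simp add: atLeast0LessThan add.commute)

text \<open>Block \<open>l + 1\<close> of the stacked input is \<open>u (t - 1 - l)\<close> and meets the Markov parameter
  \<open>C A\<^sup>l B\<close>; block 0 meets \<open>D\<close>.\<close>

lemma markov_parameters_mult_stacked_input:
  assumes k: "1 \<le> k" and m: "1 \<le> m" and i: "i < r" and t: "2 * k - 1 \<le> t"
    and A: "A \<in> carrier_mat n n" and B: "B \<in> carrier_mat n m"
    and C: "C \<in> carrier_mat r n" and D: "D \<in> carrier_mat r m"
    and u: "\<And>t. u t \<in> carrier_vec m"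
  shows "(markov_parameters k r m A B C D *\<^sub>v stacked_input k m u t) $ i =
    (D *\<^sub>v u t) $ i + (\<Sum>l<2 * k - 1. ((C * A ^\<^sub>m l) *\<^sub>v (B *\<^sub>v u (t - 1 - l))) $ i)"
proof -
  let ?G = "markov_parameters k r m A B C D"
  obtain L where L: "2 * k = Suc L" using k by (cases "2 * k") auto
  have "(?G *\<^sub>v stacked_input k m u t) $ i =
      (\<Sum>j<2 * k * m. ?G $$ (i, j) * u (t - j div m) $ (j mod m))"
    using i by (simp add: markov_parameters_def stacked_input_def scalar_prod_def atLeast0LessThan)
  also have "\<dots> = (\<Sum>b<2 * k. \<Sum>j\<in>{b * m..<b * m + m}. ?G $$ (i, j) * u (t - j div m) $ (j mod m))"
    by (rule sum.nat_group[symmetric])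
  also have "\<dots> = (\<Sum>b<2 * k. \<Sum>c<m. ?G $$ (i, b * m + c) * u (t - b) $ c)"
    unfolding block_sum_shift by (intro sum.cong refl) simp
  also have "\<dots> = (\<Sum>c<m. ?G $$ (i, c) * u t $ c) +
      (\<Sum>l<L. \<Sum>c<m. ?G $$ (i, Suc l * m + c) * u (t - Suc l) $ c)"
    unfolding L sum.lessThan_Suc_shift by simp
  also have "(\<Sum>c<m. ?G $$ (i, c) * u t $ c) = (D *\<^sub>v u t) $ i"
  proof -
    have "(\<Sum>c<m. ?G $$ (i, c) * u t $ c) = (\<Sum>c<m. D $$ (i, c) * u t $ c)"
    proof (rule sum.cong[OF refl])
      fix c assume "c \<in> {..<m}"
      moreover from this have "c < 2 * k * m" using k by (auto simp: L)
      ultimately show "?G $$ (i, c) * u t $ c = D $$ (i, c) * u t $ c"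
        using i by (simp add: markov_parameters_def)
    qed
    then show ?thesis using i D carrier_vecD[OF u[of t]] by (simp add: scalar_prod_def atLeast0LessThan)
  qed
  also have "(\<Sum>l<L. \<Sum>c<m. ?G $$ (i, Suc l * m + c) * u (t - Suc l) $ c) =
      (\<Sum>l<L. ((C * A ^\<^sub>m l) *\<^sub>v (B *\<^sub>v u (t - 1 - l))) $ i)"
  proof (rule sum.cong[OF refl])
    fix l assume l: "l \<in> {..<L}"
    have "(\<Sum>c<m. ?G $$ (i, Suc l * m + c) * u (t - Suc l) $ c) =
      (\<Sum>c<m. (C * A ^\<^sub>m l * B) $$ (i, c) * u (t - Suc l) $ c)"
    proof (rule sum.cong[OF refl])
      fix c assume c: "c \<in> {..<m}"
      have "Suc l * m + c < Suc (Suc l) * m" using c by simp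
      also have "\<dots> \<le> 2 * k * m" using l by (intro mult_right_mono) (auto simp: L)
      finally have "Suc l * m + c < 2 * k * m" .
      moreover have "(Suc l * m + c) div m = Suc l" "(Suc l * m + c) mod m = c"
        using c by (simp_all only: div_mult_self3 mod_mult_self3 div_less mod_less lessThan_iff)
      ultimately show "?G $$ (i, Suc l * m + c) * u (t - Suc l) $ c =
          (C * A ^\<^sub>m l * B) $$ (i, c) * u (t - Suc l) $ c"
        using i by (simp add: markov_parameters_def)
    qed
    also have "\<dots> = ((C * A ^\<^sub>m l * B) *\<^sub>v u (t - Suc l)) $ i"
      using i B C carrier_vecD[OF u[of "t - Suc l"]]
      by (simp add: scalar_prod_def atLeast0LessThan)
    also have "\<dots> = ((C * A ^\<^sub>m l) *\<^sub>v (B *\<^sub>v u (t - Suc l))) $ i"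
      using A B C u by (subst assoc_mult_mat_vec[of _ r n _ m]) auto
    finally show "(\<Sum>c<m. ?G $$ (i, Suc l * m + c) * u (t - Suc l) $ c) =
      ((C * A ^\<^sub>m l) *\<^sub>v (B *\<^sub>v u (t - 1 - l))) $ i" by simp
  qed
  finally show ?thesis by (simp add: L)
qed

lemma linear_system_carrier:
  assumes sys: "linear_system A B C D x y u w"
    and x0: "x 0 \<in> carrier_vec n" and w: "\<And>t. w t \<in> carrier_vec n"
  shows "x t \<in> carrier_vec n"
proof (cases t)
  case (Suc s)
  have "x (Suc s) = A *\<^sub>v x s + B *\<^sub>v u s + w s" using sys by (simp add: linear_system_def)
  then have "dim_vec (x t) = dim_vec (w s)" unfolding Suc by (simp only: index_add_vec(2))
  also have "\<dots> = n" using w by (rule carrier_vecD)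
  finally show ?thesis by (rule carrier_vecI)
qed (use x0 in simp)

text \<open>The inputs of the window cancel against the Markov parameters. What is left is the state at the
  start of the window and the attacks inside it.\<close>

lemma residual_decomposition:
  assumes sys: "linear_system A B C D x y u w"
    and k: "1 \<le> k" and m: "1 \<le> m" and i: "i < r"
    and A: "A \<in> carrier_mat n n" and B: "B \<in> carrier_mat n m"
    and C: "C \<in> carrier_mat r n" and D: "D \<in> carrier_mat r m"
    and x0: "x 0 \<in> carrier_vec n" and w: "\<And>t. w t \<in> carrier_vec n"
    and u: "\<And>t. u t \<in> carrier_vec m"
  shows "y (\<tau> + (2 * k - 1)) $ i -
      (markov_parameters k r m A B C D *\<^sub>v stacked_input k m u (\<tau> + (2 * k - 1))) $ i =
    ((C * A ^\<^sub>m (2 * k - 1)) *\<^sub>v x \<tau>) $ i +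
    (\<Sum>l<2 * k - 1. ((C * A ^\<^sub>m l) *\<^sub>v w (\<tau> + (2 * k - 1) - 1 - l)) $ i)"
proof -
  let ?L = "2 * k - 1"
  have x: "x t \<in> carrier_vec n" for t by (rule linear_system_carrier[OF sys x0 w])
  have v: "B *\<^sub>v u t + w t \<in> carrier_vec n" for t using B u w by simp
  have rec: "x (Suc t) = A *\<^sub>v x t + (B *\<^sub>v u t + w t)" for t
    using sys A B x u w unfolding linear_system_def
    by (simp add: assoc_add_vec[of _ n])
  have "(C *\<^sub>v x (\<tau> + ?L)) $ i = ((C * A ^\<^sub>m ?L) *\<^sub>v x \<tau>) $ i +
      (\<Sum>l<?L. ((C * A ^\<^sub>m l) *\<^sub>v (B *\<^sub>v u (\<tau> + ?L - 1 - l) + w (\<tau> + ?L - 1 - l))) $ i)"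
    by (rule recursion_unrolled[where x = x and v = "\<lambda>t. B *\<^sub>v u t + w t", OF A C i x v rec])
  also have "(\<Sum>l<?L. ((C * A ^\<^sub>m l) *\<^sub>v (B *\<^sub>v u (\<tau> + ?L - 1 - l) + w (\<tau> + ?L - 1 - l))) $ i) =
      (\<Sum>l<?L. ((C * A ^\<^sub>m l) *\<^sub>v (B *\<^sub>v u (\<tau> + ?L - 1 - l))) $ i) +
      (\<Sum>l<?L. ((C * A ^\<^sub>m l) *\<^sub>v w (\<tau> + ?L - 1 - l)) $ i)"
    unfolding sum.distrib[symmetric]
  proof (rule sum.cong[OF refl])
    fix l
    have "(C * A ^\<^sub>m l) *\<^sub>v (B *\<^sub>v u (\<tau> + ?L - 1 - l) + w (\<tau> + ?L - 1 - l)) =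
      (C * A ^\<^sub>m l) *\<^sub>v (B *\<^sub>v u (\<tau> + ?L - 1 - l)) + (C * A ^\<^sub>m l) *\<^sub>v w (\<tau> + ?L - 1 - l)"
      using A B C u w by (intro mult_add_distrib_mat_vec[of _ r n]) auto
    then show "((C * A ^\<^sub>m l) *\<^sub>v (B *\<^sub>v u (\<tau> + ?L - 1 - l) + w (\<tau> + ?L - 1 - l))) $ i =
      ((C * A ^\<^sub>m l) *\<^sub>v (B *\<^sub>v u (\<tau> + ?L - 1 - l))) $ i + ((C * A ^\<^sub>m l) *\<^sub>v w (\<tau> + ?L - 1 - l)) $ i"
      using C i by simp
  qed
  moreover have "y (\<tau> + ?L) $ i = (C *\<^sub>v x (\<tau> + ?L)) $ i + (D *\<^sub>v u (\<tau> + ?L)) $ i"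
    using sys C D i unfolding linear_system_def by simp
  moreover have "(markov_parameters k r m A B C D *\<^sub>v stacked_input k m u (\<tau> + ?L)) $ i =
      (D *\<^sub>v u (\<tau> + ?L)) $ i +
      (\<Sum>l<?L. ((C * A ^\<^sub>m l) *\<^sub>v (B *\<^sub>v u (\<tau> + ?L - 1 - l))) $ i)"
    by (rule markov_parameters_mult_stacked_input[OF k m i _ A B C D u]) simp
  ultimately show ?thesis by linarith
qed

section \<open>The least absolute deviation estimator, row by row\<close>

definition lad_loss :: "nat \<Rightarrow> nat \<Rightarrow> nat \<Rightarrow> (nat \<Rightarrow> real vec) \<Rightarrow> (nat \<Rightarrow> real vec) \<Rightarrow> real mat \<Rightarrow> real" where
  "lad_loss k m T y u G =
     (\<Sum>t = 2 * k - 1..T + 2 * k - 2. l1_norm (y t - G *\<^sub>v stacked_input k m u t))"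

lemma window_sum_reindex:
  fixes k T :: nat
  assumes "1 \<le> k"
  shows "(\<Sum>t = 2 * k - 1..T + 2 * k - 2. f t) = (\<Sum>\<tau><T. f (\<tau> + (2 * k - 1)))"
proof -
  have "{2 * k - 1..T + 2 * k - 2} = {0 + (2 * k - 1)..<T + (2 * k - 1)}" using assms by auto
  then show ?thesis
    by (simp only: sum.shift_bounds_nat_ivl atLeast0LessThan)
qed

text \<open>The loss is a sum of one loss per row, so replacing a single row of the minimiser by
  the corresponding row of any competitor cannot decrease it.\<close>

lemma lad_solution_row_optimal:
  assumes G: "lad_solution k r m T y u G" and H: "H \<in> carrier_mat r (2 * k * m)"
    and k: "1 \<le> k" and i: "i < r"
  shows "(\<Sum>\<tau><T. \<bar>y (\<tau> + (2 * k - 1)) $ i - row G i \<bullet> stacked_input k m u (\<tau> + (2 * k - 1))\<bar>) \<le>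
    (\<Sum>\<tau><T. \<bar>y (\<tau> + (2 * k - 1)) $ i - row H i \<bullet> stacked_input k m u (\<tau> + (2 * k - 1))\<bar>)"
proof -
  let ?U = "\<lambda>\<tau>. stacked_input k m u (\<tau> + (2 * k - 1))" and ?y = "\<lambda>\<tau>. y (\<tau> + (2 * k - 1))"
  define G' where "G' = mat r (2 * k * m) (\<lambda>(a, b). if a = i then H $$ (a, b) else G $$ (a, b))"
  have Gc: "G \<in> carrier_mat r (2 * k * m)" using G by (simp add: lad_solution_def is_arg_min_def)
  have loss: "lad_loss k m T y u F = (\<Sum>a<r. \<Sum>\<tau><T. \<bar>?y \<tau> $ a - row F a \<bullet> ?U \<tau>\<bar>)"
    if "F \<in> carrier_mat r (2 * k * m)" for F
  proof -
    have "lad_loss k m T y u F = (\<Sum>\<tau><T. \<Sum>a<r. \<bar>?y \<tau> $ a - row F a \<bullet> ?U \<tau>\<bar>)"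
      unfolding lad_loss_def window_sum_reindex[OF k] l1_norm_def using that by simp
    also have "\<dots> = (\<Sum>a<r. \<Sum>\<tau><T. \<bar>?y \<tau> $ a - row F a \<bullet> ?U \<tau>\<bar>)" by (rule sum.swap)
    finally show ?thesis .
  qed
  have "G' \<in> carrier_mat r (2 * k * m)" by (simp add: G'_def)
  then have "lad_loss k m T y u G \<le> lad_loss k m T y u G'"
    using G unfolding lad_solution_def is_arg_min_linorder lad_loss_def by blast
  then have "(\<Sum>a<r. \<Sum>\<tau><T. \<bar>?y \<tau> $ a - row G a \<bullet> ?U \<tau>\<bar>) \<le> (\<Sum>a<r. \<Sum>\<tau><T. \<bar>?y \<tau> $ a - row G' a \<bullet> ?U \<tau>\<bar>)"
    using loss[OF Gc] loss[of G'] by (simp add: G'_def)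
  moreover have "row G' a = row G a" if "a < r" "a \<noteq> i" for a
    using that Gc by (auto simp: G'_def)
  then have "(\<Sum>a\<in>{..<r} - {i}. \<Sum>\<tau><T. \<bar>?y \<tau> $ a - row G' a \<bullet> ?U \<tau>\<bar>) =
      (\<Sum>a\<in>{..<r} - {i}. \<Sum>\<tau><T. \<bar>?y \<tau> $ a - row G a \<bullet> ?U \<tau>\<bar>)" by (intro sum.cong) auto
  moreover have "row G' i = row H i" using i H by (auto simp: G'_def)
  ultimately show ?thesis using i by (simp add: sum.remove[of "{..<r}" i])
qed

lemma L2_set_sum_le:
  assumes "finite T"
  shows "L2_set (\<lambda>i. \<Sum>t\<in>T. f t i) I \<le> (\<Sum>t\<in>T. L2_set (f t) I)"
  using assms
proof (induction T rule: finite_induct)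
  case (insert a T)
  then show ?case
    using L2_set_triangle_ineq[of "f a" "\<lambda>i. \<Sum>t\<in>T. f t i" I] by simp
qed (simp add: L2_set_def)

lemma frobenius_norm_eq_rows:
  "frobenius_norm A = L2_set (\<lambda>i. l2_norm (row A i)) {..<dim_row A}"
  by (simp add: frobenius_norm_def L2_set_def l2_norm_eq_L2_set sum_nonneg)

text \<open>Every window without an attack pulls the estimate towards the truth with strength
  \<open>\<bar>z \<bullet> U\<bar>\<close>, up to twice the residual, and every attacked window pushes it away with strength at
  most \<open>\<bar>z \<bullet> U\<bar>\<close>, however large the attack is. If the pull dominates uniformly in the
  direction \<open>z\<close>, the error is controlled by the residuals of the clean windows alone.\<close>

lemma lad_error_bound:
  fixes good :: "nat \<Rightarrow> bool"
  assumes sys: "linear_system A B C D x y u w"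
    and k: "1 \<le> k" and m: "1 \<le> m"
    and A: "A \<in> carrier_mat n n" and B: "B \<in> carrier_mat n m"
    and C: "C \<in> carrier_mat r n" and D: "D \<in> carrier_mat r m"
    and x0: "x 0 \<in> carrier_vec n" and w: "\<And>t. w t \<in> carrier_vec n"
    and u: "\<And>t. u t \<in> carrier_vec m"
    and good: "\<And>\<tau> l. good \<tau> \<Longrightarrow> l < 2 * k - 1 \<Longrightarrow> w (\<tau> + l) = 0\<^sub>v n"
    and kappa: "0 < \<kappa>"
    and pull: "\<And>z. z \<in> carrier_vec (2 * k * m) \<Longrightarrow>
      \<kappa> * l2_norm z \<le> (\<Sum>\<tau><T. (if good \<tau> then 1 else - 1) *
        \<bar>z \<bullet> stacked_input k m u (\<tau> + (2 * k - 1))\<bar>)"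
    and R: "(\<Sum>\<tau><T. l2_norm ((C * A ^\<^sub>m (2 * k - 1)) *\<^sub>v x \<tau>)) \<le> R"
    and G: "lad_solution k r m T y u G"
  shows "frobenius_norm (markov_parameters k r m A B C D - G) \<le> 2 * R / \<kappa>"
proof -
  let ?L = "2 * k - 1" and ?H = "markov_parameters k r m A B C D" and ?M = "C * A ^\<^sub>m (2 * k - 1)"
  let ?U = "\<lambda>\<tau>. stacked_input k m u (\<tau> + (2 * k - 1))" and ?y = "\<lambda>\<tau>. y (\<tau> + (2 * k - 1))"
  have H: "?H \<in> carrier_mat r (2 * k * m)" by (simp add: markov_parameters_def)
  have Gc: "G \<in> carrier_mat r (2 * k * m)" using G by (simp add: lad_solution_def is_arg_min_def)
  have U: "?U \<tau> \<in> carrier_vec (2 * k * m)" for \<tau> by (simp add: stacked_input_def)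
  have rows: "l2_norm (row (?H - G) i) \<le> (2 / \<kappa>) * (\<Sum>\<tau><T. \<bar>(?M *\<^sub>v x \<tau>) $ i\<bar>)" if i: "i < r" for i
  proof -
    let ?z = "row (?H - G) i"
    define e where "e \<tau> = ?y \<tau> $ i - row ?H i \<bullet> ?U \<tau>" for \<tau>
    have z: "?z \<in> carrier_vec (2 * k * m)"
      using minus_carrier_mat[OF Gc, of ?H] by (metis row_carrier carrier_matD(2))
    have "?z = row ?H i - row G i" using H Gc i by auto
    then have zU: "?z \<bullet> ?U \<tau> = row ?H i \<bullet> ?U \<tau> - row G i \<bullet> ?U \<tau>" for \<tau>
      using H Gc U by (metis minus_scalar_prod_distrib row_carrier carrier_matD(2))
    have e_good: "e \<tau> = (?M *\<^sub>v x \<tau>) $ i" if "good \<tau>" for \<tau>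
    proof -
      have "w (\<tau> + ?L - 1 - l) = 0\<^sub>v n" if "l < ?L" for l
        using good[OF \<open>good \<tau>\<close>, of "?L - 1 - l"] that by simp
      then have "(\<Sum>l<?L. ((C * A ^\<^sub>m l) *\<^sub>v w (\<tau> + ?L - 1 - l)) $ i) = (\<Sum>l<?L. 0)"
        using i A C by (intro sum.cong) auto
      then show ?thesis
        using residual_decomposition[OF sys k m i A B C D x0 w u, of \<tau>] i H
        by (simp add: e_def)
    qed
    have pointwise: "(if good \<tau> then 1 else - 1) * \<bar>?z \<bullet> ?U \<tau>\<bar> \<le>
        \<bar>?y \<tau> $ i - row G i \<bullet> ?U \<tau>\<bar> - \<bar>e \<tau>\<bar> + 2 * \<bar>(?M *\<^sub>v x \<tau>) $ i\<bar>" for \<tau>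
    proof -
      have "?y \<tau> $ i - row G i \<bullet> ?U \<tau> = e \<tau> + ?z \<bullet> ?U \<tau>"
        using zU[of \<tau>] unfolding e_def by linarith
      moreover have "(if g then 1 else - 1) * \<bar>s\<bar> \<le> \<bar>b\<bar> - \<bar>c\<bar> + 2 * \<bar>h\<bar>"
        if "b = c + s" "g \<Longrightarrow> c = h" for b c s h :: real and g
        using that by (cases g) (auto simp: abs_if)
      ultimately show ?thesis using e_good[of \<tau>] by blast
    qed
    have "\<kappa> * l2_norm ?z \<le> (\<Sum>\<tau><T. (if good \<tau> then 1 else - 1) * \<bar>?z \<bullet> ?U \<tau>\<bar>)"
      by (rule pull[OF z])
    also have "\<dots> \<le> (\<Sum>\<tau><T. \<bar>?y \<tau> $ i - row G i \<bullet> ?U \<tau>\<bar> - \<bar>e \<tau>\<bar> + 2 * \<bar>(?M *\<^sub>v x \<tau>) $ i\<bar>)"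
      by (intro sum_mono pointwise)
    also have "\<dots> \<le> 2 * (\<Sum>\<tau><T. \<bar>(?M *\<^sub>v x \<tau>) $ i\<bar>)"
      using lad_solution_row_optimal[OF G H k i]
      by (simp add: sum.distrib sum_subtractf sum_distrib_left e_def)
    finally show ?thesis using kappa by (simp add: field_simps)
  qed
  have "frobenius_norm (?H - G) = L2_set (\<lambda>i. l2_norm (row (?H - G) i)) {..<r}"
    using Gc by (simp add: frobenius_norm_eq_rows)
  also have "\<dots> \<le> L2_set (\<lambda>i. (2 / \<kappa>) * (\<Sum>\<tau><T. \<bar>(?M *\<^sub>v x \<tau>) $ i\<bar>)) {..<r}"
    using rows by (intro L2_set_mono) auto
  also have "\<dots> = (2 / \<kappa>) * L2_set (\<lambda>i. \<Sum>\<tau><T. \<bar>(?M *\<^sub>v x \<tau>) $ i\<bar>) {..<r}"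
    using kappa by (intro L2_set_right_distrib[symmetric]) simp
  also have "\<dots> \<le> (2 / \<kappa>) * (\<Sum>\<tau><T. L2_set (\<lambda>i. \<bar>(?M *\<^sub>v x \<tau>) $ i\<bar>) {..<r})"
    using kappa by (intro mult_left_mono L2_set_sum_le) auto
  also have "(\<Sum>\<tau><T. L2_set (\<lambda>i. \<bar>(?M *\<^sub>v x \<tau>) $ i\<bar>) {..<r}) = (\<Sum>\<tau><T. l2_norm (?M *\<^sub>v x \<tau>))"
    using C by (simp add: l2_norm_eq_L2_set L2_set_def)
  also have "(2 / \<kappa>) * (\<Sum>\<tau><T. l2_norm (?M *\<^sub>v x \<tau>)) \<le> (2 / \<kappa>) * R"
    using kappa R by (intro mult_left_mono) auto
  finally show ?thesis by simp
qed

section \<open>Random vectors and Gaussian laws\<close>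

lemma space_borel_vec [simp]: "space (borel_vec d) = carrier_vec d"
  by (simp add: borel_vec_def)

lemma measurable_vec_index [measurable]:
  "i < d \<Longrightarrow> (\<lambda>v. v $ i) \<in> borel_measurable (borel_vec d)"
proof -
  assume i: "i < d"
  have "(\<lambda>v. \<lambda>i\<in>{..<d}. v $ i) \<in> borel_vec d \<rightarrow>\<^sub>M (\<Pi>\<^sub>M i\<in>{..<d}. (borel :: real measure))"
    unfolding borel_vec_def by (rule measurable_vimage_algebra1) (auto simp: space_PiM)
  from measurable_compose[OF this measurable_component_singleton[of i]] i
  show ?thesis by simp
qed

lemma measurable_vec_of_components:
  assumes "\<And>i. i < d \<Longrightarrow> (\<lambda>\<omega>. f \<omega> i) \<in> borel_measurable M"
  shows "(\<lambda>\<omega>. vec d (f \<omega>)) \<in> M \<rightarrow>\<^sub>M borel_vec d"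
  unfolding borel_vec_def
proof (rule measurable_vimage_algebra2)
  have "(\<lambda>x. \<lambda>i\<in>{..<d}. f x i) \<in> M \<rightarrow>\<^sub>M Pi\<^sub>M {..<d} (\<lambda>_. borel)"
    using assms by (intro measurable_restrict) auto
  also have "(\<lambda>x. \<lambda>i\<in>{..<d}. f x i) = (\<lambda>x. \<lambda>i\<in>{..<d}. vec d (f x) $ i)"
    by (auto simp: fun_eq_iff restrict_def)
  finally show "(\<lambda>x. \<lambda>i\<in>{..<d}. vec d (f x) $ i) \<in> M \<rightarrow>\<^sub>M Pi\<^sub>M {..<d} (\<lambda>_. borel)" .
qed auto

lemma random_vec_carrier:
  "X \<in> M \<rightarrow>\<^sub>M borel_vec d \<Longrightarrow> \<omega> \<in> space M \<Longrightarrow> X \<omega> \<in> carrier_vec d"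
  using measurable_space[of X M "borel_vec d"] by simp

lemma measurable_scalar_prod:
  assumes X: "X \<in> M \<rightarrow>\<^sub>M borel_vec d" and v: "v \<in> carrier_vec d"
  shows "(\<lambda>\<omega>. X \<omega> \<bullet> v) \<in> borel_measurable M" "(\<lambda>\<omega>. v \<bullet> X \<omega>) \<in> borel_measurable M"
proof -
  have "(\<lambda>\<omega>. \<Sum>i<d. X \<omega> $ i * v $ i) \<in> borel_measurable M"
    using measurable_compose[OF X measurable_vec_index] by (intro borel_measurable_sum borel_measurable_times) auto
  then show 1: "(\<lambda>\<omega>. X \<omega> \<bullet> v) \<in> borel_measurable M"
    using v by (simp add: scalar_prod_def atLeast0LessThan)
  show "(\<lambda>\<omega>. v \<bullet> X \<omega>) \<in> borel_measurable M"
    using 1 random_vec_carrier[OF X] by (subst measurable_cong[OF comm_scalar_prod[OF v]]) auto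
qed

lemma measurable_l2_norm_mult:
  assumes X: "X \<in> M \<rightarrow>\<^sub>M borel_vec d" and A: "A \<in> carrier_mat r d"
  shows "(\<lambda>\<omega>. l2_norm (A *\<^sub>v X \<omega>)) \<in> borel_measurable M"
proof -
  have [measurable]: "(\<lambda>\<omega>. row A i \<bullet> X \<omega>) \<in> borel_measurable M" for i
    using A by (intro measurable_scalar_prod[OF X]) auto
  have "(\<lambda>\<omega>. sqrt (\<Sum>i<r. (row A i \<bullet> X \<omega>)\<^sup>2)) \<in> borel_measurable M" by measurable
  then show ?thesis using A by (simp add: l2_norm_eq_L2_set L2_set_def)
qed

lemma measurable_l2_norm:
  assumes X: "X \<in> M \<rightarrow>\<^sub>M borel_vec d"
  shows "(\<lambda>\<omega>. l2_norm (X \<omega>)) \<in> borel_measurable M"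
  using measurable_l2_norm_mult[OF X, of "1\<^sub>m d" d] random_vec_carrier[OF X]
  by (subst measurable_cong[where g = "\<lambda>\<omega>. l2_norm (1\<^sub>m d *\<^sub>v X \<omega>)"]) auto

text \<open>The case of variance zero is kept as a point mass, so that the class is closed under
  all linear combinations.\<close>

definition centred_normal :: "real \<Rightarrow> real measure" where
  "centred_normal \<sigma> = (if \<sigma> = 0 then return borel 0
     else density lborel (\<lambda>x. ennreal (normal_density 0 \<sigma> x)))"

lemma sets_centred_normal [measurable_cong, simp]: "sets (centred_normal \<sigma>) = sets borel"
  by (simp add: centred_normal_def)

lemma distributed_normal_iff:
  assumes "0 < \<sigma>"
  shows "distributed M lborel X (\<lambda>x. ennreal (normal_density 0 \<sigma> x)) \<longleftrightarrow>
    X \<in> borel_measurable M \<and> distr M borel X = centred_normal \<sigma>"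
proof -
  have "distr M lborel X = distr M borel X" by (rule distr_cong) auto
  then show ?thesis using assms by (auto simp: distributed_def centred_normal_def)
qed

context prob_space
begin

lemma zero_of_degenerate_law:
  assumes X: "X \<in> borel_measurable M" and d: "distr M borel X = centred_normal 0"
  shows "AE \<omega> in M. X \<omega> = 0"
proof -
  have "AE x in distr M borel X. x = (0::real)"
    unfolding d centred_normal_def by (simp, subst AE_return) auto
  then show ?thesis using X by (subst (asm) AE_distr_iff) auto
qed

lemma degenerate_law:
  assumes X: "X \<in> borel_measurable M" and z: "AE \<omega> in M. X \<omega> = 0"
  shows "distr M borel X = centred_normal 0"
proof -
  have "distr M borel X = distr M borel (\<lambda>_. 0)"
    using X z by (intro distr_cong_AE) auto
  then show ?thesis by (simp add: centred_normal_def distr_const)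
qed

lemma centred_normal_scale:
  assumes X: "X \<in> borel_measurable M" and d: "distr M borel X = centred_normal \<sigma>" and s: "0 \<le> \<sigma>"
  shows "distr M borel (\<lambda>\<omega>. c * X \<omega>) = centred_normal (\<bar>c\<bar> * \<sigma>)"
proof (cases "c = 0 \<or> \<sigma> = 0")
  case True
  then have "AE \<omega> in M. c * X \<omega> = 0" using zero_of_degenerate_law[OF X] d by auto
  then have "distr M borel (\<lambda>\<omega>. c * X \<omega>) = centred_normal 0"
    using X by (intro degenerate_law) auto
  then show ?thesis using True by auto
next
  case False
  then have "distributed M lborel X (normal_density 0 \<sigma>)"
    using X d s by (subst distributed_normal_iff) auto
  from normal_density_affine[OF this, of c 0] False s
  have "distributed M lborel (\<lambda>\<omega>. c * X \<omega>) (normal_density 0 (\<bar>c\<bar> * \<sigma>))" by simp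
  then show ?thesis using False s by (subst (asm) distributed_normal_iff) auto
qed

lemma centred_normal_sum:
  assumes I: "finite I" and ind: "indep_vars (\<lambda>_. borel) X I"
    and d: "\<And>i. i \<in> I \<Longrightarrow> distr M borel (X i) = centred_normal (\<sigma> i)"
    and s: "\<And>i. i \<in> I \<Longrightarrow> 0 \<le> \<sigma> i"
  shows "distr M borel (\<lambda>\<omega>. \<Sum>i\<in>I. X i \<omega>) = centred_normal (sqrt (\<Sum>i\<in>I. (\<sigma> i)\<^sup>2))"
proof -
  define J where "J = {i\<in>I. \<sigma> i \<noteq> 0}"
  have J: "J \<subseteq> I" "finite J" using I by (auto simp: J_def)
  have X: "X i \<in> borel_measurable M" if "i \<in> I" for i using ind that by (auto simp: indep_vars_def)
  have "AE \<omega> in M. \<forall>i\<in>I - J. X i \<omega> = 0"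
  proof (rule AE_finite_allI)
    fix i assume "i \<in> I - J"
    then show "AE \<omega> in M. X i \<omega> = 0" using d[of i] X by (intro zero_of_degenerate_law) (auto simp: J_def)
  qed (use I in auto)
  then have eq: "AE \<omega> in M. (\<Sum>i\<in>I. X i \<omega>) = (\<Sum>i\<in>J. X i \<omega>)"
  proof (rule AE_mp, intro AE_I2 impI)
    fix \<omega> assume "\<forall>i\<in>I - J. X i \<omega> = 0"
    then show "(\<Sum>i\<in>I. X i \<omega>) = (\<Sum>i\<in>J. X i \<omega>)"
      using J I by (intro sum.mono_neutral_right) auto
  qed
  have sq: "(\<Sum>i\<in>I. (\<sigma> i)\<^sup>2) = (\<Sum>i\<in>J. (\<sigma> i)\<^sup>2)"
    using J I by (intro sum.mono_neutral_right) (auto simp: J_def)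
  have "distr M borel (\<lambda>\<omega>. \<Sum>i\<in>I. X i \<omega>) = distr M borel (\<lambda>\<omega>. \<Sum>i\<in>J. X i \<omega>)"
    using eq X J by (intro distr_cong_AE borel_measurable_sum) auto
  also have "\<dots> = centred_normal (sqrt (\<Sum>i\<in>J. (\<sigma> i)\<^sup>2))"
  proof (cases "J = {}")
    case True
    then show ?thesis by (simp add: centred_normal_def distr_const)
  next
    case False
    have pos: "0 < \<sigma> i" if "i \<in> J" for i using that s[of i] by (auto simp: J_def)
    have "distributed M lborel (X i) (normal_density 0 (\<sigma> i))" if "i \<in> J" for i
      using that J X[of i] d[of i] pos[OF that] by (subst distributed_normal_iff) auto
    from sum_indep_normal[OF J(2) False indep_vars_subset[OF ind J(1)] pos this]
    have *: "distributed M lborel (\<lambda>x. \<Sum>i\<in>J. X i x) (normal_density 0 (sqrt (\<Sum>i\<in>J. (\<sigma> i)\<^sup>2)))" by simp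
    have "0 < sqrt (\<Sum>i\<in>J. (\<sigma> i)\<^sup>2)" 
      unfolding real_sqrt_gt_0_iff
      by (rule sum_pos[OF J(2) False]) (use pos in \<open>simp add: less_imp_neq[symmetric]\<close>)
    from distributed_normal_iff[OF this] * show ?thesis by blast
  qed
  finally show ?thesis by (simp add: sq)
qed

end

lemma indep_vars_PiM_coordinates:
  assumes P: "\<And>i. i \<in> I \<Longrightarrow> prob_space (N i)" and ne: "I \<noteq> {}"
  shows "prob_space.indep_vars (Pi\<^sub>M I N) N (\<lambda>i \<omega>. \<omega> i) I"
proof -
  interpret prob_space "Pi\<^sub>M I N" using P by (rule prob_space_PiM)
  have "distr (Pi\<^sub>M I N) (Pi\<^sub>M I N) (\<lambda>x. \<lambda>i\<in>I. x i) = distr (Pi\<^sub>M I N) (Pi\<^sub>M I N) (\<lambda>x. x)"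
    by (intro distr_cong) (auto simp: space_PiM PiE_restrict)
  also have "\<dots> = Pi\<^sub>M I N" by (rule distr_id)
  also have "\<dots> = (\<Pi>\<^sub>M i\<in>I. distr (Pi\<^sub>M I N) (N i) (\<lambda>\<omega>. \<omega> i))"
    using P by (intro PiM_cong refl) (simp add: distr_PiM_component)
  finally show ?thesis
    using ne by (subst indep_vars_iff_distr_eq_PiM') auto
qed

text \<open>The coordinates of an isotropic Gaussian are independent, so a linear form is a sum of
  independent centred normal variables.\<close>

lemma (in prob_space) linear_form_of_isotropic_gaussian:
  assumes X: "X \<in> M \<rightarrow>\<^sub>M borel_vec m" and d: "distr M (borel_vec m) X = isotropic_gaussian m \<gamma>"
    and g: "0 < \<gamma>" and v: "v \<in> carrier_vec m"
  shows "distr M borel (\<lambda>\<omega>. v \<bullet> X \<omega>) = centred_normal (\<gamma> * l2_norm v)"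
proof -
  define N where "N = density lborel (\<lambda>z. ennreal (normal_density 0 \<gamma> z))"
  define P where "P = Pi\<^sub>M {..<m} (\<lambda>_. N)"
  have N: "prob_space N" "sets N = sets borel" and Nc: "N = centred_normal \<gamma>"
    using g by (auto simp: N_def centred_normal_def intro: prob_space_normal_density)
  interpret P: prob_space P unfolding P_def using N by (intro prob_space_PiM)
  have comp: "(\<lambda>f. f i) \<in> borel_measurable P" if "i < m" for i
  proof -
    have "(\<lambda>f. f i) \<in> measurable P N" unfolding P_def by (rule measurable_component_singleton) (use that in simp)
    then show ?thesis using N(2) by (simp cong: measurable_cong_sets)
  qed
  have vecm: "vec m \<in> P \<rightarrow>\<^sub>M borel_vec m"
    using measurable_vec_of_components[of m "\<lambda>f. f" P] comp by simp
  have form: "(\<lambda>x. v \<bullet> x) \<in> borel_measurable (borel_vec m)"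
    by (rule measurable_scalar_prod[OF _ v]) simp
  have "distr M borel (\<lambda>\<omega>. v \<bullet> X \<omega>) = distr (distr M (borel_vec m) X) borel (\<lambda>x. v \<bullet> x)"
    by (subst distr_distr[OF form X]) (simp add: comp_def)
  also have "distr M (borel_vec m) X = distr P (borel_vec m) (vec m)"
    unfolding d isotropic_gaussian_def P_def N_def by simp
  also have "distr (distr P (borel_vec m) (vec m)) borel (\<lambda>x. v \<bullet> x) =
      distr P borel (\<lambda>f. \<Sum>i<m. v $ i * f i)"
    by (subst distr_distr[OF form vecm]) (simp add: comp_def scalar_prod_def atLeast0LessThan)
  also have "\<dots> = centred_normal (sqrt (\<Sum>i<m. (\<bar>v $ i\<bar> * \<gamma>)\<^sup>2))"
  proof (rule P.centred_normal_sum)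
    show "P.indep_vars (\<lambda>_. borel) (\<lambda>i f. v $ i * f i) {..<m}"
    proof (cases "m = 0")
      case True
      then show ?thesis by (simp add: P.indep_vars_def P.indep_sets_def)
    next
      case False
      then have "P.indep_vars (\<lambda>_. N) (\<lambda>i f. f i) {..<m}"
        unfolding P_def using N by (intro indep_vars_PiM_coordinates) auto
      then show ?thesis
        by (rule P.indep_vars_compose2) (use N(2) in \<open>simp cong: measurable_cong_sets\<close>)
    qed
    fix i assume i: "i \<in> {..<m}"
    have "distr P borel (\<lambda>f. f i) = distr P N (\<lambda>f. f i)" using N by (intro distr_cong) auto
    also have "\<dots> = N" unfolding P_def using N i by (intro distr_PiM_component) auto
    finally show "distr P borel (\<lambda>f. v $ i * f i) = centred_normal (\<bar>v $ i\<bar> * \<gamma>)"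
      using g comp i unfolding Nc by (intro P.centred_normal_scale) auto
  qed (use g in auto)
  also have "sqrt (\<Sum>i<m. (\<bar>v $ i\<bar> * \<gamma>)\<^sup>2) = \<gamma> * l2_norm v"
    using g v by (simp add: l2_norm_eq_L2_set L2_set_def power_mult_distrib real_sqrt_mult flip: sum_distrib_right)
  finally show ?thesis .
qed

section \<open>Exponential moments of a centred normal variable\<close>

text \<open>Completing the square: an exponential factor shifts the mean of the normal density.\<close>

lemma normal_mgf:
  assumes "0 < \<sigma>"
  shows "has_bochner_integral lborel (\<lambda>x. normal_density 0 \<sigma> x * exp (\<mu> * x)) (exp (\<mu>\<^sup>2 * \<sigma>\<^sup>2 / 2))"
proof -
  have "normal_density 0 \<sigma> x * exp (\<mu> * x) = exp (\<mu>\<^sup>2 * \<sigma>\<^sup>2 / 2) * normal_density (\<mu> * \<sigma>\<^sup>2) \<sigma> x" for x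
  proof -
    have "- (x - 0)\<^sup>2 / (2 * \<sigma>\<^sup>2) + \<mu> * x = \<mu>\<^sup>2 * \<sigma>\<^sup>2 / 2 + - (x - \<mu> * \<sigma>\<^sup>2)\<^sup>2 / (2 * \<sigma>\<^sup>2)"
      using assms by (simp add: field_simps power2_eq_square)
    then have "exp (- (x - 0)\<^sup>2 / (2 * \<sigma>\<^sup>2)) * exp (\<mu> * x) =
      exp (\<mu>\<^sup>2 * \<sigma>\<^sup>2 / 2) * exp (- (x - \<mu> * \<sigma>\<^sup>2)\<^sup>2 / (2 * \<sigma>\<^sup>2))"
      by (simp only: exp_add[symmetric])
    then show ?thesis unfolding normal_density_def by (simp add: mult_ac)
  qed
  moreover have "has_bochner_integral lborel (\<lambda>x. exp (\<mu>\<^sup>2 * \<sigma>\<^sup>2 / 2) * normal_density (\<mu> * \<sigma>\<^sup>2) \<sigma> x)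
      (exp (\<mu>\<^sup>2 * \<sigma>\<^sup>2 / 2) * 1)"
    using assms by (intro has_bochner_integral_mult_right)
      (simp add: has_bochner_integral_iff)
  ultimately show ?thesis by simp
qed

lemma centred_normal_exp_square:
  assumes "0 < \<sigma>"
  shows "(\<integral>\<^sup>+x. ennreal (exp (x\<^sup>2 / (4 * \<sigma>\<^sup>2))) \<partial>centred_normal \<sigma>) = ennreal (sqrt 2)"
proof -
  have eq: "normal_density 0 \<sigma> x * exp (x\<^sup>2 / (4 * \<sigma>\<^sup>2)) = sqrt 2 * normal_density 0 (sqrt 2 * \<sigma>) x" for x
  proof -
    have "- x\<^sup>2 / (2 * \<sigma>\<^sup>2) + x\<^sup>2 / (4 * \<sigma>\<^sup>2) = - x\<^sup>2 / (2 * (sqrt 2 * \<sigma>)\<^sup>2)"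
      using assms by (simp add: field_simps power_mult_distrib)
    then have "exp (- x\<^sup>2 / (2 * \<sigma>\<^sup>2)) * exp (x\<^sup>2 / (4 * \<sigma>\<^sup>2)) = exp (- x\<^sup>2 / (2 * (sqrt 2 * \<sigma>)\<^sup>2))"
      by (simp only: exp_add[symmetric])
    moreover have "1 / sqrt (2 * pi * \<sigma>\<^sup>2) = sqrt 2 * (1 / sqrt (2 * pi * (sqrt 2 * \<sigma>)\<^sup>2))"
      using assms by (simp add: power_mult_distrib real_sqrt_mult field_simps)
    ultimately show ?thesis unfolding normal_density_def by (simp add: mult.assoc)
  qed
  have "(\<integral>\<^sup>+x. ennreal (exp (x\<^sup>2 / (4 * \<sigma>\<^sup>2))) \<partial>centred_normal \<sigma>) =
      (\<integral>\<^sup>+x. ennreal (normal_density 0 \<sigma> x * exp (x\<^sup>2 / (4 * \<sigma>\<^sup>2))) \<partial>lborel)"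
    using assms by (simp add: centred_normal_def nn_integral_density ennreal_mult)
  also have "\<dots> = (\<integral>\<^sup>+x. ennreal (sqrt 2) * ennreal (normal_density 0 (sqrt 2 * \<sigma>) x) \<partial>lborel)"
    unfolding eq by (simp add: ennreal_mult)
  also have "\<dots> = ennreal (sqrt 2) * (\<integral>\<^sup>+x. ennreal (normal_density 0 (sqrt 2 * \<sigma>) x) \<partial>lborel)"
    by (simp add: nn_integral_cmult)
  also have "(\<integral>\<^sup>+x. ennreal (normal_density 0 (sqrt 2 * \<sigma>) x) \<partial>lborel) = 1"
    using assms by (subst nn_integral_eq_integral) (auto simp: integral_normal_density)
  finally show ?thesis by simp
qed

text \<open>A sign of mean \<open>a = 1 - 2 q\<close>, independent of a normal variable \<open>g\<close>, gives \<open>\<bar>g\<bar>\<close> a positive drift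
  \<open>a E\<bar>g\<bar> = a \<sigma> sqrt (2 / \<pi>)\<close>. In the exponential moment at \<open>- \<mu>\<close> the drift appears through
  \<open>- a sinh (\<mu> \<bar>g\<bar>) \<le> - a \<mu> \<bar>g\<bar>\<close>, while the even part is \<open>E cosh (\<mu> g) = exp (\<mu>\<^sup>2 \<sigma>\<^sup>2 / 2)\<close>, which
  exceeds 1 only to second order in \<open>\<mu>\<close>; \<open>\<mu>\<close> is chosen proportional to \<open>a / \<sigma>\<close>.\<close>

lemma signed_normal_exp_moment:
  assumes s: "0 < \<sigma>" and q: "0 \<le> q" "q \<le> 1 / 2"
  defines "a \<equiv> 1 - 2 * q"
  defines "\<mu> \<equiv> a / (4 * \<sigma>)"
  shows "(\<integral>\<^sup>+x. ennreal ((1 - q) * exp (- \<mu> * \<bar>x\<bar>) + q * exp (\<mu> * \<bar>x\<bar>)) \<partial>centred_normal \<sigma>)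
    \<le> ennreal (exp (- a\<^sup>2 / 8))"
proof -
  have a: "0 \<le> a" "a \<le> 1" using q by (auto simp: a_def)
  have mu: "0 \<le> \<mu>" using s a by (simp add: \<mu>_def)
  let ?h = "\<lambda>x. (exp (\<mu> * x) + exp ((- \<mu>) * x)) / 2 - a * (\<mu> * \<bar>x\<bar>)"
  have pw: "(1 - q) * exp (- \<mu> * \<bar>x\<bar>) + q * exp (\<mu> * \<bar>x\<bar>) \<le> ?h x" for x
  proof -
    define y where "y = \<mu> * \<bar>x\<bar>"
    have "y \<le> (exp y - inverse (exp y)) / 2" using mu by (intro real_le_x_sinh) (simp add: y_def)
    then have "a * y \<le> a * ((exp y - exp (- y)) / 2)" using a by (intro mult_left_mono) (auto simp: exp_minus)
    moreover have "(1 - q) * exp (- y) + q * exp y = (exp y + exp (- y)) / 2 - a * ((exp y - exp (- y)) / 2)"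
      by (simp add: a_def field_simps)
    moreover have "exp (\<mu> * x) + exp ((- \<mu>) * x) = exp y + exp (- y)"
      by (cases "0 \<le> x") (auto simp: y_def abs_if)
    ultimately show ?thesis by (simp add: y_def)
  qed
  have i1: "has_bochner_integral lborel (\<lambda>x. normal_density 0 \<sigma> x * exp (\<mu> * x)) (exp (\<mu>\<^sup>2 * \<sigma>\<^sup>2 / 2))"
    and i2: "has_bochner_integral lborel (\<lambda>x. normal_density 0 \<sigma> x * exp ((- \<mu>) * x)) (exp (\<mu>\<^sup>2 * \<sigma>\<^sup>2 / 2))"
    using normal_mgf[OF s, of \<mu>] normal_mgf[OF s, of "- \<mu>"] by auto
  have i3: "has_bochner_integral lborel (\<lambda>x. normal_density 0 \<sigma> x * \<bar>x\<bar>) (\<sigma> * sqrt (2 / pi))"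
    using normal_moment_abs_odd[OF s, of 0 0] by simp
  have "has_bochner_integral lborel
      (\<lambda>x. (1 / 2) * (normal_density 0 \<sigma> x * exp (\<mu> * x) + normal_density 0 \<sigma> x * exp ((- \<mu>) * x))
          - (a * \<mu>) * (normal_density 0 \<sigma> x * \<bar>x\<bar>))
      ((1 / 2) * (exp (\<mu>\<^sup>2 * \<sigma>\<^sup>2 / 2) + exp (\<mu>\<^sup>2 * \<sigma>\<^sup>2 / 2)) - (a * \<mu>) * (\<sigma> * sqrt (2 / pi)))"
    by (intro has_bochner_integral_diff has_bochner_integral_mult_right has_bochner_integral_add i1 i2 i3)
  then have int: "has_bochner_integral lborel (\<lambda>x. normal_density 0 \<sigma> x * ?h x)
      (exp (\<mu>\<^sup>2 * \<sigma>\<^sup>2 / 2) - (a * \<mu>) * (\<sigma> * sqrt (2 / pi)))"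
    by (rule has_bochner_integral_cong[THEN iffD1, rotated -1]) (auto simp: field_simps)
  have h0: "0 \<le> ?h x" for x
  proof -
    have "0 \<le> (1 - q) * exp (- \<mu> * \<bar>x\<bar>) + q * exp (\<mu> * \<bar>x\<bar>)" using q by (intro add_nonneg_nonneg) auto
    then show ?thesis using pw[of x] by (rule order_trans)
  qed
  have "(\<integral>\<^sup>+x. ennreal ((1 - q) * exp (- \<mu> * \<bar>x\<bar>) + q * exp (\<mu> * \<bar>x\<bar>)) \<partial>centred_normal \<sigma>)
      \<le> (\<integral>\<^sup>+x. ennreal (?h x) \<partial>centred_normal \<sigma>)"
    by (intro nn_integral_mono ennreal_leI pw)
  also have "\<dots> = (\<integral>\<^sup>+x. ennreal (normal_density 0 \<sigma> x * ?h x) \<partial>lborel)"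
    using s h0 by (simp add: centred_normal_def nn_integral_density ennreal_mult)
  also have "\<dots> = ennreal (exp (\<mu>\<^sup>2 * \<sigma>\<^sup>2 / 2) - (a * \<mu>) * (\<sigma> * sqrt (2 / pi)))"
    using int h0 by (subst nn_integral_eq_integral) (auto simp: has_bochner_integral_iff)
  also have "\<dots> \<le> ennreal (exp (- a\<^sup>2 / 8))"
  proof (rule ennreal_leI)
    have mus: "\<mu>\<^sup>2 * \<sigma>\<^sup>2 / 2 = a\<^sup>2 / 32" using s by (simp add: \<mu>_def power2_eq_square field_simps)
    have "a\<^sup>2 \<le> 1" using a by (simp add: power_le_one)
    then have "exp (a\<^sup>2 / 32) \<le> 1 + a\<^sup>2 / 32 + (a\<^sup>2 / 32)\<^sup>2" by (intro exp_bound) auto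
    also have "(a\<^sup>2 / 32)\<^sup>2 \<le> a\<^sup>2 / 32"

      unfolding power2_eq_square[of "a\<^sup>2 / 32"] by (rule mult_left_le) (use \<open>a\<^sup>2 \<le> 1\<close> in auto)
    finally have e: "exp (a\<^sup>2 / 32) \<le> 1 + a\<^sup>2 / 16" by simp
    have "3 / 4 \<le> sqrt (2 / pi)"
      using pi_approx by (intro real_le_rsqrt) (simp add: field_simps power2_eq_square)
    then have "(a * \<mu> * \<sigma>) * (3 / 4) \<le> (a * \<mu> * \<sigma>) * sqrt (2 / pi)"
      using a mu s by (intro mult_left_mono) auto
    moreover have "a * \<mu> * \<sigma> = a\<^sup>2 / 4" using s by (simp add: \<mu>_def power2_eq_square)
    ultimately have "exp (\<mu>\<^sup>2 * \<sigma>\<^sup>2 / 2) - (a * \<mu>) * (\<sigma> * sqrt (2 / pi)) \<le> 1 + (- a\<^sup>2 / 8)"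
      using e unfolding mus by (simp add: mult_ac)
    also have "\<dots> \<le> exp (- a\<^sup>2 / 8)" by (rule exp_ge_add_one_self)
    finally show "exp (\<mu>\<^sup>2 * \<sigma>\<^sup>2 / 2) - (a * \<mu>) * (\<sigma> * sqrt (2 / pi)) \<le> exp (- a\<^sup>2 / 8)" .
  qed
  finally show ?thesis .
qed

section \<open>Tails of the initial state, the attacks and the inputs\<close>

text \<open>Jensen's inequality for a sub-convex combination, the missing weight being placed at 0:
  the tangent of \<open>exp\<close> at the mean lies below \<open>exp\<close>.\<close>

lemma exp_subconvex_combination:
  fixes b a :: "'i \<Rightarrow> real"
  assumes l: "\<And>j. j \<in> S \<Longrightarrow> 0 \<le> a j" and l1: "(\<Sum>j\<in>S. a j) \<le> 1"
  shows "exp (\<Sum>j\<in>S. a j * b j) \<le> (1 - (\<Sum>j\<in>S. a j)) + (\<Sum>j\<in>S. a j * exp (b j))"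
proof -
  define s where "s = (\<Sum>j\<in>S. a j * b j)"
  define L where "L = (\<Sum>j\<in>S. a j)"
  have tangent: "exp s * (1 + y - s) \<le> exp y" for y
    using mult_left_mono[OF exp_ge_add_one_self[of "y - s"], of "exp s"]
    by (simp add: exp_diff field_simps)
  have "(\<Sum>j\<in>S. a j * (exp s * (1 + b j - s))) = exp s * (\<Sum>j\<in>S. a j * (1 + b j - s))"
    by (simp add: sum_distrib_left mult_ac)
  also have "(\<Sum>j\<in>S. a j * (1 + b j - s)) = (\<Sum>j\<in>S. a j + a j * b j - a j * s)"
    by (simp add: algebra_simps)
  also have "\<dots> = L + s - L * s"
    by (simp add: sum.distrib sum_subtractf flip: s_def L_def sum_distrib_right)
  finally have "exp s = (1 - L) * (exp s * (1 + 0 - s)) + (\<Sum>j\<in>S. a j * (exp s * (1 + b j - s)))"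
    by (simp add: algebra_simps)
  also have "\<dots> \<le> (1 - L) * exp 0 + (\<Sum>j\<in>S. a j * exp (b j))"
    using l l1 by (intro add_mono mult_left_mono sum_mono tangent) (auto simp: L_def)
  finally show ?thesis by (simp add: s_def L_def)
qed

text \<open>Sub-Gaussian moments are moments of \<open>exp (b\<^sup>2)\<close>; this passes to those of \<open>exp b\<close>, at the cost of
  a constant factor and for either sign of \<open>b\<close>.\<close>

lemma exp_le_exp_square:
  fixes b :: real
  shows "exp b \<le> exp (1 / 4) * exp (b\<^sup>2)"
proof -
  have "0 \<le> (b - 1 / 2)\<^sup>2" by simp
  then have "b \<le> 1 / 4 + b\<^sup>2" by (simp add: power2_eq_square algebra_simps)
  then show ?thesis by (simp flip: exp_add)
qed

lemma exp_quarter_le: "exp (1 / 4 :: real) \<le> 4 / 3"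
  using exp_bound[of "1 / 4 :: real"] by (simp add: power2_eq_square)

lemma (in prob_space) chernoff_bound:
  assumes S: "S \<in> borel_measurable M" and K: "(\<integral>\<^sup>+\<omega>. ennreal (exp (S \<omega>)) \<partial>M) \<le> ennreal K" and "0 \<le> K"
  shows "prob {\<omega> \<in> space M. b < S \<omega>} \<le> K * exp (- b)"
proof -
  have "emeasure M {\<omega> \<in> space M. b < S \<omega>} = (\<integral>\<^sup>+\<omega>. indicator {\<omega> \<in> space M. b < S \<omega>} \<omega> \<partial>M)"
    using S by (intro nn_integral_indicator[symmetric]) measurable
  also have "\<dots> \<le> (\<integral>\<^sup>+\<omega>. ennreal (exp (- b)) * ennreal (exp (S \<omega>)) \<partial>M)"
    by (intro nn_integral_mono)
      (auto simp: indicator_def exp_minus field_simps simp flip: ennreal_mult ennreal_1 intro!: ennreal_leI)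
  also have "\<dots> = ennreal (exp (- b)) * (\<integral>\<^sup>+\<omega>. ennreal (exp (S \<omega>)) \<partial>M)"
    using S by (intro nn_integral_cmult) measurable
  also have "\<dots> \<le> ennreal (exp (- b)) * ennreal K" by (intro mult_left_mono K) auto
  also have "\<dots> = ennreal (K * exp (- b))" using \<open>0 \<le> K\<close> by (simp add: ennreal_mult mult.commute)
  finally show ?thesis using \<open>0 \<le> K\<close> by (simp add: emeasure_eq_measure)
qed

lemma (in prob_space) exp_moment_chain:
  fixes Y :: "nat \<Rightarrow> 'a \<Rightarrow> real"
  assumes step: "\<And>s. s < N \<Longrightarrow>
    (\<integral>\<^sup>+\<omega>. ennreal (exp (\<Sum>t<s. Y t \<omega>)) * ennreal (exp (Y s \<omega>)) \<partial>M)
      \<le> c * (\<integral>\<^sup>+\<omega>. ennreal (exp (\<Sum>t<s. Y t \<omega>)) \<partial>M)"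
  shows "(\<integral>\<^sup>+\<omega>. ennreal (exp (\<Sum>t<N. Y t \<omega>)) \<partial>M) \<le> c ^ N"
  using step
proof (induction N)
  case 0
  then show ?case by (simp add: emeasure_space_1)
next
  case (Suc N)
  have "(\<integral>\<^sup>+\<omega>. ennreal (exp (\<Sum>t<Suc N. Y t \<omega>)) \<partial>M) =
      (\<integral>\<^sup>+\<omega>. ennreal (exp (\<Sum>t<N. Y t \<omega>)) * ennreal (exp (Y N \<omega>)) \<partial>M)"
    by (simp add: exp_add ennreal_mult)
  also have "\<dots> \<le> c * (\<integral>\<^sup>+\<omega>. ennreal (exp (\<Sum>t<N. Y t \<omega>)) \<partial>M)" by (rule Suc.prems) simp
  also have "\<dots> \<le> c * c ^ N" by (intro mult_left_mono Suc.IH Suc.prems) auto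
  finally show ?case by simp
qed

lemma generated_algebra_subset:
  assumes "X \<in> M \<rightarrow>\<^sub>M N"
  shows "generated_algebra M N X \<subseteq> sets M"
proof -
  have "X \<in> space M \<rightarrow> space N" using assms by (auto dest: measurable_space)
  then show ?thesis using assms unfolding generated_algebra_def
    by (auto simp: sets_vimage_algebra2)
qed

lemma space_history [simp]: "space (history M n x0 w t) = space M"
  by (simp add: history_def space_measure_of_conv)

lemma sets_history:
  assumes "x0 \<in> M \<rightarrow>\<^sub>M borel_vec n" "\<And>t. w t \<in> M \<rightarrow>\<^sub>M borel_vec n"
  shows "sets (history M n x0 w t) = sigma_sets (space M)
    (generated_algebra M (borel_vec n) x0 \<union> (\<Union>s<t. generated_algebra M (borel_vec n) (w s)))"
proof -
  have "generated_algebra M (borel_vec n) x0 \<union> (\<Union>s<t. generated_algebra M (borel_vec n) (w s)) \<subseteq> sets M"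
    using assms generated_algebra_subset by blast
  then show ?thesis unfolding history_def
    by (intro sets_measure_of) (use sets.space_closed in blast)
qed

lemma subalgebra_history:
  assumes "x0 \<in> M \<rightarrow>\<^sub>M borel_vec n" "\<And>t. w t \<in> M \<rightarrow>\<^sub>M borel_vec n"
  shows "subalgebra M (history M n x0 w t)"
  unfolding subalgebra_def
proof
  show "sets (history M n x0 w t) \<subseteq> sets M"
    unfolding sets_history[OF assms]
    using assms generated_algebra_subset by (intro sets.sigma_sets_subset) blast
qed simp

lemma measurable_history:
  assumes x0: "x0 \<in> M \<rightarrow>\<^sub>M borel_vec n" and w: "\<And>t. w t \<in> M \<rightarrow>\<^sub>M borel_vec n"
  shows "x0 \<in> history M n x0 w t \<rightarrow>\<^sub>M borel_vec n"
    and "s < t \<Longrightarrow> w s \<in> history M n x0 w t \<rightarrow>\<^sub>M borel_vec n"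
proof -
  have gen: "X -` A \<inter> space M \<in> generated_algebra M (borel_vec n) X" if "A \<in> sets (borel_vec n)" for X A
    unfolding generated_algebra_def using that by (rule in_vimage_algebra)
  show "x0 \<in> history M n x0 w t \<rightarrow>\<^sub>M borel_vec n"
    by (rule measurableI)
      (use x0 gen random_vec_carrier[OF x0] in \<open>auto simp: sets_history[OF x0 w]\<close>)
  show "w s \<in> history M n x0 w t \<rightarrow>\<^sub>M borel_vec n" if "s < t"
    by (rule measurableI)
      (use that gen random_vec_carrier[OF w] in \<open>auto simp: sets_history[OF x0 w]\<close>)
qed

text \<open>A conditional norm at most \<open>K\<close> provides, at almost every point, some rational \<open>d < c\<close> with the
  moment bound, but \<open>d\<close> depends on the point. The conditional moments are almost surely monotone
  along the countably many rationals below \<open>c\<close>, which replaces \<open>d\<close> by the fixed \<open>c\<close>.\<close>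

lemma (in prob_space) cond_exp_square_of_cond_psi2:
  assumes sub: "subalgebra M F" and X: "X \<in> M \<rightarrow>\<^sub>M borel_vec n"
    and K: "cond_psi2_norm_vec_le M F n X K" and v: "v \<in> carrier_vec n" "l2_norm v \<le> 1"
    and c: "K < c" "0 < K"
  shows "AE \<omega> in M. nn_cond_exp M F (\<lambda>\<omega>. ennreal (exp ((X \<omega> \<bullet> v)\<^sup>2 / c\<^sup>2))) \<omega> \<le> 2"
proof -
  have fin: "finite_measure M" by unfold_locales
  interpret F: sigma_finite_subalgebra M F
    by (rule finite_measure_subalgebra_is_sigma_finite)
       (use sub fin in \<open>simp add: finite_measure_subalgebra_def finite_measure_subalgebra_axioms_def\<close>)
  let ?f = "\<lambda>c \<omega>. ennreal (exp ((X \<omega> \<bullet> v)\<^sup>2 / c\<^sup>2))"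
  have f: "?f c \<in> borel_measurable M" for c
    using measurable_scalar_prod(1)[OF X v(1)] by measurable
  have "AE \<omega> in M. \<forall>d\<in>\<rat> \<inter> {0<..<c}. nn_cond_exp M F (?f c) \<omega> \<le> nn_cond_exp M F (?f d) \<omega>"
  proof (subst AE_ball_countable)
    show "countable (\<rat> \<inter> {0<..<c})" using countable_rat by (rule countable_Int1)
    show "\<forall>d\<in>\<rat> \<inter> {0<..<c}. AE \<omega> in M. nn_cond_exp M F (?f c) \<omega> \<le> nn_cond_exp M F (?f d) \<omega>"
    proof
      fix d :: real assume d: "d \<in> \<rat> \<inter> {0<..<c}"
      then have "?f c \<omega> \<le> ?f d \<omega>" for \<omega>
        by (intro ennreal_leI) (auto intro!: divide_left_mono power_mono)
      then show "AE \<omega> in M. nn_cond_exp M F (?f c) \<omega> \<le> nn_cond_exp M F (?f d) \<omega>"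
        by (intro F.nn_cond_exp_mono f) auto
    qed
  qed
  moreover have "AE \<omega> in M. cond_psi2_norm M F (\<lambda>\<omega>. X \<omega> \<bullet> v) \<omega> \<le> ennreal K"
    using K v unfolding cond_psi2_norm_vec_le_def by blast
  ultimately show ?thesis
  proof eventually_elim
    case (elim \<omega>)
    have "cond_psi2_norm M F (\<lambda>\<omega>. X \<omega> \<bullet> v) \<omega> < ennreal c"
      using elim(2) c by (simp add: ennreal_lessI order.strict_trans1)
    then obtain d where d: "d \<in> \<rat>" "0 < d" "nn_cond_exp M F (?f d) \<omega> \<le> 2" "ennreal d < ennreal c"
      unfolding cond_psi2_norm_def INF_less_iff by auto
    then have "d < c" by (simp add: ennreal_less_iff)
    with elim(1) d have "nn_cond_exp M F (?f c) \<omega> \<le> nn_cond_exp M F (?f d) \<omega>" by auto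
    then show ?case using d(3) by (rule order_trans)
  qed
qed

lemma exp_square_of_psi2:
  assumes K: "psi2_norm_vec M n X \<le> ennreal K" and v: "v \<in> carrier_vec n" "l2_norm v \<le> 1"
    and c: "K < c" "0 < K"
  shows "(\<integral>\<^sup>+\<omega>. ennreal (exp ((X \<omega> \<bullet> v)\<^sup>2 / c\<^sup>2)) \<partial>M) \<le> 2"
proof -
  have "psi2_norm M (\<lambda>\<omega>. X \<omega> \<bullet> v) \<le> psi2_norm_vec M n X"
    unfolding psi2_norm_vec_def using v by (intro SUP_upper) auto
  then have "psi2_norm M (\<lambda>\<omega>. X \<omega> \<bullet> v) < ennreal c"
    using K c by (metis ennreal_lessI order.strict_trans1 order_trans less_trans)
  then obtain d where d: "0 < d" "(\<integral>\<^sup>+\<omega>. ennreal (exp ((X \<omega> \<bullet> v)\<^sup>2 / d\<^sup>2)) \<partial>M) \<le> 2" "ennreal d < ennreal c"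
    unfolding psi2_norm_def INF_less_iff by auto
  then have "d < c" by (simp add: ennreal_less_iff)
  have "(\<integral>\<^sup>+\<omega>. ennreal (exp ((X \<omega> \<bullet> v)\<^sup>2 / c\<^sup>2)) \<partial>M) \<le> (\<integral>\<^sup>+\<omega>. ennreal (exp ((X \<omega> \<bullet> v)\<^sup>2 / d\<^sup>2)) \<partial>M)"
    using d \<open>d < c\<close> by (intro nn_integral_mono ennreal_leI) (auto intro!: divide_left_mono power_mono)
  then show ?thesis using d(2) by (rule order_trans)
qed

text \<open>Up to a factor, the sum over \<open>J\<close> later times of the norm of the response to one shock \<open>z\<close>, where
  \<open>e j i\<close> is the normalised row \<open>i\<close> of the response after \<open>j\<close> steps. The factor makes the
  exponential moment bounded by a constant: the geometric weights have total mass at most 1, and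
  the root mean square over the \<open>r\<close> rows has the scale of a single coordinate.\<close>

definition shock :: "nat \<Rightarrow> nat \<Rightarrow> real \<Rightarrow> real \<Rightarrow> (nat \<Rightarrow> nat \<Rightarrow> real vec) \<Rightarrow> real vec \<Rightarrow> real" where
  "shock J r \<rho> c e z =
     (\<Sum>j<J. (1 - \<rho>) * \<rho> ^ j * (L2_set (\<lambda>i. z \<bullet> e j i) {..<r} / (sqrt (real r) * c)))"

lemma geometric_weights_le_1:
  fixes \<rho> :: real
  assumes "0 \<le> \<rho>" "\<rho> < 1"
  shows "(\<Sum>j<J. (1 - \<rho>) * \<rho> ^ j) \<le> 1"
proof -
  have "(\<Sum>j<J. (1 - \<rho>) * \<rho> ^ j) = 1 - \<rho> ^ J"
    using assms by (induction J) (auto simp: algebra_simps)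
  then show ?thesis using assms by simp
qed

text \<open>Jensen's inequality for the average over the \<open>r\<close> coordinates: bounds for single coordinates
  suffice, whatever their dependence.\<close>

lemma exp_root_mean_square_le:
  assumes r: "1 \<le> r" and c: "0 < c"
  shows "exp (L2_set g {..<r} / (sqrt (real r) * c)) \<le>
    exp (1 / 4) * (\<Sum>i<r. 1 / real r * exp ((g i)\<^sup>2 / c\<^sup>2))"
proof -
  have sq: "(L2_set g {..<r} / (sqrt (real r) * c))\<^sup>2 = (\<Sum>i<r. 1 / real r * ((g i)\<^sup>2 / c\<^sup>2))"
    by (simp add: L2_set_def power_divide power_mult_distrib sum_nonneg sum_divide_distrib)
  have "exp (\<Sum>i<r. 1 / real r * ((g i)\<^sup>2 / c\<^sup>2)) \<le> (\<Sum>i<r. 1 / real r * exp ((g i)\<^sup>2 / c\<^sup>2))"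
    using exp_subconvex_combination[of "{..<r}" "\<lambda>_. 1 / real r" "\<lambda>i. (g i)\<^sup>2 / c\<^sup>2"] r by simp
  then show ?thesis
    using exp_le_exp_square[of "L2_set g {..<r} / (sqrt (real r) * c)"] unfolding sq
    by (smt (verit) exp_gt_zero mult_left_mono)
qed

lemma exp_shock_le:
  assumes r: "1 \<le> r" and rho: "0 \<le> \<rho>" "\<rho> < 1" and c: "0 < c"
  shows "exp (shock J r \<rho> c e z) \<le> exp (1 / 4) * ((1 - (\<Sum>j<J. (1 - \<rho>) * \<rho> ^ j)) +
    (\<Sum>j<J. \<Sum>i<r. (1 - \<rho>) * \<rho> ^ j / real r * exp ((z \<bullet> e j i)\<^sup>2 / c\<^sup>2)))"
proof -
  let ?l = "\<lambda>j. (1 - \<rho>) * \<rho> ^ j"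
  have l: "0 \<le> ?l j" for j using rho by simp
  note L = geometric_weights_le_1[OF rho, of J]
  have "exp (shock J r \<rho> c e z) \<le> (1 - (\<Sum>j<J. ?l j)) +
      (\<Sum>j<J. ?l j * exp (L2_set (\<lambda>i. z \<bullet> e j i) {..<r} / (sqrt (real r) * c)))"
    unfolding shock_def by (rule exp_subconvex_combination[OF l L])
  also have "\<dots> \<le> exp (1 / 4) * (1 - (\<Sum>j<J. ?l j)) +
      (\<Sum>j<J. ?l j * (exp (1 / 4) * (\<Sum>i<r. 1 / real r * exp ((z \<bullet> e j i)\<^sup>2 / c\<^sup>2))))"
    using L l by (intro add_mono sum_mono mult_left_mono exp_root_mean_square_le r c)
      (auto intro: mult_right_mono[of 1 "exp (1/4)", simplified])
  also have "\<dots> = exp (1 / 4) * ((1 - (\<Sum>j<J. ?l j)) +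
      (\<Sum>j<J. \<Sum>i<r. ?l j / real r * exp ((z \<bullet> e j i)\<^sup>2 / c\<^sup>2)))"
    by (simp add: distrib_left sum_distrib_left mult_ac)
  finally show ?thesis .
qed

lemma measurable_shock:
  assumes X: "X \<in> N \<rightarrow>\<^sub>M borel_vec n"
    and e: "\<And>j i. j < J \<Longrightarrow> i < r \<Longrightarrow> e j i \<in> carrier_vec n"
  shows "(\<lambda>\<omega>. shock J r \<rho> c e (X \<omega>)) \<in> borel_measurable N"
proof -
  have "(\<lambda>\<omega>. sqrt (\<Sum>i<r. (X \<omega> \<bullet> e j i)\<^sup>2)) \<in> borel_measurable N" if "j < J" for j
    using measurable_scalar_prod(1)[OF X e[OF that]]
    by (intro measurable_compose[OF _ borel_measurable_sqrt] borel_measurable_sum borel_measurable_power) auto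
  then show ?thesis unfolding shock_def L2_set_def
    by (intro borel_measurable_sum borel_measurable_times borel_measurable_divide) auto
qed

text \<open>A bound on the square-exponential moments of the one-dimensional marginals, weighted by
  any density \<open>f\<close>, passes to the shock.\<close>

lemma shock_exp_moment:
  assumes f: "f \<in> borel_measurable M" and X: "X \<in> M \<rightarrow>\<^sub>M borel_vec n"
    and r: "1 \<le> r" and rho: "0 \<le> \<rho>" "\<rho> < 1" and c: "0 < c"
    and e: "\<And>j i. j < J \<Longrightarrow> i < r \<Longrightarrow> e j i \<in> carrier_vec n"
    and mom: "\<And>j i. j < J \<Longrightarrow> i < r \<Longrightarrow>
      (\<integral>\<^sup>+\<omega>. f \<omega> * ennreal (exp ((X \<omega> \<bullet> e j i)\<^sup>2 / c\<^sup>2)) \<partial>M) \<le> 2 * (\<integral>\<^sup>+\<omega>. f \<omega> \<partial>M)"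
  shows "(\<integral>\<^sup>+\<omega>. f \<omega> * ennreal (exp (shock J r \<rho> c e (X \<omega>))) \<partial>M)
    \<le> ennreal (exp 1) * (\<integral>\<^sup>+\<omega>. f \<omega> \<partial>M)"
proof -
  define L where "L = (\<Sum>j<J. (1 - \<rho>) * \<rho> ^ j)"
  define l where "l j = (1 - \<rho>) * \<rho> ^ j / real r" for j
  let ?g = "\<lambda>j i \<omega>. ennreal (exp ((X \<omega> \<bullet> e j i)\<^sup>2 / c\<^sup>2))" and ?I = "\<integral>\<^sup>+\<omega>. f \<omega> \<partial>M"
  have l0: "0 \<le> l j" for j using rho by (simp add: l_def)
  have L1: "L \<le> 1" unfolding L_def by (rule geometric_weights_le_1[OF rho])
  have lL: "(\<Sum>j<J. \<Sum>i<r. l j) = L" using r by (simp add: l_def L_def)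
  have g: "?g j i \<in> borel_measurable M" if "j < J" "i < r" for j i
    using measurable_scalar_prod(1)[OF X e[OF that]] by measurable
  have pw: "ennreal (exp (shock J r \<rho> c e (X \<omega>))) \<le>
      ennreal (exp (1 / 4)) * (ennreal (1 - L) + (\<Sum>j<J. \<Sum>i<r. ennreal (l j) * ?g j i \<omega>))" for \<omega>
  proof -
    have "ennreal (exp (1 / 4)) * (ennreal (1 - L) + (\<Sum>j<J. \<Sum>i<r. ennreal (l j) * ?g j i \<omega>)) =
      ennreal (exp (1 / 4) * ((1 - L) + (\<Sum>j<J. \<Sum>i<r. l j * exp ((X \<omega> \<bullet> e j i)\<^sup>2 / c\<^sup>2))))"
      using l0 L1 by (simp add: ennreal_mult ennreal_plus sum_nonneg flip: sum_ennreal)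
    then show ?thesis
      using exp_shock_le[OF r rho c, of J e "X \<omega>"] by (simp add: l_def L_def ennreal_leI)
  qed
  have "(\<integral>\<^sup>+\<omega>. f \<omega> * ennreal (exp (shock J r \<rho> c e (X \<omega>))) \<partial>M) \<le>
      (\<integral>\<^sup>+\<omega>. ennreal (exp (1 / 4)) * (ennreal (1 - L) * f \<omega> +
        (\<Sum>j<J. \<Sum>i<r. ennreal (l j) * (f \<omega> * ?g j i \<omega>))) \<partial>M)"
  proof (rule nn_integral_mono)
    fix \<omega>
    have "f \<omega> * ennreal (exp (shock J r \<rho> c e (X \<omega>))) \<le> f \<omega> *
       (ennreal (exp (1 / 4)) * (ennreal (1 - L) + (\<Sum>j<J. \<Sum>i<r. ennreal (l j) * ?g j i \<omega>)))"
      by (intro mult_left_mono pw) simp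
    also have "\<dots> = ennreal (exp (1 / 4)) * (ennreal (1 - L) * f \<omega> +
        (\<Sum>j<J. \<Sum>i<r. ennreal (l j) * (f \<omega> * ?g j i \<omega>)))"
      by (simp add: distrib_left sum_distrib_left mult_ac)
    finally show "f \<omega> * ennreal (exp (shock J r \<rho> c e (X \<omega>))) \<le> ennreal (exp (1 / 4)) *
      (ennreal (1 - L) * f \<omega> + (\<Sum>j<J. \<Sum>i<r. ennreal (l j) * (f \<omega> * ?g j i \<omega>)))" .
  qed
  also have "\<dots> = ennreal (exp (1 / 4)) * (ennreal (1 - L) * ?I +
      (\<Sum>j<J. \<Sum>i<r. ennreal (l j) * (\<integral>\<^sup>+\<omega>. f \<omega> * ?g j i \<omega> \<partial>M)))"
  proof -
    have fg: "(\<lambda>\<omega>. f \<omega> * ?g j i \<omega>) \<in> borel_measurable M" if "j < J" "i < r" for j i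
      using f g[OF that] by (rule borel_measurable_times_ennreal)
    have inner: "(\<lambda>\<omega>. ennreal (l j) * (f \<omega> * ?g j i \<omega>)) \<in> borel_measurable M" if "j < J" "i < r" for j i
      by (intro borel_measurable_times_ennreal[OF _ fg[OF that]]) simp
    have sums: "(\<lambda>\<omega>. \<Sum>j<J. \<Sum>i<r. ennreal (l j) * (f \<omega> * ?g j i \<omega>)) \<in> borel_measurable M"
      by (intro borel_measurable_sum inner) auto
    have "(\<integral>\<^sup>+\<omega>. (\<Sum>j<J. \<Sum>i<r. ennreal (l j) * (f \<omega> * ?g j i \<omega>)) \<partial>M) =
        (\<Sum>j<J. \<Sum>i<r. \<integral>\<^sup>+\<omega>. ennreal (l j) * (f \<omega> * ?g j i \<omega>) \<partial>M)"
      by (subst nn_integral_sum, intro borel_measurable_sum inner, simp_all)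
         (intro sum.cong refl nn_integral_sum inner, simp_all)
    also have "\<dots> = (\<Sum>j<J. \<Sum>i<r. ennreal (l j) * (\<integral>\<^sup>+\<omega>. f \<omega> * ?g j i \<omega> \<partial>M))"
      by (intro sum.cong refl nn_integral_cmult fg) auto
    finally have s: "(\<integral>\<^sup>+\<omega>. (\<Sum>j<J. \<Sum>i<r. ennreal (l j) * (f \<omega> * ?g j i \<omega>)) \<partial>M) =
        (\<Sum>j<J. \<Sum>i<r. ennreal (l j) * (\<integral>\<^sup>+\<omega>. f \<omega> * ?g j i \<omega> \<partial>M))" .
    have fl: "(\<lambda>\<omega>. ennreal (1 - L) * f \<omega>) \<in> borel_measurable M"
      by (intro borel_measurable_times_ennreal f) simp
    show ?thesis
      by (subst nn_integral_cmult[OF borel_measurable_add[OF fl sums]], subst nn_integral_add[OF fl sums],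
          subst nn_integral_cmult[OF f], subst s) (rule refl)
  qed
  also have "\<dots> \<le> ennreal (exp (1 / 4)) * (2 * (ennreal (1 - L) * ?I) +
      (\<Sum>j<J. \<Sum>i<r. ennreal (l j) * (2 * ?I)))"
    using mom by (intro mult_left_mono add_mono sum_mono) (auto simp: mult_2)
  also have "\<dots> = ennreal (exp (1 / 4)) * (2 * (ennreal (1 - L) + (\<Sum>j<J. \<Sum>i<r. ennreal (l j))) * ?I)"
    by (simp add: distrib_left distrib_right sum_distrib_left sum_distrib_right mult_ac)
  also have "(\<Sum>j<J. \<Sum>i<r. ennreal (l j)) = ennreal L"
  proof -
    have "(\<Sum>j<J. \<Sum>i<r. ennreal (l j)) = (\<Sum>j<J. ennreal (\<Sum>i<r. l j))"
      by (intro sum.cong refl sum_ennreal l0)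
    also have "\<dots> = ennreal L" unfolding lL[symmetric] by (intro sum_ennreal sum_nonneg l0)
    finally show ?thesis .
  qed
  also have "ennreal (1 - L) + ennreal L = 1"
    using L1 l0 lL by (subst ennreal_plus[symmetric]) (auto intro!: sum_nonneg simp flip: lL)
  also have "ennreal (exp (1 / 4)) * (2 * 1 * ?I) = ennreal (exp (1 / 4) * 2) * ?I"
    by (simp add: ennreal_mult mult_ac)
  also have "\<dots> \<le> ennreal (exp 1) * ?I"
  proof (intro mult_right_mono ennreal_leI)
    have "2 \<le> exp (3 / 4 :: real)" using exp_lower_Taylor_quadratic[of "3 / 4 :: real"]
      by (simp add: power2_eq_square)
    then have "exp (1 / 4 :: real) * 2 \<le> exp (1 / 4) * exp (3 / 4)" by (intro mult_left_mono) auto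
    then show "exp (1 / 4 :: real) * 2 \<le> exp 1" by (simp flip: exp_add)
  qed simp
  finally show ?thesis .
qed

text \<open>The shocks may depend on each other. Given the past, however, each of them has a bounded
  exponential moment, so that every further shock multiplies the moment of the partial sum by at
  most a constant.\<close>

lemma (in prob_space) shock_sum_tail:
  assumes sg: "sub_gaussian_attacks M n \<eta> x0 w" and eta: "0 < \<eta>" "\<eta> < c"
    and r: "1 \<le> r" and rho: "0 \<le> \<rho>" "\<rho> < 1"
    and e: "\<And>j i. j < J \<Longrightarrow> i < r \<Longrightarrow> e j i \<in> carrier_vec n \<and> l2_norm (e j i) \<le> 1"
  shows "prob {\<omega> \<in> space M. 3 * real (Suc N) <
      shock J r \<rho> c e (x0 \<omega>) + (\<Sum>s<N. shock J r \<rho> c e (w s \<omega>))} \<le> exp (- 2 * real (Suc N))"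
proof -
  define Y where "Y s \<omega> = (case s of 0 \<Rightarrow> shock J r \<rho> c e (x0 \<omega>) | Suc t \<Rightarrow> shock J r \<rho> c e (w t \<omega>))" for s \<omega>
  have x0: "x0 \<in> M \<rightarrow>\<^sub>M borel_vec n" and w: "\<And>t. w t \<in> M \<rightarrow>\<^sub>M borel_vec n"
    using sg by (auto simp: sub_gaussian_attacks_def)
  have e1: "e j i \<in> carrier_vec n" "l2_norm (e j i) \<le> 1" if "j < J" "i < r" for j i using e that by auto
  have Ysum: "(\<Sum>t<Suc s. Y t \<omega>) = shock J r \<rho> c e (x0 \<omega>) + (\<Sum>t<s. shock J r \<rho> c e (w t \<omega>))" for s \<omega>
    unfolding sum.lessThan_Suc_shift by (simp add: Y_def)
  have "(\<integral>\<^sup>+\<omega>. ennreal (exp (\<Sum>t<s. Y t \<omega>)) * ennreal (exp (Y s \<omega>)) \<partial>M)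
      \<le> ennreal (exp 1) * (\<integral>\<^sup>+\<omega>. ennreal (exp (\<Sum>t<s. Y t \<omega>)) \<partial>M)" for s
  proof (cases s)
    case 0
    have "(\<integral>\<^sup>+\<omega>. 1 * ennreal (exp (shock J r \<rho> c e (x0 \<omega>))) \<partial>M) \<le> ennreal (exp 1) * (\<integral>\<^sup>+\<omega>. 1 \<partial>M)"
      using sg eta e1
      by (intro shock_exp_moment[OF _ x0 r rho])
        (auto simp: sub_gaussian_attacks_def emeasure_space_1 intro!: exp_square_of_psi2[where K = \<eta>])
    then show ?thesis by (simp add: 0 Y_def)
  next
    case (Suc s')
    let ?F = "history M n x0 w s'" and ?f = "\<lambda>\<omega>. ennreal (exp (\<Sum>t<Suc s'. Y t \<omega>))"
    have sub: "subalgebra M ?F" by (rule subalgebra_history[OF x0 w])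
    have fin: "finite_measure M" by unfold_locales
    interpret F: sigma_finite_subalgebra M ?F
      by (rule finite_measure_subalgebra_is_sigma_finite)
         (use sub fin in \<open>simp add: finite_measure_subalgebra_def finite_measure_subalgebra_axioms_def\<close>)
    have "(\<lambda>\<omega>. shock J r \<rho> c e (x0 \<omega>) + (\<Sum>t<s'. shock J r \<rho> c e (w t \<omega>))) \<in> borel_measurable ?F"
      by (intro borel_measurable_add borel_measurable_sum measurable_shock[of _ _ n] e1
          measurable_history[OF x0 w]) auto
    then have f: "?f \<in> borel_measurable ?F" unfolding Ysum by measurable
    have fM: "?f \<in> borel_measurable M" by (rule measurable_from_subalg[OF sub f])
    have "(\<integral>\<^sup>+\<omega>. ?f \<omega> * ennreal (exp (shock J r \<rho> c e (w s' \<omega>))) \<partial>M) \<le> ennreal (exp 1) * (\<integral>\<^sup>+\<omega>. ?f \<omega> \<partial>M)"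
    proof (rule shock_exp_moment[OF fM w r rho])
      fix j i assume ji: "j < J" "i < r"
      let ?g = "\<lambda>\<omega>. ennreal (exp ((w s' \<omega> \<bullet> e j i)\<^sup>2 / c\<^sup>2))"
      have g: "?g \<in> borel_measurable M" using measurable_scalar_prod(1)[OF w e1(1)[OF ji]] by measurable
      have "(\<integral>\<^sup>+\<omega>. ?f \<omega> * ?g \<omega> \<partial>M) = (\<integral>\<^sup>+\<omega>. ?f \<omega> * nn_cond_exp M ?F ?g \<omega> \<partial>M)"
        by (rule F.nn_cond_exp_intg[OF f g, symmetric])
      also have "\<dots> \<le> (\<integral>\<^sup>+\<omega>. ?f \<omega> * 2 \<partial>M)"
      proof (rule nn_integral_mono_AE)
        have "AE \<omega> in M. nn_cond_exp M ?F ?g \<omega> \<le> 2"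
          using sg eta e1[OF ji]
          by (intro cond_exp_square_of_cond_psi2[OF sub w, where K = \<eta>])
             (auto simp: sub_gaussian_attacks_def)
        then show "AE \<omega> in M. ?f \<omega> * nn_cond_exp M ?F ?g \<omega> \<le> ?f \<omega> * 2"
          by eventually_elim (auto intro: mult_left_mono)
      qed
      also have "\<dots> = 2 * (\<integral>\<^sup>+\<omega>. ?f \<omega> \<partial>M)"
        using fM by (subst nn_integral_multc) (auto simp: mult.commute)
      finally show "(\<integral>\<^sup>+\<omega>. ?f \<omega> * ?g \<omega> \<partial>M) \<le> 2 * (\<integral>\<^sup>+\<omega>. ?f \<omega> \<partial>M)" .
    qed (use eta e1 in auto)
    then show ?thesis by (simp add: Suc Y_def)
  qed
  then have "(\<integral>\<^sup>+\<omega>. ennreal (exp (\<Sum>t<Suc N. Y t \<omega>)) \<partial>M) \<le> ennreal (exp 1) ^ Suc N"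
    by (rule exp_moment_chain)
  also have "\<dots> = ennreal (exp (real (Suc N)))"
    by (simp only: ennreal_power exp_of_nat_mult[symmetric] exp_ge_zero mult_1_right)
  finally have mom: "(\<integral>\<^sup>+\<omega>. ennreal (exp (\<Sum>t<Suc N. Y t \<omega>)) \<partial>M) \<le> ennreal (exp (real (Suc N)))" .
  have "(\<lambda>\<omega>. \<Sum>t<Suc N. Y t \<omega>) \<in> borel_measurable M"
    unfolding Ysum by (intro borel_measurable_add borel_measurable_sum measurable_shock[of _ _ n] e1 x0 w) auto
  note chernoff_bound[OF this mom exp_ge_zero, of "3 * real (Suc N)"]
  moreover have "exp (real (Suc N)) * exp (- (3 * real (Suc N))) = exp (- 2 * real (Suc N))"
    by (subst exp_add[symmetric]) simp
  ultimately show ?thesis unfolding Ysum by simp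
qed

lemma (in prob_space) gaussian_norm_exp_moment:
  assumes X: "X \<in> M \<rightarrow>\<^sub>M borel_vec m" and d: "distr M (borel_vec m) X = isotropic_gaussian m \<gamma>"
    and g: "0 < \<gamma>" and m: "1 \<le> m"
  shows "(\<integral>\<^sup>+\<omega>. ennreal (exp (l2_norm (X \<omega>) / (sqrt (real m) * (2 * \<gamma>)))) \<partial>M) \<le> ennreal (exp 1)"
proof -
  let ?g = "\<lambda>i \<omega>. ennreal (exp ((unit_vec m i \<bullet> X \<omega>)\<^sup>2 / (4 * \<gamma>\<^sup>2)))"
  have meas: "(\<lambda>\<omega>. unit_vec m i \<bullet> X \<omega>) \<in> borel_measurable M" for i
    by (intro measurable_scalar_prod[OF X]) auto
  have gm: "?g i \<in> borel_measurable M" for i using meas[of i] by measurable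
  have one: "(\<integral>\<^sup>+\<omega>. ?g i \<omega> \<partial>M) = ennreal (sqrt 2)" if i: "i < m" for i
  proof -
    have "l2_norm (unit_vec m i) = 1" using i by (simp add: l2_norm_def)
    then have "distr M borel (\<lambda>\<omega>. unit_vec m i \<bullet> X \<omega>) = centred_normal \<gamma>"
      using linear_form_of_isotropic_gaussian[OF X d g, of "unit_vec m i"] by simp
    then have "(\<integral>\<^sup>+x. ennreal (exp (x\<^sup>2 / (4 * \<gamma>\<^sup>2))) \<partial>centred_normal \<gamma>) = (\<integral>\<^sup>+\<omega>. ?g i \<omega> \<partial>M)"
      using meas[of i] by (subst nn_integral_distr[symmetric]) (auto dest: sym)
    then show ?thesis using centred_normal_exp_square[OF g] by simp
  qed
  have "(\<integral>\<^sup>+\<omega>. ennreal (exp (l2_norm (X \<omega>) / (sqrt (real m) * (2 * \<gamma>)))) \<partial>M) \<le>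
      (\<integral>\<^sup>+\<omega>. ennreal (exp (1 / 4)) * (\<Sum>i<m. ennreal (1 / real m) * ?g i \<omega>) \<partial>M)"
  proof (rule nn_integral_mono)
    fix \<omega> assume "\<omega> \<in> space M"
    then have Xc: "X \<omega> \<in> carrier_vec m" by (rule random_vec_carrier[OF X])
    then have "l2_norm (X \<omega>) = L2_set (\<lambda>i. unit_vec m i \<bullet> X \<omega>) {..<m}"
      by (auto simp: l2_norm_eq_L2_set intro!: L2_set_cong)
    then have "exp (l2_norm (X \<omega>) / (sqrt (real m) * (2 * \<gamma>))) \<le> exp (1 / 4) *
        (\<Sum>i<m. 1 / real m * exp ((unit_vec m i \<bullet> X \<omega>)\<^sup>2 / (2 * \<gamma>)\<^sup>2))"
      using exp_root_mean_square_le[OF m, of "2 * \<gamma>"] g by simp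
    then show "ennreal (exp (l2_norm (X \<omega>) / (sqrt (real m) * (2 * \<gamma>)))) \<le>
        ennreal (exp (1 / 4)) * (\<Sum>i<m. ennreal (1 / real m) * ?g i \<omega>)"
      by (simp add: power_mult_distrib sum_nonneg ennreal_leI flip: ennreal_mult)
  qed
  also have "\<dots> = ennreal (exp (1 / 4)) * (\<Sum>i<m. ennreal (1 / real m) * ennreal (sqrt 2))"
    using gm one by (simp add: nn_integral_cmult nn_integral_sum)
  also have "(\<Sum>i<m. ennreal (1 / real m) * ennreal (sqrt 2)) = ennreal (\<Sum>i<m. 1 / real m * sqrt 2)"
  proof -
    have "(\<Sum>i<m. ennreal (1 / real m) * ennreal (sqrt 2)) = (\<Sum>i<m. ennreal (1 / real m * sqrt 2))"
      by (intro sum.cong refl ennreal_mult[symmetric]) auto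
    also have "\<dots> = ennreal (\<Sum>i<m. 1 / real m * sqrt 2)" by (intro sum_ennreal) simp
    finally show ?thesis .
  qed
  also have "(\<Sum>i<m. 1 / real m * sqrt 2) = sqrt 2" using m by simp
  also have "ennreal (exp (1 / 4)) * ennreal (sqrt 2) \<le> ennreal (exp 1)"
  proof -
    have "sqrt 2 \<le> 3 / 2" by (rule real_le_lsqrt) (auto simp: power2_eq_square)
    then have "exp (1 / 4) * sqrt 2 \<le> 4 / 3 * (3 / 2)" by (intro mult_mono exp_quarter_le) auto
    also have "\<dots> \<le> exp 1" using exp_ge_add_one_self[of "1 :: real"] by simp
    finally show ?thesis by (simp add: ennreal_leI flip: ennreal_mult)
  qed
  finally show ?thesis .
qed

lemma (in prob_space) input_norm_sum_tail:
  assumes u: "gaussian_inputs M m \<gamma> u" and g: "0 < \<gamma>" and m: "1 \<le> m"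
  shows "prob {\<omega> \<in> space M. 3 * real N < (\<Sum>s<N. l2_norm (u s \<omega>) / (sqrt (real m) * (2 * \<gamma>)))}
    \<le> exp (- 2 * real N)"
proof -
  have ind: "indep_vars (\<lambda>_. borel_vec m) u UNIV"
    and d: "\<And>t. distr M (borel_vec m) (u t) = isotropic_gaussian m \<gamma>"
    using u by (auto simp: gaussian_inputs_def)
  then have rv: "u t \<in> M \<rightarrow>\<^sub>M borel_vec m" for t by (auto simp: indep_vars_def)
  let ?h = "\<lambda>v. l2_norm v / (sqrt (real m) * (2 * \<gamma>))"
  have h: "?h \<in> borel_measurable (borel_vec m)"
    using measurable_l2_norm[of "\<lambda>v. v" "borel_vec m" m] by measurable
  have meas: "(\<lambda>\<omega>. ?h (u s \<omega>)) \<in> borel_measurable M" for s using measurable_compose[OF rv h] .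
  have "(\<integral>\<^sup>+\<omega>. ennreal (exp (\<Sum>s<N. ?h (u s \<omega>))) \<partial>M) = (\<integral>\<^sup>+\<omega>. (\<Prod>s<N. ennreal (exp (?h (u s \<omega>)))) \<partial>M)"
    by (simp add: exp_sum prod_ennreal)
  also have "\<dots> = (\<Prod>s<N. \<integral>\<^sup>+\<omega>. ennreal (exp (?h (u s \<omega>))) \<partial>M)"
  proof (rule indep_vars_nn_integral)
    have "indep_vars (\<lambda>_. borel) (\<lambda>s \<omega>. ennreal (exp (?h (u s \<omega>)))) UNIV"
      by (rule indep_vars_compose2[OF ind]) (use h in measurable)
    then show "indep_vars (\<lambda>_. borel) (\<lambda>s \<omega>. ennreal (exp (?h (u s \<omega>)))) {..<N}"
      by (rule indep_vars_subset) simp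
  qed auto
  also have "\<dots> \<le> (\<Prod>s<N. ennreal (exp 1))"
    using gaussian_norm_exp_moment[OF rv d g m] by (intro prod_mono_ennreal) auto
  also have "\<dots> = ennreal (exp (real N))"
    by (simp add: ennreal_power flip: exp_of_nat_mult)
  finally have "(\<integral>\<^sup>+\<omega>. ennreal (exp (\<Sum>s<N. ?h (u s \<omega>))) \<partial>M) \<le> ennreal (exp (real N))" .
  note chernoff_bound[OF borel_measurable_sum[OF meas] this exp_ge_zero, of "3 * real N"]
  moreover have "exp (real N) * exp (- (3 * real N)) = exp (- 2 * real N)"
    by (subst exp_add[symmetric]) simp
  ultimately show ?thesis by simp
qed

section \<open>Clean windows outweigh attacked windows in a fixed direction\<close>

definition slice :: "nat \<Rightarrow> real vec \<Rightarrow> nat \<Rightarrow> real vec" where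
  "slice m z b = vec m (\<lambda>c. z $ (b * m + c))"

lemma slice_carrier [simp]: "slice m z b \<in> carrier_vec m"
  by (simp add: slice_def)

lemma sum_slices:
  fixes f :: "nat \<Rightarrow> real"
  shows "(\<Sum>i<N * m. f i) = (\<Sum>b<N. \<Sum>c<m. f (b * m + c))"
proof -
  have "(\<Sum>i<N * m. f i) = (\<Sum>b<N. \<Sum>i\<in>{b * m..<b * m + m}. f i)" by (rule sum.nat_group[symmetric])
  then show ?thesis by (simp only: block_sum_shift)
qed

lemma sum_l2_norm_slices:
  assumes "z \<in> carrier_vec (N * m)"
  shows "(\<Sum>b<N. (l2_norm (slice m z b))\<^sup>2) = (l2_norm z)\<^sup>2"
  using assms by (simp add: l2_norm_eq_L2_set L2_set_def sum_nonneg sum_slices slice_def)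

lemma scalar_prod_stacked_input:
  assumes m: "1 \<le> m" and z: "z \<in> carrier_vec (2 * k * m)" and u: "\<And>s. u s \<in> carrier_vec m"
  shows "z \<bullet> stacked_input k m u (\<tau> + (2 * k - 1)) =
    (\<Sum>s\<in>{\<tau>..<\<tau> + 2 * k}. slice m z (\<tau> + 2 * k - 1 - s) \<bullet> u s)"
proof -
  have dim: "dim_vec (u s) = m" for s using u by (rule carrier_vecD)
  have "z \<bullet> stacked_input k m u (\<tau> + (2 * k - 1)) =
      (\<Sum>i<2 * k * m. z $ i * u (\<tau> + (2 * k - 1) - i div m) $ (i mod m))"
    by (simp add: scalar_prod_def stacked_input_def atLeast0LessThan)
  also have "\<dots> = (\<Sum>b<2 * k. \<Sum>c<m. z $ (b * m + c) * u (\<tau> + (2 * k - 1) - b) $ c)"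
    unfolding sum_slices by (intro sum.cong refl) simp
  also have "\<dots> = (\<Sum>b<2 * k. slice m z b \<bullet> u (\<tau> + (2 * k - 1) - b))"
    by (simp add: scalar_prod_def slice_def dim atLeast0LessThan)
  also have "\<dots> = (\<Sum>s\<in>{\<tau>..<\<tau> + 2 * k}. slice m z (\<tau> + 2 * k - 1 - s) \<bullet> u s)"
    by (rule sum.reindex_bij_witness[of _ "\<lambda>s. \<tau> + 2 * k - 1 - s" "\<lambda>b. \<tau> + 2 * k - 1 - b"]) auto
  finally show ?thesis .
qed

definition clean_window :: "nat \<Rightarrow> (nat \<Rightarrow> bool) \<Rightarrow> nat \<Rightarrow> bool" where
  "clean_window k \<xi> \<tau> \<longleftrightarrow> (\<forall>s\<in>{\<tau>..<\<tau> + (2 * k - 1)}. \<not> \<xi> s)"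

text \<open>Fubini's theorem for two independent maps, which may take values in different types: the second
  one is integrated first, with the first one held fixed.\<close>

lemma (in prob_space) nn_integral_iterated_of_indep_set:
  assumes X: "X \<in> M \<rightarrow>\<^sub>M S" and Y: "Y \<in> M \<rightarrow>\<^sub>M T"
    and ind: "indep_set (generated_algebra M T Y) (generated_algebra M S X)"
    and f: "(\<lambda>(x, y). f x y) \<in> borel_measurable (S \<Otimes>\<^sub>M T)"
  shows "(\<integral>\<^sup>+\<omega>. f (X \<omega>) (Y \<omega>) \<partial>M) = (\<integral>\<^sup>+\<omega>. \<integral>\<^sup>+\<omega>'. f (X \<omega>) (Y \<omega>') \<partial>M \<partial>M)"
proof -
  interpret X: prob_space "distr M S X" using X by (rule prob_space_distr)
  interpret Y: prob_space "distr M T Y" using Y by (rule prob_space_distr)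
  have law: "distr M S X \<Otimes>\<^sub>M distr M T Y = distr M (S \<Otimes>\<^sub>M T) (\<lambda>\<omega>. (X \<omega>, Y \<omega>))"
  proof (rule pair_measure_eqI)
    fix A B assume "A \<in> sets (distr M S X)" "B \<in> sets (distr M T Y)"
    then have A: "A \<in> sets S" and B: "B \<in> sets T" by auto
    have "prob ((Y -` B \<inter> space M) \<inter> (X -` A \<inter> space M)) = prob (Y -` B \<inter> space M) * prob (X -` A \<inter> space M)"
      using A B by (intro indep_setD[OF ind]) (auto simp: generated_algebra_def intro: in_vimage_algebra)
    moreover have "(\<lambda>\<omega>. (X \<omega>, Y \<omega>)) -` (A \<times> B) \<inter> space M = (Y -` B \<inter> space M) \<inter> (X -` A \<inter> space M)"
      by auto
    ultimately show "emeasure (distr M S X) A * emeasure (distr M T Y) B =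
        emeasure (distr M (S \<Otimes>\<^sub>M T) (\<lambda>\<omega>. (X \<omega>, Y \<omega>))) (A \<times> B)"
      using A B X Y by (simp add: emeasure_distr emeasure_eq_measure mult.commute flip: ennreal_mult)
  qed (auto intro: sets_pair_measure_cong X.sigma_finite_measure_axioms Y.sigma_finite_measure_axioms)
  have f': "(\<lambda>(x, y). f x y) \<in> borel_measurable (distr M S X \<Otimes>\<^sub>M distr M T Y)"
    using f by (simp cong: measurable_cong_sets)
  have "(\<integral>\<^sup>+\<omega>. f (X \<omega>) (Y \<omega>) \<partial>M) =
      (\<integral>\<^sup>+z. (\<lambda>(x, y). f x y) z \<partial>distr M (S \<Otimes>\<^sub>M T) (\<lambda>\<omega>. (X \<omega>, Y \<omega>)))"
    using f X Y by (subst nn_integral_distr) auto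
  also have "distr M (S \<Otimes>\<^sub>M T) (\<lambda>\<omega>. (X \<omega>, Y \<omega>)) = distr M S X \<Otimes>\<^sub>M distr M T Y"
    by (rule law[symmetric])
  also have "(\<integral>\<^sup>+z. (\<lambda>(x, y). f x y) z \<partial>(distr M S X \<Otimes>\<^sub>M distr M T Y)) =
      (\<integral>\<^sup>+x. \<integral>\<^sup>+y. f x y \<partial>distr M T Y \<partial>distr M S X)"
    using Y.nn_integral_fst[OF f'] by simp
  also have "\<dots> = (\<integral>\<^sup>+\<omega>. \<integral>\<^sup>+y. f (X \<omega>) y \<partial>distr M T Y \<partial>M)"
    using X Y.borel_measurable_nn_integral_fst[OF f']
    by (subst nn_integral_distr) (auto cong: measurable_cong_sets)
  also have "\<dots> = (\<integral>\<^sup>+\<omega>. \<integral>\<^sup>+\<omega>'. f (X \<omega>) (Y \<omega>') \<partial>M \<partial>M)"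
  proof (rule nn_integral_cong)
    fix \<omega> assume "\<omega> \<in> space M"
    then have "X \<omega> \<in> space S" using X by (auto dest: measurable_space)
    then have "f (X \<omega>) \<in> borel_measurable T" using measurable_Pair2[OF f] by simp
    then show "(\<integral>\<^sup>+y. f (X \<omega>) y \<partial>distr M T Y) = (\<integral>\<^sup>+\<omega>'. f (X \<omega>) (Y \<omega>') \<partial>M)"
      using Y by (subst nn_integral_distr) auto
  qed
  finally show ?thesis .
qed

definition signed_size :: "bool \<Rightarrow> real \<Rightarrow> real" where
  "signed_size b x = (if b then 1 else - 1) * \<bar>x\<bar>"

lemma measurable_signed_size:
  assumes "Measurable.pred N B" "X \<in> borel_measurable N"
  shows "(\<lambda>\<omega>. signed_size (B \<omega>) (X \<omega>)) \<in> borel_measurable N"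
proof -
  have [measurable]: "Measurable.pred N B" "X \<in> borel_measurable N" using assms .
  have "(\<lambda>\<omega>. if B \<omega> then \<bar>X \<omega>\<bar> else - \<bar>X \<omega>\<bar>) \<in> borel_measurable N" by measurable
  also have "(\<lambda>\<omega>. if B \<omega> then \<bar>X \<omega>\<bar> else - \<bar>X \<omega>\<bar>) = (\<lambda>\<omega>. signed_size (B \<omega>) (X \<omega>))"
    by (auto simp: signed_size_def)
  finally show ?thesis .
qed

text \<open>The part of the probabilistic model that the lower bound depends on: the attacks enter only
  through their times.\<close>

locale gaussian_inputs_random_attack_times = prob_space M for M :: "'a measure" +
  fixes k m :: nat and p q \<gamma> :: real
    and u :: "nat \<Rightarrow> 'a \<Rightarrow> real vec" and \<xi> :: "nat \<Rightarrow> 'a \<Rightarrow> bool"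
  assumes k: "1 \<le> k" and m: "1 \<le> m" and gamma: "0 < \<gamma>" and p: "0 \<le> p" "p \<le> 1"
    and q: "q = 1 - (1 - p) ^ (2 * k - 1)" "q < 1 / 2"
    and inputs: "gaussian_inputs M m \<gamma> u"
    and attack_times: "indep_vars (\<lambda>_. count_space UNIV) \<xi> UNIV"
    and bernoulli: "\<And>t. distr M (count_space UNIV) (\<xi> t) = measure_pmf (bernoulli_pmf p)"
    and indep: "inputs_indep_attack_times M m u \<xi>"
begin

lemma q_nonneg: "0 \<le> q"
  using p q by (simp add: power_le_one)

lemma indep_inputs: "indep_vars (\<lambda>_. borel_vec m) u UNIV"
  and law_input: "distr M (borel_vec m) (u t) = isotropic_gaussian m \<gamma>"
  and measurable_input: "u t \<in> M \<rightarrow>\<^sub>M borel_vec m"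
  using inputs by (auto simp: gaussian_inputs_def indep_vars_def)

lemma measurable_attack_time: "\<xi> t \<in> M \<rightarrow>\<^sub>M count_space UNIV"
  using attack_times by (auto simp: indep_vars_def)

text \<open>The scalar product of \<open>z\<close> with the stacked input, as a function of the whole input sequence:
  in this form it visibly depends on the times of one window only.\<close>

definition projection :: "real vec \<Rightarrow> nat \<Rightarrow> (nat \<Rightarrow> real vec) \<Rightarrow> real" where
  "projection z \<tau> v = (\<Sum>s\<in>{\<tau>..<\<tau> + 2 * k}. slice m z (\<tau> + 2 * k - 1 - s) \<bullet> v s)"

lemma projection_eq:
  assumes "z \<in> carrier_vec (2 * k * m)" "\<omega> \<in> space M"
  shows "z \<bullet> stacked_input k m (\<lambda>t. u t \<omega>) (\<tau> + (2 * k - 1)) = projection z \<tau> (\<lambda>t. u t \<omega>)"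
  unfolding projection_def
  using assms random_vec_carrier[OF measurable_input] by (intro scalar_prod_stacked_input m) auto

lemma measurable_slice: "(\<lambda>v. slice m z b \<bullet> v) \<in> borel_measurable (borel_vec m)"
  by (rule measurable_scalar_prod(2)[of "\<lambda>v. v" "borel_vec m" m]) auto

lemma measurable_projection:
  assumes "{\<tau>..<\<tau> + 2 * k} \<subseteq> K"
  shows "projection z \<tau> \<in> borel_measurable (Pi\<^sub>M K (\<lambda>_. borel_vec m))"
  unfolding projection_def
proof (rule borel_measurable_sum)
  fix s assume "s \<in> {\<tau>..<\<tau> + 2 * k}"
  then have "s \<in> K" using assms by blast
  from measurable_compose[OF measurable_component_singleton[OF this, of "\<lambda>_. borel_vec m"] measurable_slice]
  show "(\<lambda>v. slice m z (\<tau> + 2 * k - 1 - s) \<bullet> v s) \<in> borel_measurable (Pi\<^sub>M K (\<lambda>_. borel_vec m))" .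
qed

lemma projection_restrict:
  "projection z \<tau> (restrict v {\<tau>..<\<tau> + 2 * k}) = projection z \<tau> v"
  unfolding projection_def by (intro sum.cong) auto

lemma measurable_clean_window:
  assumes "{\<tau>..<\<tau> + 2 * k} \<subseteq> K"
  shows "Measurable.pred (Pi\<^sub>M K (\<lambda>_. count_space UNIV)) (\<lambda>x. clean_window k x \<tau>)"
proof -
  have "Measurable.pred (Pi\<^sub>M K (\<lambda>_. count_space UNIV)) (\<lambda>x. x s)" if "s \<in> {\<tau>..<\<tau> + (2 * k - 1)}" for s
    using assms that by (intro measurable_component_singleton) auto
  then show ?thesis unfolding clean_window_def
    by (intro pred_intros_finite pred_intros_logic) auto
qed

lemma clean_window_restrict:
  "clean_window k (restrict x {\<tau>..<\<tau> + 2 * k}) \<tau> \<longleftrightarrow> clean_window k x \<tau>"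
  unfolding clean_window_def by auto

lemma measurable_inputs_process:
  "(\<lambda>\<omega> t. u t \<omega>) \<in> M \<rightarrow>\<^sub>M Pi\<^sub>M UNIV (\<lambda>_. borel_vec m)"
  by (intro measurable_abs_UNIV measurable_input)

lemma measurable_attack_process:
  "(\<lambda>\<omega> t. \<xi> t \<omega>) \<in> M \<rightarrow>\<^sub>M Pi\<^sub>M UNIV (\<lambda>_. count_space UNIV)"
  by (intro measurable_abs_UNIV measurable_attack_time)

lemma indep_inputs_attack_times:
  "indep_set (generated_algebra M (Pi\<^sub>M UNIV (\<lambda>_. borel_vec m)) (\<lambda>\<omega> t. u t \<omega>))
     (generated_algebra M (Pi\<^sub>M UNIV (\<lambda>_. count_space UNIV)) (\<lambda>\<omega> t. \<xi> t \<omega>))"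
  using indep by (simp add: inputs_indep_attack_times_def)

lemma law_projection:
  assumes z: "z \<in> carrier_vec (2 * k * m)"
  shows "distr M borel (\<lambda>\<omega>. projection z \<tau> (\<lambda>t. u t \<omega>)) = centred_normal (\<gamma> * l2_norm z)"
proof -
  let ?I = "{\<tau>..<\<tau> + 2 * k}" and ?v = "\<lambda>s. slice m z (\<tau> + 2 * k - 1 - s)"
  have "indep_vars (\<lambda>_. borel) (\<lambda>s \<omega>. ?v s \<bullet> u s \<omega>) UNIV"
    by (rule indep_vars_compose2[OF indep_inputs measurable_slice])
  then have "indep_vars (\<lambda>_. borel) (\<lambda>s \<omega>. ?v s \<bullet> u s \<omega>) ?I" by (rule indep_vars_subset) simp
  then have "distr M borel (\<lambda>\<omega>. \<Sum>s\<in>?I. ?v s \<bullet> u s \<omega>) =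
      centred_normal (sqrt (\<Sum>s\<in>?I. (\<gamma> * l2_norm (?v s))\<^sup>2))"
    using gamma
    by (intro centred_normal_sum
        linear_form_of_isotropic_gaussian[OF measurable_input law_input gamma slice_carrier]) auto
  also have "(\<Sum>s\<in>?I. (\<gamma> * l2_norm (?v s))\<^sup>2) = (\<Sum>b<2 * k. (\<gamma> * l2_norm (slice m z b))\<^sup>2)"
    by (rule sum.reindex_bij_witness[of _ "\<lambda>b. \<tau> + 2 * k - 1 - b" "\<lambda>s. \<tau> + 2 * k - 1 - s"]) auto
  also have "\<dots> = (\<gamma> * l2_norm z)\<^sup>2"
    using sum_l2_norm_slices[OF z] by (simp add: power_mult_distrib flip: sum_distrib_left)
  also have "sqrt \<dots> = \<gamma> * l2_norm z" using gamma by simp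
  finally show ?thesis by (simp add: projection_def)
qed

lemma prob_clean_window: "prob {\<omega> \<in> space M. clean_window k (\<lambda>t. \<xi> t \<omega>) \<tau>} = 1 - q"
proof -
  let ?I = "{\<tau>..<\<tau> + (2 * k - 1)}" and ?G = "{\<omega> \<in> space M. clean_window k (\<lambda>t. \<xi> t \<omega>) \<tau>}"
  let ?f = "\<lambda>b. if b then 0 else 1 :: ennreal"
  have "Measurable.pred M (\<lambda>\<omega>. clean_window k (\<lambda>t. \<xi> t \<omega>) \<tau>)"
    by (rule measurable_compose[OF measurable_attack_process measurable_clean_window]) simp
  then have "?G \<in> sets M" by (simp add: pred_def)
  then have "emeasure M ?G = (\<integral>\<^sup>+\<omega>. indicator ?G \<omega> \<partial>M)" by simp
  also have "\<dots> = (\<integral>\<^sup>+\<omega>. (\<Prod>s\<in>?I. ?f (\<xi> s \<omega>)) \<partial>M)"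
  proof (rule nn_integral_cong)
    fix \<omega> assume \<omega>: "\<omega> \<in> space M"
    show "indicator ?G \<omega> = (\<Prod>s\<in>?I. ?f (\<xi> s \<omega>))"
    proof (cases "clean_window k (\<lambda>t. \<xi> t \<omega>) \<tau>")
      case True
      then show ?thesis using \<omega> by (simp add: clean_window_def)
    next
      case False
      then obtain s where "s \<in> ?I" "\<xi> s \<omega>" by (auto simp: clean_window_def)
      then have "(\<Prod>s\<in>?I. ?f (\<xi> s \<omega>)) = 0" by (intro prod_zero) auto
      then show ?thesis using False by simp
    qed
  qed
  also have "\<dots> = (\<Prod>s\<in>?I. \<integral>\<^sup>+\<omega>. ?f (\<xi> s \<omega>) \<partial>M)"
  proof (rule indep_vars_nn_integral)
    have "indep_vars (\<lambda>_. borel) (\<lambda>s \<omega>. ?f (\<xi> s \<omega>)) UNIV"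
      by (rule indep_vars_compose2[OF attack_times]) simp
    then show "indep_vars (\<lambda>_. borel) (\<lambda>s \<omega>. ?f (\<xi> s \<omega>)) ?I" by (rule indep_vars_subset) simp
  qed auto
  also have "\<dots> = (\<Prod>s\<in>?I. ennreal (1 - p))"
  proof (rule prod.cong[OF refl])
    fix s
    have "(\<integral>\<^sup>+\<omega>. ?f (\<xi> s \<omega>) \<partial>M) = (\<integral>\<^sup>+b. ?f b \<partial>distr M (count_space UNIV) (\<xi> s))"
      by (subst nn_integral_distr[OF measurable_attack_time]) auto
    also have "\<dots> = ennreal (1 - p)" unfolding bernoulli using p by (simp add: mult.commute)
    finally show "(\<integral>\<^sup>+\<omega>. ?f (\<xi> s \<omega>) \<partial>M) = ennreal (1 - p)" .
  qed
  also have "\<dots> = ennreal (1 - q)" using p q by (simp add: ennreal_power)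
  finally show ?thesis using q by (simp add: emeasure_eq_measure)
qed

text \<open>Windows that do not overlap are independent, so along such windows the exponential moment is a
  product. Integrating over the inputs first, with the attack times held fixed, leaves a product
  over the windows of functions of the attack times alone.\<close>

lemma disjoint_windows_exp_moment:
  assumes z: "z \<in> carrier_vec (2 * k * m)" "0 < l2_norm z" and S: "finite S"
    and disj: "disjoint_family_on (\<lambda>\<tau>. {\<tau>..<\<tau> + 2 * k}) S"
  defines "\<mu> \<equiv> (1 - 2 * q) / (4 * (\<gamma> * l2_norm z))"
  shows "(\<integral>\<^sup>+\<omega>. ennreal (exp (- \<mu> * (\<Sum>\<tau>\<in>S. signed_size (clean_window k (\<lambda>t. \<xi> t \<omega>) \<tau>)
      (projection z \<tau> (\<lambda>t. u t \<omega>))))) \<partial>M) \<le> ennreal (exp (- (1 - 2 * q)\<^sup>2 / 8)) ^ card S"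
proof -
  let ?W = "\<lambda>\<tau>. {\<tau>..<\<tau> + 2 * k}" and ?N = "centred_normal (\<gamma> * l2_norm z)"
  define \<phi> where "\<phi> b x = ennreal (exp (- \<mu> * signed_size b x))" for b x
  define h where "h b = (\<integral>\<^sup>+x. \<phi> b x \<partial>?N)" for b
  have phi_meas: "\<phi> b \<in> borel_measurable borel" for b
    unfolding \<phi>_def by (cases b) (simp_all add: signed_size_def)
  have phi: "\<phi> True x = ennreal (exp (- \<mu> * \<bar>x\<bar>))" "\<phi> False x = ennreal (exp (\<mu> * \<bar>x\<bar>))" for x
    by (simp_all add: \<phi>_def signed_size_def)
  have h_bound: "h True * ennreal (1 - q) + h False * ennreal q \<le> ennreal (exp (- (1 - 2 * q)\<^sup>2 / 8))"
  proof -
    have "h True * ennreal (1 - q) + h False * ennreal q = (\<integral>\<^sup>+x. \<phi> True x * ennreal (1 - q) + \<phi> False x * ennreal q \<partial>?N)"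
      using phi_meas unfolding h_def by (simp add: nn_integral_add nn_integral_multc cong: measurable_cong_sets)
    also have "\<dots> = (\<integral>\<^sup>+x. ennreal ((1 - q) * exp (- \<mu> * \<bar>x\<bar>) + q * exp (\<mu> * \<bar>x\<bar>)) \<partial>?N)"
      unfolding phi using q q_nonneg by (simp add: ennreal_mult mult.commute)
    also have "\<dots> \<le> ennreal (exp (- (1 - 2 * q)\<^sup>2 / 8))"
      unfolding \<mu>_def using q q_nonneg gamma z by (intro signed_normal_exp_moment) auto
    finally show ?thesis .
  qed
  define F where "F x v = (\<Prod>\<tau>\<in>S. \<phi> (clean_window k x \<tau>) (projection z \<tau> v))" for x v
  have proj: "(\<lambda>\<omega>. projection z \<tau> (\<lambda>t. u t \<omega>)) \<in> borel_measurable M" for \<tau>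
    by (rule measurable_compose[OF measurable_inputs_process measurable_projection]) simp
  have clean: "Measurable.pred M (\<lambda>\<omega>. clean_window k (\<lambda>t. \<xi> t \<omega>) \<tau>)" for \<tau>
    by (rule measurable_compose[OF measurable_attack_process measurable_clean_window]) simp
  have F_meas: "(\<lambda>(x, v). F x v) \<in> borel_measurable (Pi\<^sub>M UNIV (\<lambda>_. count_space UNIV) \<Otimes>\<^sub>M Pi\<^sub>M UNIV (\<lambda>_. borel_vec m))"
  proof -
    have "(\<lambda>y. signed_size (clean_window k (fst y) \<tau>) (projection z \<tau> (snd y)))
      \<in> borel_measurable (Pi\<^sub>M UNIV (\<lambda>_. count_space UNIV) \<Otimes>\<^sub>M Pi\<^sub>M UNIV (\<lambda>_. borel_vec m))" for \<tau>
      by (intro measurable_signed_size measurable_compose[OF measurable_fst measurable_clean_window]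
          measurable_compose[OF measurable_snd measurable_projection]) auto
    then show ?thesis unfolding F_def \<phi>_def case_prod_beta
      by (intro borel_measurable_prod_ennreal measurable_compose[OF _ measurable_ennreal]
          measurable_compose[OF _ borel_measurable_exp] borel_measurable_times borel_measurable_const) auto
  qed
  have inner: "(\<integral>\<^sup>+\<omega>. F x (\<lambda>t. u t \<omega>) \<partial>M) = (\<Prod>\<tau>\<in>S. h (clean_window k x \<tau>))" for x
  proof -
    have "indep_vars (\<lambda>\<tau>. Pi\<^sub>M (?W \<tau>) (\<lambda>_. borel_vec m)) (\<lambda>\<tau> \<omega>. restrict (\<lambda>t. u t \<omega>) (?W \<tau>)) S"
      by (rule indep_vars_restrict[OF indep_inputs _ disj]) simp
    then have "indep_vars (\<lambda>_. borel) (\<lambda>\<tau> \<omega>. \<phi> (clean_window k x \<tau>) (projection z \<tau> (restrict (\<lambda>t. u t \<omega>) (?W \<tau>)))) S"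
      by (rule indep_vars_compose2) (intro measurable_compose[OF measurable_projection phi_meas], simp)
    then have "(\<integral>\<^sup>+\<omega>. F x (\<lambda>t. u t \<omega>) \<partial>M) =
        (\<Prod>\<tau>\<in>S. \<integral>\<^sup>+\<omega>. \<phi> (clean_window k x \<tau>) (projection z \<tau> (\<lambda>t. u t \<omega>)) \<partial>M)"
      unfolding F_def projection_restrict using S by (intro indep_vars_nn_integral) auto
    also have "\<dots> = (\<Prod>\<tau>\<in>S. h (clean_window k x \<tau>))"
    proof (rule prod.cong[OF refl])
      fix \<tau>
      show "(\<integral>\<^sup>+\<omega>. \<phi> (clean_window k x \<tau>) (projection z \<tau> (\<lambda>t. u t \<omega>)) \<partial>M) = h (clean_window k x \<tau>)"
        unfolding h_def law_projection[OF z(1), of \<tau>, symmetric]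
        by (rule nn_integral_distr[OF proj, symmetric]) (use phi_meas in simp)
    qed
    finally show ?thesis .
  qed
  have outer: "(\<integral>\<^sup>+\<omega>. (\<Prod>\<tau>\<in>S. h (clean_window k (\<lambda>t. \<xi> t \<omega>) \<tau>)) \<partial>M) =
      (\<Prod>\<tau>\<in>S. \<integral>\<^sup>+\<omega>. h (clean_window k (\<lambda>t. \<xi> t \<omega>) \<tau>) \<partial>M)"
  proof -
    have "indep_vars (\<lambda>\<tau>. Pi\<^sub>M (?W \<tau>) (\<lambda>_. count_space UNIV)) (\<lambda>\<tau> \<omega>. restrict (\<lambda>t. \<xi> t \<omega>) (?W \<tau>)) S"
      by (rule indep_vars_restrict[OF attack_times _ disj]) simp
    then have "indep_vars (\<lambda>_. borel) (\<lambda>\<tau> \<omega>. h (clean_window k (restrict (\<lambda>t. \<xi> t \<omega>) (?W \<tau>)) \<tau>)) S"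
      by (rule indep_vars_compose2) (intro measurable_compose[OF measurable_clean_window], auto)
    then show ?thesis unfolding clean_window_restrict using S by (intro indep_vars_nn_integral) auto
  qed
  have single: "(\<integral>\<^sup>+\<omega>. h (clean_window k (\<lambda>t. \<xi> t \<omega>) \<tau>) \<partial>M) = h True * ennreal (1 - q) + h False * ennreal q" for \<tau>
  proof -
    let ?G = "{\<omega> \<in> space M. clean_window k (\<lambda>t. \<xi> t \<omega>) \<tau>}"
    have G: "?G \<in> sets M" using clean[of \<tau>] by (simp add: pred_def)
    have "(\<integral>\<^sup>+\<omega>. h (clean_window k (\<lambda>t. \<xi> t \<omega>) \<tau>) \<partial>M) =
        (\<integral>\<^sup>+\<omega>. h True * indicator ?G \<omega> + h False * indicator (space M - ?G) \<omega> \<partial>M)"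
      by (intro nn_integral_cong) (auto simp: indicator_def)
    also have "\<dots> = h True * emeasure M ?G + h False * emeasure M (space M - ?G)"
      using G by (simp add: nn_integral_add nn_integral_cmult)
    also have "\<dots> = h True * ennreal (1 - q) + h False * ennreal q"
      using G by (simp add: emeasure_eq_measure prob_compl prob_clean_window)
    finally show ?thesis .
  qed
  have "(\<integral>\<^sup>+\<omega>. ennreal (exp (- \<mu> * (\<Sum>\<tau>\<in>S. signed_size (clean_window k (\<lambda>t. \<xi> t \<omega>) \<tau>)
      (projection z \<tau> (\<lambda>t. u t \<omega>))))) \<partial>M) = (\<integral>\<^sup>+\<omega>. F (\<lambda>t. \<xi> t \<omega>) (\<lambda>t. u t \<omega>) \<partial>M)"
    by (simp add: F_def \<phi>_def sum_distrib_left exp_sum[OF S] prod_ennreal flip: sum_negf)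
  also have "\<dots> = (\<integral>\<^sup>+\<omega>. \<integral>\<^sup>+\<omega>'. F (\<lambda>t. \<xi> t \<omega>) (\<lambda>t. u t \<omega>') \<partial>M \<partial>M)"
    by (rule nn_integral_iterated_of_indep_set[OF measurable_attack_process
        measurable_inputs_process indep_inputs_attack_times F_meas])
  also have "\<dots> = (\<Prod>\<tau>\<in>S. h True * ennreal (1 - q) + h False * ennreal q)"
    by (simp only: inner outer single)
  also have "\<dots> \<le> (\<Prod>\<tau>\<in>S. ennreal (exp (- (1 - 2 * q)\<^sup>2 / 8)))"
    using h_bound by (intro prod_mono_ennreal) auto
  finally show ?thesis by simp
qed

lemma window_class_card:
  assumes c: "c < 2 * k"
  shows "T div (2 * k) \<le> card {\<tau>\<in>{..<T}. \<tau> mod (2 * k) = c}"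
proof -
  have "inj_on (\<lambda>i. i * (2 * k) + c) {..<T div (2 * k)}" using c by (auto simp: inj_on_def)
  moreover have "(\<lambda>i. i * (2 * k) + c) ` {..<T div (2 * k)} \<subseteq> {\<tau>\<in>{..<T}. \<tau> mod (2 * k) = c}"
  proof (rule image_subsetI)
    fix i assume "i \<in> {..<T div (2 * k)}"
    then have "Suc i * (2 * k) \<le> T div (2 * k) * (2 * k)" by (intro mult_right_mono) auto
    also have "\<dots> \<le> T" by simp
    finally have "i * (2 * k) + c < T" using c by simp
    then show "i * (2 * k) + c \<in> {\<tau>\<in>{..<T}. \<tau> mod (2 * k) = c}" using c by simp
  qed
  ultimately show ?thesis
    using card_inj_on_le[of "\<lambda>i. i * (2 * k) + c" "{..<T div (2 * k)}"] by simp
qed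

lemma disjoint_windows:
  "disjoint_family_on (\<lambda>\<tau>. {\<tau>..<\<tau> + 2 * k}) {\<tau>\<in>{..<T}. \<tau> mod (2 * k) = c}"
proof -
  have "\<tau> = \<tau>'" if "\<tau> mod (2 * k) = \<tau>' mod (2 * k)" "s \<in> {\<tau>..<\<tau> + 2 * k}" "s \<in> {\<tau>'..<\<tau>' + 2 * k}" for \<tau> \<tau>' s
  proof -
    have *: "a = b" if "a \<le> b" "b < a + 2 * k" "a mod (2 * k) = b mod (2 * k)" for a b :: nat
    proof -
      have "2 * k dvd b - a" using that by (simp only: mod_eq_dvd_iff_nat[symmetric])
      then have "b - a = 0" using that nat_dvd_not_less[of "b - a" "2 * k"] by linarith
      then show ?thesis using that by simp
    qed
    show ?thesis
      using that *[of \<tau> \<tau>'] *[of \<tau>' \<tau>] by (cases "\<tau> \<le> \<tau>'") auto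
  qed
  then show ?thesis unfolding disjoint_family_on_def by blast
qed

lemma measurable_signed_size_window:
  "(\<lambda>\<omega>. signed_size (clean_window k (\<lambda>t. \<xi> t \<omega>) \<tau>) (projection z \<tau> (\<lambda>t. u t \<omega>))) \<in> borel_measurable M"
  by (intro measurable_signed_size measurable_compose[OF measurable_attack_process measurable_clean_window]
      measurable_compose[OF measurable_inputs_process measurable_projection]) auto

text \<open>Consecutive windows overlap, but windows whose starting points agree modulo \<open>2 k\<close> do not.
  Jensen's inequality for the average over the \<open>2 k\<close> residue classes reduces the exponential
  moment of the full sum to those of the classes; its price is the factor \<open>k\<close> in the exponent.\<close>

lemma signed_sum_tail:
  assumes z: "z \<in> carrier_vec (2 * k * m)" "0 < l2_norm z" and T: "4 * k \<le> T"
  shows "prob {\<omega> \<in> space M. (\<Sum>\<tau><T. signed_size (clean_window k (\<lambda>t. \<xi> t \<omega>) \<tau>)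
      (projection z \<tau> (\<lambda>t. u t \<omega>))) < (1 - 2 * q) * real T / 8 * (\<gamma> * l2_norm z)}
    \<le> exp (- ((1 - 2 * q)\<^sup>2 * real T / (64 * real k)))"
proof -
  define a where "a = 1 - 2 * q"
  define \<sigma> where "\<sigma> = \<gamma> * l2_norm z"
  define \<mu> where "\<mu> = a / (4 * \<sigma>)"
  define \<kappa> where "\<kappa> = \<mu> / (2 * real k)"
  define X where "X \<tau> \<omega> = signed_size (clean_window k (\<lambda>t. \<xi> t \<omega>) \<tau>) (projection z \<tau> (\<lambda>t. u t \<omega>))" for \<tau> \<omega>
  define S where "S c = {\<tau>\<in>{..<T}. \<tau> mod (2 * k) = c}" for c
  have a: "0 < a" using q by (simp add: a_def)
  \<comment> \<open>\<open>\<mu>\<close> is the exponent within one residue class; averaging over the \<open>2 k\<close> classes turns it into \<open>\<kappa>\<close>.\<close>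
  have sig: "0 < \<sigma>" using gamma z by (simp add: \<sigma>_def)
  have mu: "0 < \<mu>" "0 < \<kappa>" using a sig k by (auto simp: \<mu>_def \<kappa>_def)
  have X: "X \<tau> \<in> borel_measurable M" for \<tau>
    unfolding X_def by (rule measurable_signed_size_window)
  have total: "(\<Sum>\<tau><T. X \<tau> \<omega>) = (\<Sum>c<2 * k. \<Sum>\<tau>\<in>S c. X \<tau> \<omega>)" for \<omega>
    unfolding S_def using k by (intro sum.group[symmetric]) auto
  have jensen: "exp (- \<kappa> * (\<Sum>\<tau><T. X \<tau> \<omega>)) \<le>
      (\<Sum>c<2 * k. 1 / (2 * real k) * exp (- \<mu> * (\<Sum>\<tau>\<in>S c. X \<tau> \<omega>)))" for \<omega>
  proof -
    have "- \<kappa> * (\<Sum>\<tau><T. X \<tau> \<omega>) = (\<Sum>c<2 * k. 1 / (2 * real k) * (- \<mu> * (\<Sum>\<tau>\<in>S c. X \<tau> \<omega>)))"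
      unfolding total \<kappa>_def by (simp add: sum_distrib_left sum_negf)
    then show ?thesis
      using exp_subconvex_combination[of "{..<2 * k}" "\<lambda>_. 1 / (2 * real k)" "\<lambda>c. - \<mu> * (\<Sum>\<tau>\<in>S c. X \<tau> \<omega>)"] k
      by simp
  qed
  have e1: "exp (- a\<^sup>2 / 8) \<le> 1" by simp
  have class_moment: "(\<integral>\<^sup>+\<omega>. ennreal (exp (- \<mu> * (\<Sum>\<tau>\<in>S c. X \<tau> \<omega>))) \<partial>M) \<le> ennreal (exp (- a\<^sup>2 / 8) ^ (T div (2 * k)))"
    if c: "c < 2 * k" for c
  proof -
    have "(\<integral>\<^sup>+\<omega>. ennreal (exp (- \<mu> * (\<Sum>\<tau>\<in>S c. X \<tau> \<omega>))) \<partial>M) \<le> ennreal (exp (- a\<^sup>2 / 8)) ^ card (S c)"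
      unfolding X_def \<mu>_def \<sigma>_def a_def
      by (rule disjoint_windows_exp_moment[OF z _ disjoint_windows[of T c, folded S_def]]) (simp add: S_def)
    also have "\<dots> = ennreal (exp (- a\<^sup>2 / 8) ^ card (S c))" by (simp add: ennreal_power)
    also have "\<dots> \<le> ennreal (exp (- a\<^sup>2 / 8) ^ (T div (2 * k)))"
      using window_class_card[OF c, of T] e1 unfolding S_def by (intro ennreal_leI power_decreasing) auto
    finally show ?thesis .
  qed
  have "(\<integral>\<^sup>+\<omega>. ennreal (exp (- \<kappa> * (\<Sum>\<tau><T. X \<tau> \<omega>))) \<partial>M) \<le>
      (\<integral>\<^sup>+\<omega>. (\<Sum>c<2 * k. ennreal (1 / (2 * real k)) * ennreal (exp (- \<mu> * (\<Sum>\<tau>\<in>S c. X \<tau> \<omega>)))) \<partial>M)"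
  proof (rule nn_integral_mono)
    fix \<omega>
    have "(\<Sum>c<2 * k. ennreal (1 / (2 * real k)) * ennreal (exp (- \<mu> * (\<Sum>\<tau>\<in>S c. X \<tau> \<omega>)))) =
        (\<Sum>c<2 * k. ennreal (1 / (2 * real k) * exp (- \<mu> * (\<Sum>\<tau>\<in>S c. X \<tau> \<omega>))))"
      by (intro sum.cong refl ennreal_mult[symmetric]) auto
    also have "\<dots> = ennreal (\<Sum>c<2 * k. 1 / (2 * real k) * exp (- \<mu> * (\<Sum>\<tau>\<in>S c. X \<tau> \<omega>)))"
      by (intro sum_ennreal) simp
    finally show "ennreal (exp (- \<kappa> * (\<Sum>\<tau><T. X \<tau> \<omega>))) \<le>
        (\<Sum>c<2 * k. ennreal (1 / (2 * real k)) * ennreal (exp (- \<mu> * (\<Sum>\<tau>\<in>S c. X \<tau> \<omega>))))"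
      using jensen[of \<omega>] by (simp only: ennreal_leI)
  qed
  also have "\<dots> = (\<Sum>c<2 * k. ennreal (1 / (2 * real k)) * (\<integral>\<^sup>+\<omega>. ennreal (exp (- \<mu> * (\<Sum>\<tau>\<in>S c. X \<tau> \<omega>))) \<partial>M))"
  proof -
    have "(\<lambda>\<omega>. ennreal (exp (- \<mu> * (\<Sum>\<tau>\<in>S c. X \<tau> \<omega>)))) \<in> borel_measurable M" for c
      using X by measurable
    then show ?thesis by (simp add: nn_integral_sum nn_integral_cmult)
  qed
  also have "\<dots> \<le> (\<Sum>c<2 * k. ennreal (1 / (2 * real k)) * ennreal (exp (- a\<^sup>2 / 8) ^ (T div (2 * k))))"
    using class_moment by (intro sum_mono mult_left_mono) auto
  also have "\<dots> = ennreal (\<Sum>c<2 * k. 1 / (2 * real k) * exp (- a\<^sup>2 / 8) ^ (T div (2 * k)))"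
  proof -
    have "(\<Sum>c<2 * k. ennreal (1 / (2 * real k)) * ennreal (exp (- a\<^sup>2 / 8) ^ (T div (2 * k)))) =
      (\<Sum>c<2 * k. ennreal (1 / (2 * real k) * exp (- a\<^sup>2 / 8) ^ (T div (2 * k))))"
      by (intro sum.cong refl ennreal_mult[symmetric]) auto
    also have "\<dots> = ennreal (\<Sum>c<2 * k. 1 / (2 * real k) * exp (- a\<^sup>2 / 8) ^ (T div (2 * k)))"
      by (intro sum_ennreal) simp
    finally show ?thesis .
  qed
  also have "(\<Sum>c<2 * k. 1 / (2 * real k) * exp (- a\<^sup>2 / 8) ^ (T div (2 * k))) = exp (- a\<^sup>2 / 8) ^ (T div (2 * k))"
    using k by simp
  also have "\<dots> = exp (- (real (T div (2 * k)) * a\<^sup>2 / 8))"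
    by (simp flip: exp_of_nat_mult)
  finally have mom: "(\<integral>\<^sup>+\<omega>. ennreal (exp (- \<kappa> * (\<Sum>\<tau><T. X \<tau> \<omega>))) \<partial>M) \<le>
      ennreal (exp (- (real (T div (2 * k)) * a\<^sup>2 / 8)))" .
  define \<theta> where "\<theta> = a * real T / 8 * \<sigma>"
  have "(\<lambda>\<omega>. - \<kappa> * (\<Sum>\<tau><T. X \<tau> \<omega>)) \<in> borel_measurable M" using X by measurable
  note chernoff_bound[OF this mom exp_ge_zero, of "- \<kappa> * \<theta>"]
  also have "exp (- (real (T div (2 * k)) * a\<^sup>2 / 8)) * exp (- (- \<kappa> * \<theta>)) \<le> exp (- (a\<^sup>2 * real T / (64 * real k)))"
  proof -
    have "\<kappa> * \<theta> = a\<^sup>2 * real T / (64 * real k)"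
      using sig k by (simp add: \<kappa>_def \<mu>_def \<theta>_def power2_eq_square field_simps)
    moreover have "real T \<le> 4 * real k * real (T div (2 * k))"
    proof -
      have "1 \<le> T div (2 * k)" using T k by (simp add: Suc_le_eq div_greater_zero_iff)
      then have "2 * k \<le> 2 * k * (T div (2 * k))" by simp
      moreover have "T = 2 * k * (T div (2 * k)) + T mod (2 * k)" by simp
      moreover have "T mod (2 * k) < 2 * k" using k by simp
      ultimately have "T \<le> 4 * k * (T div (2 * k))" by linarith
      then show ?thesis by (metis of_nat_le_iff of_nat_mult of_nat_numeral)
    qed
    then have "a\<^sup>2 * real T / (32 * real k) \<le> real (T div (2 * k)) * a\<^sup>2 / 8"
      using k mult_left_mono[of "real T" "4 * real k * real (T div (2 * k))" "a\<^sup>2"]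
      by (simp add: field_simps)
    ultimately have "- (real (T div (2 * k)) * a\<^sup>2 / 8) + \<kappa> * \<theta> \<le> - (a\<^sup>2 * real T / (64 * real k))"
      by (simp add: field_simps)
    then show ?thesis by (simp flip: exp_add)
  qed
  finally have "prob {\<omega> \<in> space M. - \<kappa> * \<theta> < - \<kappa> * (\<Sum>\<tau><T. X \<tau> \<omega>)} \<le> exp (- (a\<^sup>2 * real T / (64 * real k)))" .
  moreover have "{\<omega> \<in> space M. - \<kappa> * \<theta> < - \<kappa> * (\<Sum>\<tau><T. X \<tau> \<omega>)} = {\<omega> \<in> space M. (\<Sum>\<tau><T. X \<tau> \<omega>) < \<theta>}"
    using mu by auto
  ultimately show ?thesis by (simp add: X_def \<theta>_def a_def \<sigma>_def)
qed

end

section \<open>Uniformity over all directions\<close>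

definition grid_point :: "nat \<Rightarrow> nat \<Rightarrow> (nat \<Rightarrow> int) \<Rightarrow> real vec" where
  "grid_point d N g = vec d (\<lambda>i. real_of_int (g i) / real N)"

lemma grid_point_carrier [simp]: "grid_point d N g \<in> carrier_vec d"
  by (simp add: grid_point_def)

lemma card_grid: "card ({..<d} \<rightarrow>\<^sub>E {- int N..int N}) = (2 * N + 1) ^ d"
  by (simp add: card_PiE nat_add_distrib nat_mult_distrib)

text \<open>Every time lies in at most \<open>2 k\<close> windows.\<close>

lemma sum_windows_le:
  fixes f :: "nat \<Rightarrow> real"
  assumes "\<And>s. 0 \<le> f s" and k: "1 \<le> k"
  shows "(\<Sum>\<tau><T. \<Sum>s\<in>{\<tau>..<\<tau> + 2 * k}. f s) \<le> 2 * real k * (\<Sum>s<T + (2 * k - 1). f s)"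
proof -
  have "(\<Sum>\<tau><T. \<Sum>s\<in>{\<tau>..<\<tau> + 2 * k}. f s) = (\<Sum>\<tau><T. \<Sum>b<2 * k. f (\<tau> + b))"
  proof (rule sum.cong[OF refl])
    fix \<tau>
    show "(\<Sum>s\<in>{\<tau>..<\<tau> + 2 * k}. f s) = (\<Sum>b<2 * k. f (\<tau> + b))"
      by (rule sum.reindex_bij_witness[of _ "\<lambda>b. \<tau> + b" "\<lambda>s. s - \<tau>"]) auto
  qed
  also have "\<dots> = (\<Sum>b<2 * k. \<Sum>\<tau><T. f (\<tau> + b))" by (rule sum.swap)
  also have "\<dots> \<le> (\<Sum>b<2 * k. \<Sum>s<T + (2 * k - 1). f s)"
  proof (rule sum_mono)
    fix b assume b: "b \<in> {..<2 * k}"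
    have "(\<Sum>\<tau><T. f (\<tau> + b)) = (\<Sum>s\<in>(\<lambda>\<tau>. \<tau> + b) ` {..<T}. f s)"
      by (subst sum.reindex) (auto simp: inj_on_def)
    also have "\<dots> \<le> (\<Sum>s<T + (2 * k - 1). f s)"
      using assms b by (intro sum_mono2) auto
    finally show "(\<Sum>\<tau><T. f (\<tau> + b)) \<le> (\<Sum>s<T + (2 * k - 1). f s)" .
  qed
  also have "\<dots> = 2 * real k * (\<Sum>s<T + (2 * k - 1). f s)"
    by (simp only: sum_constant card_lessThan of_nat_mult of_nat_numeral)
  finally show ?thesis .
qed

lemma stacked_input_small_coefficients:
  assumes m: "1 \<le> m" and k: "1 \<le> k" and y: "y \<in> carrier_vec (2 * k * m)"
    and small: "\<And>i. i < 2 * k * m \<Longrightarrow> \<bar>y $ i\<bar> \<le> h" and h: "0 \<le> h"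
    and u: "\<And>s. u s \<in> carrier_vec m"
  shows "(\<Sum>\<tau><T. \<bar>y \<bullet> stacked_input k m u (\<tau> + (2 * k - 1))\<bar>) \<le>
    2 * real k * sqrt (real m) * h * (\<Sum>s<T + (2 * k - 1). l2_norm (u s))"
proof -
  have slice: "l2_norm (slice m y b) \<le> sqrt (real m) * h" if b: "b < 2 * k" for b
  proof -
    have "l2_norm (slice m y b) = L2_set (\<lambda>c. \<bar>y $ (b * m + c)\<bar>) {..<m}"
      by (simp add: l2_norm_eq_L2_set L2_set_def slice_def)
    also have "\<dots> \<le> L2_set (\<lambda>c. h) {..<m}"
    proof (rule L2_set_mono)
      fix c assume c: "c \<in> {..<m}"
      have "b * m + c < Suc b * m" using c by simp
      also have "\<dots> \<le> 2 * k * m" using b by (intro mult_right_mono) auto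
      finally show "\<bar>y $ (b * m + c)\<bar> \<le> h" by (rule small)
    qed simp
    finally have "l2_norm (slice m y b) \<le> L2_set (\<lambda>c. h) {..<m}" .
    then show ?thesis using h by (simp add: L2_set_constant)
  qed
  have "(\<Sum>\<tau><T. \<bar>y \<bullet> stacked_input k m u (\<tau> + (2 * k - 1))\<bar>) \<le>
      (\<Sum>\<tau><T. \<Sum>s\<in>{\<tau>..<\<tau> + 2 * k}. sqrt (real m) * h * l2_norm (u s))"
  proof (rule sum_mono)
    fix \<tau>
    have "\<bar>y \<bullet> stacked_input k m u (\<tau> + (2 * k - 1))\<bar> \<le>
        (\<Sum>s\<in>{\<tau>..<\<tau> + 2 * k}. \<bar>slice m y (\<tau> + 2 * k - 1 - s) \<bullet> u s\<bar>)"
      unfolding scalar_prod_stacked_input[OF m y u] by (rule sum_abs)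
    also have "\<dots> \<le> (\<Sum>s\<in>{\<tau>..<\<tau> + 2 * k}. sqrt (real m) * h * l2_norm (u s))"
    proof (rule sum_mono)
      fix s assume "s \<in> {\<tau>..<\<tau> + 2 * k}"
      then have "l2_norm (slice m y (\<tau> + 2 * k - 1 - s)) \<le> sqrt (real m) * h" by (intro slice) auto
      then show "\<bar>slice m y (\<tau> + 2 * k - 1 - s) \<bullet> u s\<bar> \<le> sqrt (real m) * h * l2_norm (u s)"
        using abs_scalar_prod_le[OF slice_carrier u, of y "\<tau> + 2 * k - 1 - s" s]
        by (meson l2_norm_nonneg mult_right_mono order_trans)
    qed
    finally show "\<bar>y \<bullet> stacked_input k m u (\<tau> + (2 * k - 1))\<bar> \<le>
      (\<Sum>s\<in>{\<tau>..<\<tau> + 2 * k}. sqrt (real m) * h * l2_norm (u s))" .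
  qed
  also have "\<dots> \<le> 2 * real k * (\<Sum>s<T + (2 * k - 1). sqrt (real m) * h * l2_norm (u s))"
    using h k by (intro sum_windows_le) auto
  finally show ?thesis by (simp add: sum_distrib_left mult_ac)
qed

text \<open>Rounding a unit vector down to the grid changes each coefficient by at most \<open>1 / N\<close>, hence the
  signed sum by at most \<open>(24 k m / N) \<gamma> T\<close>, which the choice of \<open>N\<close> makes half of the bound that
  holds at the grid point.\<close>

lemma lower_bound_from_grid:
  assumes m: "1 \<le> m" and k: "1 \<le> k" and gamma: "0 < \<gamma>" and a: "0 < a" "a \<le> 1"
    and N: "768 * real (k * m) / a \<le> real N"
    and u: "\<And>s. u s \<in> carrier_vec m"
    and grid: "\<And>g. g \<in> {..<2 * k * m} \<rightarrow>\<^sub>E {- int N..int N} \<Longrightarrow> 0 < l2_norm (grid_point (2 * k * m) N g) \<Longrightarrow>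
      a * real T / 8 * (\<gamma> * l2_norm (grid_point (2 * k * m) N g)) \<le>
      (\<Sum>\<tau><T. signed_size (good \<tau>) (grid_point (2 * k * m) N g \<bullet> stacked_input k m u (\<tau> + (2 * k - 1))))"
    and size: "(\<Sum>s<T + (2 * k - 1). l2_norm (u s)) \<le> 12 * \<gamma> * sqrt (real m) * real T"
    and z: "z \<in> carrier_vec (2 * k * m)"
  shows "\<gamma> * a * real T / 32 * l2_norm z \<le>
    (\<Sum>\<tau><T. signed_size (good \<tau>) (z \<bullet> stacked_input k m u (\<tau> + (2 * k - 1))))"
proof -
  let ?d = "2 * k * m" and ?U = "\<lambda>\<tau>. stacked_input k m u (\<tau> + (2 * k - 1))"
  have U: "?U \<tau> \<in> carrier_vec ?d" for \<tau> by (simp add: stacked_input_def)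
  have km: "1 \<le> k * m" using k m by simp
  have "768 * real (k * m) \<le> 768 * real (k * m) / a" 
    using a mult_left_le_one_le[of "768 * real (k * m)" a] by (simp add: pos_le_divide_eq mult.commute)
  then have N768: "768 * real (k * m) \<le> real N" using N by linarith
  moreover have "1 \<le> real (k * m)" using km by linarith
  ultimately have N0: "0 < real N" by linarith
  have unit: "\<gamma> * a * real T / 32 \<le> (\<Sum>\<tau><T. signed_size (good \<tau>) (e \<bullet> ?U \<tau>))"
    if e: "e \<in> carrier_vec ?d" and e1: "l2_norm e = 1" for e
  proof -
    define g where "g = (\<lambda>i\<in>{..<?d}. \<lfloor>real N * e $ i\<rfloor>)"
    let ?p = "grid_point ?d N g"
    define y where "y = e - ?p"
    have coord: "\<bar>e $ i\<bar> \<le> 1" if "i < ?d" for i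
    proof -
      have "\<bar>e $ i\<bar> \<le> L2_set (\<lambda>i. \<bar>e $ i\<bar>) {..<?d}" using that by (intro member_le_L2_set) auto
      then show ?thesis using e1 e by (simp add: l2_norm_eq_L2_set L2_set_def)
    qed
    have g: "g \<in> {..<?d} \<rightarrow>\<^sub>E {- int N..int N}"
    proof (rule PiE_I)
      fix i assume i: "i \<in> {..<?d}"
      have "\<bar>real N * e $ i\<bar> \<le> real N" using coord[of i] i N0 by (simp add: abs_mult mult_left_le)
      then show "g i \<in> {- int N..int N}" using i by (auto simp: g_def floor_le_iff le_floor_iff)
    qed (simp add: g_def)
    have y: "y \<in> carrier_vec ?d" using e by (simp add: y_def)
    have small: "\<bar>y $ i\<bar> \<le> 1 / real N" if i: "i < ?d" for i
    proof -
      have "y $ i = (real N * e $ i - of_int \<lfloor>real N * e $ i\<rfloor>) / real N"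
        using i N0 e by (simp add: y_def grid_point_def g_def diff_divide_distrib)
      then show ?thesis using N0 by (auto simp: abs_if field_simps) linarith+
    qed
    have split: "e = ?p + y" using e
      by (intro eq_vecI) (simp_all add: y_def grid_point_def)
    have ylen: "l2_norm y \<le> 1 / 2"
    proof -
      have "l2_norm y \<le> (\<Sum>i<?d. \<bar>y $ i\<bar>)" using y L2_set_le_sum_abs[of "\<lambda>i. y $ i" "{..<?d}"] by (simp add: l2_norm_eq_L2_set)
      also have "\<dots> \<le> (\<Sum>i<?d. 1 / real N)" using small by (intro sum_mono) auto
      also have "\<dots> = 2 * real (k * m) / real N" by simp
      also have "\<dots> \<le> 1 / 2" using N768 N0 km by (simp add: field_simps)
      finally show ?thesis .
    qed
    have "1 \<le> l2_norm ?p + l2_norm y" using l2_norm_triangle[of ?p ?d y] y e1 split by simp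
    then have plen: "1 / 2 \<le> l2_norm ?p" using ylen by linarith
    have "(\<Sum>\<tau><T. signed_size (good \<tau>) (?p \<bullet> ?U \<tau>)) \<le>
        (\<Sum>\<tau><T. signed_size (good \<tau>) (e \<bullet> ?U \<tau>) + \<bar>y \<bullet> ?U \<tau>\<bar>)"
    proof (rule sum_mono)
      fix \<tau>
      have "e \<bullet> ?U \<tau> = ?p \<bullet> ?U \<tau> + y \<bullet> ?U \<tau>"
        by (subst split) (rule add_scalar_prod_distrib[OF grid_point_carrier y U])
      moreover have "signed_size b s \<le> signed_size b (s + t) + \<bar>t\<bar>" for b and s t :: real
        by (cases b) (auto simp: signed_size_def abs_if)
      ultimately show "signed_size (good \<tau>) (?p \<bullet> ?U \<tau>) \<le> signed_size (good \<tau>) (e \<bullet> ?U \<tau>) + \<bar>y \<bullet> ?U \<tau>\<bar>"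
        by metis
    qed
    also have "\<dots> = (\<Sum>\<tau><T. signed_size (good \<tau>) (e \<bullet> ?U \<tau>)) + (\<Sum>\<tau><T. \<bar>y \<bullet> ?U \<tau>\<bar>)"
      by (rule sum.distrib)
    also have "(\<Sum>\<tau><T. \<bar>y \<bullet> ?U \<tau>\<bar>) \<le> 2 * real k * sqrt (real m) * (1 / real N) * (\<Sum>s<T + (2 * k - 1). l2_norm (u s))"
      using N0 by (intro stacked_input_small_coefficients m k y small u) auto
    also have "\<dots> \<le> 2 * real k * sqrt (real m) * (1 / real N) * (12 * \<gamma> * sqrt (real m) * real T)"
      using N0 by (intro mult_left_mono size) auto
    also have "\<dots> = 24 * real (k * m) / real N * (\<gamma> * real T)"
    proof -
      have "sqrt (real m) * sqrt (real m) = real m" by simp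
      then have "2 * real k * sqrt (real m) * (1 / real N) * (12 * \<gamma> * sqrt (real m) * real T) =
        24 * real k * real m * (1 / real N) * \<gamma> * real T" by (simp add: mult_ac)
      then show ?thesis by simp
    qed
    also have "\<dots> \<le> a / 32 * (\<gamma> * real T)"
      using N N0 a gamma by (intro mult_right_mono) (auto simp: field_simps)
    finally have "(\<Sum>\<tau><T. signed_size (good \<tau>) (?p \<bullet> ?U \<tau>)) \<le>
      (\<Sum>\<tau><T. signed_size (good \<tau>) (e \<bullet> ?U \<tau>)) + a / 32 * (\<gamma> * real T)" by simp
    moreover have "a * real T / 8 * (\<gamma> * (1 / 2)) \<le> a * real T / 8 * (\<gamma> * l2_norm ?p)"
      using plen a gamma by (intro mult_left_mono) auto
    moreover have "a * real T / 8 * (\<gamma> * l2_norm ?p) \<le> (\<Sum>\<tau><T. signed_size (good \<tau>) (?p \<bullet> ?U \<tau>))"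
      using grid[OF g] plen by simp
    ultimately show ?thesis by (simp add: field_simps)
  qed
  show ?thesis
  proof (cases "l2_norm z = 0")
    case True
    then have "z = 0\<^sub>v ?d" using z by (intro l2_norm_eq_0)
    then show ?thesis using U by (simp add: signed_size_def)
  next
    case False
    then have z0: "0 < l2_norm z" using l2_norm_nonneg[of z] by linarith
    define e where "e = (1 / l2_norm z) \<cdot>\<^sub>v z"
    have e: "e \<in> carrier_vec ?d" "l2_norm e = 1" using z z0 by (auto simp: e_def l2_norm_smult)
    have "signed_size (good \<tau>) (z \<bullet> ?U \<tau>) = l2_norm z * signed_size (good \<tau>) (e \<bullet> ?U \<tau>)" for \<tau>
      using z z0 U by (simp add: e_def signed_size_def abs_mult)
    then have "(\<Sum>\<tau><T. signed_size (good \<tau>) (z \<bullet> ?U \<tau>)) = l2_norm z * (\<Sum>\<tau><T. signed_size (good \<tau>) (e \<bullet> ?U \<tau>))"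
      by (simp add: sum_distrib_left)
    then show ?thesis using mult_left_mono[OF unit[OF e], of "l2_norm z"] by (simp add: mult.commute)
  qed
qed

context gaussian_inputs_random_attack_times
begin

text \<open>The union bound over the grid for the signed sums, and the bound on the total size of the inputs
  that the passage from the grid to all directions consumes.\<close>

lemma uniform_lower_bound:
  assumes T: "4 * k \<le> T" and N: "768 * real (k * m) / (1 - 2 * q) \<le> real N"
  obtains E where "E \<in> sets M"
    "prob (space M - E) \<le>
      real (2 * N + 1) ^ (2 * k * m) * exp (- ((1 - 2 * q)\<^sup>2 * real T / (64 * real k))) + exp (- 2 * real T)"
    "\<And>\<omega>. \<omega> \<in> E \<Longrightarrow> (\<Sum>s<T + (2 * k - 1). l2_norm (u s \<omega>)) \<le> 12 * \<gamma> * sqrt (real m) * real T"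
    "\<And>\<omega> z. \<omega> \<in> E \<Longrightarrow> z \<in> carrier_vec (2 * k * m) \<Longrightarrow>
      \<gamma> * (1 - 2 * q) * real T / 32 * l2_norm z \<le>
      (\<Sum>\<tau><T. signed_size (clean_window k (\<lambda>t. \<xi> t \<omega>) \<tau>)
        (z \<bullet> stacked_input k m (\<lambda>t. u t \<omega>) (\<tau> + (2 * k - 1))))"
proof -
  let ?d = "2 * k * m" and ?L = "2 * k - 1"
  let ?X = "\<lambda>z \<omega>. \<Sum>\<tau><T. signed_size (clean_window k (\<lambda>t. \<xi> t \<omega>) \<tau>) (projection z \<tau> (\<lambda>t. u t \<omega>))"
  let ?e = "exp (- ((1 - 2 * q)\<^sup>2 * real T / (64 * real k)))"
  define grid where "grid = {g \<in> {..<?d} \<rightarrow>\<^sub>E {- int N..int N}. 0 < l2_norm (grid_point ?d N g)}"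
  define bad where "bad g = {\<omega> \<in> space M. ?X (grid_point ?d N g) \<omega> <
    (1 - 2 * q) * real T / 8 * (\<gamma> * l2_norm (grid_point ?d N g))}" for g
  define large where "large = {\<omega> \<in> space M. 3 * real (T + ?L) <
    (\<Sum>s<T + ?L. l2_norm (u s \<omega>) / (sqrt (real m) * (2 * \<gamma>)))}"
  define E where "E = space M - ((\<Union>g\<in>grid. bad g) \<union> large)"
  have all_finite: "finite ({..<?d} \<rightarrow>\<^sub>E {- int N..int N})" by (intro finite_PiE) auto
  then have fin: "finite grid" by (simp add: grid_def)
  have "card grid \<le> card ({..<?d} \<rightarrow>\<^sub>E {- int N..int N})"
    by (intro card_mono all_finite) (auto simp: grid_def)
  then have card: "card grid \<le> (2 * N + 1) ^ ?d" by (simp only: card_grid)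
  have Xmeas: "?X z \<in> borel_measurable M" for z
    by (intro borel_measurable_sum measurable_signed_size_window)
  have bad: "bad g \<in> sets M" for g
    unfolding bad_def using Xmeas[of "grid_point ?d N g"] by measurable
  have norm_meas: "(\<lambda>\<omega>. l2_norm (u s \<omega>)) \<in> borel_measurable M" for s
    by (rule measurable_l2_norm[OF measurable_input])
  have large: "large \<in> sets M"
    unfolding large_def using norm_meas by measurable
  have bad_prob: "prob (bad g) \<le> ?e" if "g \<in> grid" for g
    unfolding bad_def using that by (intro signed_sum_tail[OF grid_point_carrier _ T]) (simp add: grid_def)
  have "prob (\<Union>g\<in>grid. bad g) \<le> (\<Sum>g\<in>grid. prob (bad g))"
    using bad fin by (intro finite_measure_subadditive_finite) auto
  also have "\<dots> \<le> real (card grid) * ?e" using bad_prob by (intro sum_bounded_above) auto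
  also have "\<dots> \<le> real ((2 * N + 1) ^ ?d) * ?e" using card by (intro mult_right_mono) (auto simp del: of_nat_power)
  finally have p1: "prob (\<Union>g\<in>grid. bad g) \<le> real (2 * N + 1) ^ ?d * ?e" by (simp only: of_nat_power)
  have "prob large \<le> exp (- 2 * real (T + ?L))"
    unfolding large_def by (rule input_norm_sum_tail[OF inputs gamma m])
  also have "\<dots> \<le> exp (- 2 * real T)" by simp
  finally have p2: "prob large \<le> exp (- 2 * real T)" .
  have badU: "(\<Union>g\<in>grid. bad g) \<in> sets M" using bad fin by (intro sets.finite_UN) auto
  show ?thesis
  proof (rule that[of E])
    show "E \<in> sets M" unfolding E_def using badU large by (intro sets.compl_sets sets.Un)
    have compl: "space M - E = (\<Union>g\<in>grid. bad g) \<union> large"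
      using sets.sets_into_space[OF badU] sets.sets_into_space[OF large] by (auto simp: E_def)
    have "prob ((\<Union>g\<in>grid. bad g) \<union> large) \<le> real (2 * N + 1) ^ ?d * ?e + exp (- 2 * real T)"
      using measure_Un_le[OF badU large] p1 p2 by linarith
    then show "prob (space M - E) \<le> real (2 * N + 1) ^ ?d * ?e + exp (- 2 * real T)"
      unfolding compl .
    fix \<omega> assume \<omega>: "\<omega> \<in> E"
    then have sp: "\<omega> \<in> space M" by (simp add: E_def)
    have "\<omega> \<notin> large" using \<omega> by (simp add: E_def)
    then have "(\<Sum>s<T + ?L. l2_norm (u s \<omega>)) / (sqrt (real m) * (2 * \<gamma>)) \<le> 3 * real (T + ?L)"
      using sp by (simp add: large_def sum_divide_distrib)
    moreover have "3 * real (T + ?L) \<le> 6 * real T" using T by (simp add: of_nat_diff)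
    ultimately have "(\<Sum>s<T + ?L. l2_norm (u s \<omega>)) / (sqrt (real m) * (2 * \<gamma>)) \<le> 6 * real T" by linarith
    then show size: "(\<Sum>s<T + ?L. l2_norm (u s \<omega>)) \<le> 12 * \<gamma> * sqrt (real m) * real T"
      using gamma m by (simp add: pos_divide_le_eq mult_ac)
    fix z :: "real vec" assume z: "z \<in> carrier_vec ?d"
    show "\<gamma> * (1 - 2 * q) * real T / 32 * l2_norm z \<le>
      (\<Sum>\<tau><T. signed_size (clean_window k (\<lambda>t. \<xi> t \<omega>) \<tau>)
        (z \<bullet> stacked_input k m (\<lambda>t. u t \<omega>) (\<tau> + ?L)))"
    proof (rule lower_bound_from_grid[OF m k gamma _ _ N _ _ size z])
      show "0 < 1 - 2 * q" "1 - 2 * q \<le> 1" using q q_nonneg by auto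
      show "u s \<omega> \<in> carrier_vec m" for s using random_vec_carrier[OF measurable_input sp] .
      fix g assume "g \<in> {..<?d} \<rightarrow>\<^sub>E {- int N..int N}" "0 < l2_norm (grid_point ?d N g)"
      then have "\<omega> \<notin> bad g" using \<omega> by (auto simp: E_def grid_def)
      then show "(1 - 2 * q) * real T / 8 * (\<gamma> * l2_norm (grid_point ?d N g)) \<le>
        (\<Sum>\<tau><T. signed_size (clean_window k (\<lambda>t. \<xi> t \<omega>) \<tau>)
          (grid_point ?d N g \<bullet> stacked_input k m (\<lambda>t. u t \<omega>) (\<tau> + ?L)))"
        using sp unfolding projection_eq[OF grid_point_carrier sp] by (simp add: bad_def)
    qed
  qed
qed

end

section \<open>The state is small on average\<close>

lemma convolution_sum_le:
  fixes f :: "nat \<Rightarrow> nat \<Rightarrow> real"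
  assumes "\<And>l s. 0 \<le> f l s"
  shows "(\<Sum>\<tau><T. \<Sum>l<\<tau>. f l (\<tau> - 1 - l)) \<le> (\<Sum>s<T. \<Sum>l<T. f l s)"
proof -
  have "(\<Sum>\<tau><T. \<Sum>l<\<tau>. f l (\<tau> - 1 - l)) = (\<Sum>(\<tau>, l)\<in>(SIGMA \<tau>:{..<T}. {..<\<tau>}). f l (\<tau> - 1 - l))"
    by (subst sum.Sigma) auto
  also have "\<dots> = (\<Sum>(s, l)\<in>(\<lambda>(\<tau>, l). (\<tau> - 1 - l, l)) ` (SIGMA \<tau>:{..<T}. {..<\<tau>}). f l s)"
    by (subst sum.reindex) (auto simp: inj_on_def case_prod_beta)
  also have "\<dots> \<le> (\<Sum>(s, l)\<in>{..<T} \<times> {..<T}. f l s)"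
    using assms by (intro sum_mono2) auto
  also have "\<dots> = (\<Sum>s<T. \<Sum>l<T. f l s)" by (simp add: sum.cartesian_product)
  finally show ?thesis .
qed

text \<open>Each input or attack at time \<open>s\<close> contributes to the later states through \<open>F A\<^sup>l\<close>, whose norm is at
  most \<open>K \<parallel>A\<parallel>\<^sup>l\<close>; summing over \<open>l\<close> gives the factor \<open>1 / (1 - \<parallel>A\<parallel>)\<close>. For the inputs the full norm
  of the response is bounded by that of \<open>u s\<close>; for the attacks the rows are kept apart, in the form
  of the \<open>shock\<close>.\<close>

lemma state_sum_bound:
  assumes sys: "linear_system A B C D x y u w"
    and A: "A \<in> carrier_mat n n" "spectral_norm A < 1" and B: "B \<in> carrier_mat n m"
    and F: "F \<in> carrier_mat r n" and r: "1 \<le> r" and c: "0 < c"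
    and x0: "x 0 \<in> carrier_vec n" and w: "\<And>t. w t \<in> carrier_vec n"
    and u: "\<And>t. u t \<in> carrier_vec m"
    and K: "0 \<le> K" and bd: "\<And>j v. v \<in> carrier_vec n \<Longrightarrow>
      l2_norm ((F * A ^\<^sub>m j) *\<^sub>v v) \<le> K * spectral_norm A ^ j * l2_norm v"
    and e: "\<And>j i. j < T \<Longrightarrow> i < r \<Longrightarrow> e j i \<in> carrier_vec n \<and>
      row (F * A ^\<^sub>m j) i = (K * spectral_norm A ^ j) \<cdot>\<^sub>v e j i"
  shows "(\<Sum>\<tau><T. l2_norm (F *\<^sub>v x \<tau>)) \<le> K / (1 - spectral_norm A) *
    (sqrt (real r) * c * (shock T r (spectral_norm A) c e (x 0) + (\<Sum>s<T. shock T r (spectral_norm A) c e (w s)))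
      + spectral_norm B * (\<Sum>s<T. l2_norm (u s)))"
proof -
  let ?\<rho> = "spectral_norm A"
  let ?M = "\<lambda>l. F * A ^\<^sub>m l"
  define v where "v t = B *\<^sub>v u t + w t" for t
  have M: "?M l \<in> carrier_mat r n" for l using A F by auto
  have x: "x t \<in> carrier_vec n" for t by (rule linear_system_carrier[OF sys x0 w])
  have v: "v t \<in> carrier_vec n" for t using B u w by (simp add: v_def)
  have rec: "x (Suc t) = A *\<^sub>v x t + v t" for t
    using sys A B x u w unfolding linear_system_def v_def by (simp add: assoc_add_vec[of _ n])
  have r0: "0 < sqrt (real r)" using r by simp
  have impulse: "(\<Sum>l<T. l2_norm (?M l *\<^sub>v z)) = K / (1 - ?\<rho>) * (sqrt (real r) * c * shock T r ?\<rho> c e z)"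
    if z: "z \<in> carrier_vec n" for z
  proof -
    have one: "l2_norm (?M l *\<^sub>v z) = K * ?\<rho> ^ l * L2_set (\<lambda>i. z \<bullet> e l i) {..<r}" if l: "l < T" for l
    proof -
      have "l2_norm (?M l *\<^sub>v z) = L2_set (\<lambda>i. row (?M l) i \<bullet> z) {..<r}"
        unfolding l2_norm_eq_L2_set using M[of l] by (intro L2_set_cong) auto
      also have "\<dots> = L2_set (\<lambda>i. K * ?\<rho> ^ l * (z \<bullet> e l i)) {..<r}"
      proof (rule L2_set_cong[OF refl])
        fix i assume "i \<in> {..<r}"
        then have ei: "e l i \<in> carrier_vec n" "row (?M l) i = (K * ?\<rho> ^ l) \<cdot>\<^sub>v e l i" using e[OF l] by auto
        then show "row (?M l) i \<bullet> z = K * ?\<rho> ^ l * (z \<bullet> e l i)"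
          using z comm_scalar_prod[OF ei(1) z] by simp
      qed
      also have "\<dots> = K * ?\<rho> ^ l * L2_set (\<lambda>i. z \<bullet> e l i) {..<r}"
        using K by (intro L2_set_right_distrib[symmetric]) simp
      finally show ?thesis .
    qed
    have "(\<Sum>l<T. l2_norm (?M l *\<^sub>v z)) = (\<Sum>l<T. K / (1 - ?\<rho>) * (sqrt (real r) * c *
        ((1 - ?\<rho>) * ?\<rho> ^ l * (L2_set (\<lambda>i. z \<bullet> e l i) {..<r} / (sqrt (real r) * c)))))"
      using A r0 c one by (intro sum.cong) (auto simp: field_simps)
    then show ?thesis unfolding shock_def by (simp only: sum_distrib_left)
  qed
  have input: "(\<Sum>l<T. l2_norm (?M l *\<^sub>v (B *\<^sub>v u s))) \<le> K / (1 - ?\<rho>) * (spectral_norm B * l2_norm (u s))" for s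
  proof -
    have "(\<Sum>l<T. l2_norm (?M l *\<^sub>v (B *\<^sub>v u s))) \<le> (\<Sum>l<T. K * ?\<rho> ^ l * (spectral_norm B * l2_norm (u s)))"
    proof (rule sum_mono)
      fix l
      have "l2_norm (?M l *\<^sub>v (B *\<^sub>v u s)) \<le> K * ?\<rho> ^ l * l2_norm (B *\<^sub>v u s)"
        using B u by (intro bd) auto
      also have "\<dots> \<le> K * ?\<rho> ^ l * (spectral_norm B * l2_norm (u s))"
        using K by (intro mult_left_mono spectral_norm_bound[OF B u]) auto
      finally show "l2_norm (?M l *\<^sub>v (B *\<^sub>v u s)) \<le> K * ?\<rho> ^ l * (spectral_norm B * l2_norm (u s))" .
    qed
    also have "\<dots> = K / (1 - ?\<rho>) * (spectral_norm B * l2_norm (u s)) * (\<Sum>l<T. (1 - ?\<rho>) * ?\<rho> ^ l)"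
    proof -
      have "K * g * X = K / s * X * (s * g)" if "s \<noteq> 0" for g X s :: real using that by simp
      from this[of "1 - ?\<rho>"] show ?thesis unfolding sum_distrib_left using A by (intro sum.cong refl) simp
    qed
    also have "\<dots> \<le> K / (1 - ?\<rho>) * (spectral_norm B * l2_norm (u s))"
      using geometric_weights_le_1[of ?\<rho> T] A K by (intro mult_left_le) auto
    finally show ?thesis .
  qed
  have "(\<Sum>\<tau><T. l2_norm (F *\<^sub>v x \<tau>)) \<le>
      (\<Sum>\<tau><T. l2_norm (?M \<tau> *\<^sub>v x 0) + (\<Sum>l<\<tau>. l2_norm (?M l *\<^sub>v v (\<tau> - 1 - l))))"
    by (intro sum_mono recursion_norm_bound[where x = x and v = v, OF A(1) F x v rec])
  also have "\<dots> = (\<Sum>\<tau><T. l2_norm (?M \<tau> *\<^sub>v x 0)) + (\<Sum>\<tau><T. \<Sum>l<\<tau>. l2_norm (?M l *\<^sub>v v (\<tau> - 1 - l)))"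
    by (rule sum.distrib)
  also have "(\<Sum>\<tau><T. \<Sum>l<\<tau>. l2_norm (?M l *\<^sub>v v (\<tau> - 1 - l))) \<le> (\<Sum>s<T. \<Sum>l<T. l2_norm (?M l *\<^sub>v v s))"
    by (rule convolution_sum_le) simp
  also have "\<dots> \<le> (\<Sum>s<T. (\<Sum>l<T. l2_norm (?M l *\<^sub>v (B *\<^sub>v u s))) + (\<Sum>l<T. l2_norm (?M l *\<^sub>v w s)))"
  proof (rule sum_mono)
    fix s
    have "(\<Sum>l<T. l2_norm (?M l *\<^sub>v v s)) \<le> (\<Sum>l<T. l2_norm (?M l *\<^sub>v (B *\<^sub>v u s)) + l2_norm (?M l *\<^sub>v w s))"
    proof (rule sum_mono)
      fix l
      have "?M l *\<^sub>v v s = ?M l *\<^sub>v (B *\<^sub>v u s) + ?M l *\<^sub>v w s"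
        unfolding v_def using M B u w by (intro mult_add_distrib_mat_vec[of _ r n]) auto
      then show "l2_norm (?M l *\<^sub>v v s) \<le> l2_norm (?M l *\<^sub>v (B *\<^sub>v u s)) + l2_norm (?M l *\<^sub>v w s)"
        using M[of l] B u w by (simp add: l2_norm_triangle[of _ r] mult_mat_vec_carrier[of _ r n])
    qed
    then show "(\<Sum>l<T. l2_norm (?M l *\<^sub>v v s)) \<le>
        (\<Sum>l<T. l2_norm (?M l *\<^sub>v (B *\<^sub>v u s))) + (\<Sum>l<T. l2_norm (?M l *\<^sub>v w s))"
      by (simp only: sum.distrib)
  qed
  also have "\<dots> \<le> (\<Sum>s<T. K / (1 - ?\<rho>) * (spectral_norm B * l2_norm (u s)) +
      K / (1 - ?\<rho>) * (sqrt (real r) * c * shock T r ?\<rho> c e (w s)))"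
    unfolding impulse[OF w] by (intro sum_mono add_right_mono input)
  also have "(\<Sum>\<tau><T. l2_norm (?M \<tau> *\<^sub>v x 0)) = K / (1 - ?\<rho>) * (sqrt (real r) * c * shock T r ?\<rho> c e (x 0))"
    by (rule impulse[OF x0])
  finally show ?thesis by (simp add: sum.distrib distrib_left sum_distrib_left mult_ac)
qed

section \<open>Sample size and conclusion\<close>

text \<open>The union bound runs over at most \<open>1600 km / a\<close> to the power \<open>2 k m\<close> grid points. If \<open>km / a\<close> is at
  least 2, the constant 1600 is absorbed by the logarithm of \<open>km / a\<close>. Otherwise \<open>k = m = 1\<close> and
  \<open>a > 1 / 2\<close>, the number of points is bounded, and a constant sample size suffices.\<close>

lemma sample_size_pays_for_grid:
  fixes a \<delta> :: real and k m r T :: nat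
  assumes k: "1 \<le> k" and m: "1 \<le> m" and r: "1 \<le> r" and a: "0 < a" "a \<le> 1" and d: "0 < \<delta>" "\<delta> \<le> 1"
    and T: "7000 * max 1 (real k / a\<^sup>2 * (real (k * m) * ln (real (k * m) / a) + ln (real r / \<delta>))) \<le> real T"
  shows "2 * real (k * m) * ln (1600 * (real (k * m) / a)) + ln (4 / \<delta>) \<le> a\<^sup>2 * real T / (64 * real k)"
proof -
  define n where "n = real (k * m)"
  define l where "l = ln (n / a)"
  define R where "R = real k / a\<^sup>2 * (n * l + ln (real r / \<delta>))"
  have "1 \<le> k * m" using k m by simp
  then have n1: "1 \<le> n" unfolding n_def by linarith
  then have na: "1 \<le> n / a" using a by (simp add: field_simps)
  have l0: "0 \<le> l" using na by (simp add: l_def)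
  have ln2: "0 < ln (2::real)" "ln (2::real) \<le> 1" using ln_le_minus_one[of "2::real"] by auto
  have "ln (1600::real) \<le> ln (2 ^ 11)" by (subst ln_le_cancel_iff) auto
  also have "\<dots> = 11 * ln 2" by (subst ln_realpow) auto
  finally have ln1600: "ln (1600::real) \<le> 11 * ln 2" .
  have lgrid: "ln (1600 * (n / a)) = ln 1600 + l" using na by (subst ln_mult) (auto simp: l_def)
  have "ln (4 / \<delta>) = ln 4 - ln \<delta>" using d by (subst ln_div) auto
  moreover have "ln (4::real) = 2 * ln 2" using ln_realpow[of "2::real" 2] by simp
  ultimately have ld: "ln (4 / \<delta>) = 2 * ln 2 + ln (1 / \<delta>)" using d by (simp add: ln_div)
  have d0: "0 \<le> ln (1 / \<delta>)" using d by simp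
  have dr: "ln (1 / \<delta>) \<le> ln (real r / \<delta>)" using d r by (subst ln_le_cancel_iff) (auto simp: divide_right_mono)
  have T': "7000 * max 1 R \<le> real T" using T by (simp add: R_def n_def l_def)
  have k0: "0 < real k" using k by simp
  have a2: "0 < a\<^sup>2" "a\<^sup>2 \<le> 1" using a by (auto simp: power_le_one)
  have nl: "0 \<le> n * l" using n1 l0 by simp
  have "2 * n * ln (1600 * (n / a)) + ln (4 / \<delta>) \<le> a\<^sup>2 * real T / (64 * real k)"
  proof (cases "ln 2 \<le> l")
    case True
    have "2 * n * (ln 1600 + l) \<le> 2 * n * (12 * l)"
      using True ln1600 n1 by (intro mult_left_mono) auto
    also have "\<dots> = 24 * (n * l)" by simp
    finally have "2 * n * (ln 1600 + l) \<le> 24 * (n * l)" .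
    moreover have "2 * ln 2 \<le> 2 * (n * l)" using True n1 l0 mult_right_mono[of 1 n l] by simp
    moreover have "ln (1 / \<delta>) \<le> 26 * ln (real r / \<delta>)" using dr d0 by linarith
    ultimately have "2 * n * ln (1600 * (n / a)) + ln (4 / \<delta>) \<le>
        24 * (n * l) + (2 * (n * l) + 26 * ln (real r / \<delta>))"
      unfolding lgrid ld by (intro add_mono)
    also have "\<dots> = 26 * (n * l + ln (real r / \<delta>))" by (simp add: algebra_simps)
    finally have "2 * n * ln (1600 * (n / a)) + ln (4 / \<delta>) \<le> 26 * (n * l + ln (real r / \<delta>))" .
    moreover have "26 * (n * l + ln (real r / \<delta>)) = 26 * (a\<^sup>2 * R / real k)" using a2 k0 by (simp add: R_def)
    moreover have "26 * (a\<^sup>2 * R / real k) \<le> a\<^sup>2 * real T / (64 * real k)"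
    proof -
      have "1664 * R \<le> real T" using T' by linarith
      then have "a\<^sup>2 * (1664 * R) / (64 * real k) \<le> a\<^sup>2 * real T / (64 * real k)"
        using a2 k0 by (intro divide_right_mono mult_left_mono) auto
      then show ?thesis by (simp add: mult_ac)
    qed
    ultimately show ?thesis by linarith
  next
    case False
    then have "n / a < 2" using na by (simp add: l_def not_le)
    then have n2: "n < 2 * a" using a by (simp add: field_simps)
    then have "n < 2" using a by linarith
    then have "k * m < 2" unfolding n_def by linarith
    with \<open>1 \<le> k * m\<close> have "k * m = 1" by linarith
    then have km: "real k = 1" "n = 1" by (simp_all add: n_def)
    have "1 / 4 \<le> a\<^sup>2"
      using n2 a km power_mono[of "1 / 2" a 2] by (simp add: power2_eq_square)
    have "ln (1 / \<delta>) \<le> R"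
    proof -
      have "0 \<le> n * l + ln (real r / \<delta>)" using nl dr d0 by linarith
      then have "1 * (n * l + ln (real r / \<delta>)) \<le> 1 / a\<^sup>2 * (n * l + ln (real r / \<delta>))"
        using a2 by (intro mult_right_mono) auto
      then show ?thesis using nl dr by (simp add: R_def km)
    qed
    moreover have "2 * n * ln (1600 * (n / a)) + ln (4 / \<delta>) \<le> 26 + ln (1 / \<delta>)"
      using False ln1600 ln2 unfolding lgrid ld by (simp add: km)
    ultimately have "2 * n * ln (1600 * (n / a)) + ln (4 / \<delta>) \<le> 27 * max 1 R" by linarith
    also have "\<dots> \<le> 1 / 4 * real T / 64" using T' by linarith
    also have "\<dots> \<le> a\<^sup>2 * real T / 64"
      using \<open>1 / 4 \<le> a\<^sup>2\<close> by (intro divide_right_mono mult_right_mono) auto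
    finally show ?thesis by (simp add: km)
  qed
  then show ?thesis by (simp add: n_def)
qed

text \<open>A window contains \<open>2 k - 1\<close> times at which an attack matters, so by Bernoulli's inequality it is
  attacked with probability at most \<open>(2 k - 1) p < 1 / 2\<close>.\<close>

lemma attacked_window_rate_less_half:
  fixes p :: real
  assumes k: "1 \<le> k" and p: "0 \<le> p" "p < 1 / (4 * real k - 2)"
  shows "p \<le> 1" "1 - (1 - p) ^ (2 * k - 1) < 1 / 2"
proof -
  have k1: "1 \<le> real k" using k by simp
  have *: "p * (4 * real k - 2) < 1" using p k1 by (simp add: pos_less_divide_eq)
  have "p * 2 \<le> p * (4 * real k - 2)" using p k1 by (intro mult_left_mono) auto
  then show p1: "p \<le> 1" using * by linarith
  have "1 + real (2 * k - 1) * (- p) \<le> (1 + (- p)) ^ (2 * k - 1)"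
    using p1 by (intro Bernoulli_inequality) simp
  moreover have "real (2 * k - 1) = 2 * real k - 1" using k by (simp add: of_nat_diff)
  ultimately have "1 - (2 * real k - 1) * p \<le> (1 - p) ^ (2 * k - 1)" by simp
  then show "1 - (1 - p) ^ (2 * k - 1) < 1 / 2" using * by (simp add: algebra_simps)
qed

text \<open>Three events of probability at most \<open>\<delta> / 4\<close> are excluded: a failure of the lower bound at a grid
  point, inputs that are too large on average, and shocks that are too large on average. The
  constant 768 is \<open>2 * 12 * 32\<close>: the factor 2 of the comparison of losses, 12 from the average
  size of the state, and the \<open>1 / 32\<close> of the lower bound.\<close>

lemma (in prob_space) lad_estimation_error:
  assumes m: "1 \<le> m" and r: "1 \<le> r" and k: "1 \<le> k"
    and A: "A \<in> carrier_mat n n" and B: "B \<in> carrier_mat n m"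
    and C: "C \<in> carrier_mat r n" and D: "D \<in> carrier_mat r m"
    and stable: "spectral_norm A < 1" and eta: "0 < \<eta>" and gamma: "0 < \<gamma>"
    and p: "0 \<le> p" "p < 1 / (4 * real k - 2)" and q: "q = 1 - (1 - p) ^ (2 * k - 1)"
    and delta: "0 < \<delta>" "\<delta> \<le> 1"
    and sys: "\<And>\<omega>. \<omega> \<in> space M \<Longrightarrow> linear_system A B C D (\<lambda>t. x t \<omega>) (\<lambda>t. y t \<omega>) (\<lambda>t. u t \<omega>) (\<lambda>t. w t \<omega>)"
    and sg: "sub_gaussian_attacks M n \<eta> (x 0) w"
    and pa: "probabilistic_attacks M n p (x 0) w \<xi>"
    and gi: "gaussian_inputs M m \<gamma> u"
    and ii: "inputs_indep_attack_times M m u \<xi>"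
    and T: "7000 * max 1 (sample_rate k m r q \<delta>) \<le> real T"
  shows "holds_with_prob_at_least M (1 - \<delta>) (\<lambda>\<omega>.
    \<forall>G. lad_solution k r m T (\<lambda>t. y t \<omega>) (\<lambda>t. u t \<omega>) G \<longrightarrow>
      frobenius_norm (markov_parameters k r m A B C D - G) \<le> 768 * error_rate k m r q \<eta> \<gamma> A B C)"
proof -
  define a where "a = 1 - 2 * q"
  define \<rho> where "\<rho> = spectral_norm A"
  define F where "F = C * A ^\<^sub>m (2 * k - 1)"
  define K where "K = spectral_norm (A ^\<^sub>m (2 * k - 1)) * spectral_norm C"
  have half: "p \<le> 1" "q < 1 / 2" using attacked_window_rate_less_half[OF k p] q by auto
  interpret model: gaussian_inputs_random_attack_times M k m p q \<gamma> u \<xi>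
    using k m gamma p half q gi ii pa
    by unfold_locales (auto simp: probabilistic_attacks_def)
  have a: "0 < a" "a \<le> 1" using half model.q_nonneg by (auto simp: a_def)
  have rho: "0 \<le> \<rho>" "\<rho> < 1" using stable by (auto simp: \<rho>_def)
  have K: "0 \<le> K" by (simp add: K_def)
  have F: "F \<in> carrier_mat r n" using A C by (auto simp: F_def)

  define X where "X = real (k * m) / a"
  define N where "N = nat \<lceil>768 * X\<rceil>"
  have "1 \<le> k * m" using k m by simp
  then have "1 \<le> real (k * m)" by linarith
  then have X1: "1 \<le> X" using a by (simp add: X_def field_simps)
  have N: "768 * X \<le> real N" "real N \<le> 768 * X + 1" using X1 unfolding N_def by linarith+
  define Z where "Z = a\<^sup>2 * real T / (64 * real k)"
  have "2 * real (k * m) * ln (1600 * X) + ln (4 / \<delta>) \<le> Z"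
    unfolding X_def Z_def using T
    by (intro sample_size_pays_for_grid[OF k m r a delta]) (simp add: sample_rate_def a_def)
  then have Z: "real (2 * k * m) * ln (1600 * X) + ln (4 / \<delta>) \<le> Z" by simp
  have "exp 1 \<le> 1600 * X" using X1 exp_le by linarith
  then have "1 \<le> ln (1600 * X)" using X1 by (simp add: ln_ge_iff)
  moreover have "2 \<le> real (2 * k * m)" using \<open>1 \<le> real (k * m)\<close> by simp
  ultimately have grid_exp: "2 * 1 \<le> real (2 * k * m) * ln (1600 * X)" by (intro mult_mono) auto
  have "0 \<le> ln (4 / \<delta>)" using delta by simp
  then have Z1: "1 \<le> Z" "ln (4 / \<delta>) \<le> Z" using Z grid_exp by linarith+
  have ZT: "Z \<le> real T / (64 * real k)"
    unfolding Z_def using a k by (intro divide_right_mono) (auto simp: mult_left_le_one_le power_le_one)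
  have "1 \<le> real T / (64 * real k)" using Z1 ZT by linarith
  then have "64 * real k \<le> real T" using k by (simp add: pos_le_divide_eq)
  then have Tk: "4 * k \<le> T" and T1: "1 \<le> real T" using k by linarith+
  have "real T / (64 * real k) \<le> 2 * real T" using k T1 by (simp add: field_simps)
  then have expT: "exp (- 2 * real T) \<le> exp (- Z)" using ZT by simp
  have expZ: "exp (- Z) \<le> \<delta> / 4"
  proof -
    have "exp (- Z) \<le> exp (- ln (4 / \<delta>))" using Z1 by simp
    also have "\<dots> = \<delta> / 4" using delta by (simp add: exp_minus)
    finally show ?thesis .
  qed
  have expgrid: "real (2 * N + 1) ^ (2 * k * m) * exp (- Z) \<le> \<delta> / 4"
  proof -
    have "real (2 * N + 1) \<le> exp (ln (1600 * X))" using N X1 by simp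
    then have "real (2 * N + 1) ^ (2 * k * m) \<le> exp (ln (1600 * X)) ^ (2 * k * m)" by (intro power_mono) auto
    also have "\<dots> = exp (real (2 * k * m) * ln (1600 * X))" by (rule exp_of_nat_mult[symmetric])
    finally have "real (2 * N + 1) ^ (2 * k * m) * exp (- Z) \<le>
        exp (real (2 * k * m) * ln (1600 * X)) * exp (- Z)" by (intro mult_right_mono) auto
    also have "\<dots> = exp (real (2 * k * m) * ln (1600 * X) - Z)" by (simp flip: exp_add)
    also have "\<dots> \<le> exp (- ln (4 / \<delta>))" using Z by simp
    also have "\<dots> = \<delta> / 4" using delta by (simp add: exp_minus)
    finally show ?thesis .
  qed

  have x0: "x 0 \<in> M \<rightarrow>\<^sub>M borel_vec n" and w: "\<And>t. w t \<in> M \<rightarrow>\<^sub>M borel_vec n"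
    using sg by (auto simp: sub_gaussian_attacks_def)
  have bd: "l2_norm ((F * A ^\<^sub>m j) *\<^sub>v v) \<le> K * \<rho> ^ j * l2_norm v" if v: "v \<in> carrier_vec n" for j v
  proof -
    have Aj: "(A ^\<^sub>m j) *\<^sub>v v \<in> carrier_vec n" "(A ^\<^sub>m (2 * k - 1)) *\<^sub>v ((A ^\<^sub>m j) *\<^sub>v v) \<in> carrier_vec n"
      using A v by (auto intro!: mult_mat_vec_carrier[of _ n n])
    have "(F * A ^\<^sub>m j) *\<^sub>v v = C *\<^sub>v ((A ^\<^sub>m (2 * k - 1)) *\<^sub>v ((A ^\<^sub>m j) *\<^sub>v v))"
      using A C F v Aj unfolding F_def
      by (simp add: assoc_mult_mat_vec[of _ r n _ n])
    then have "l2_norm ((F * A ^\<^sub>m j) *\<^sub>v v) \<le>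
        spectral_norm C * l2_norm ((A ^\<^sub>m (2 * k - 1)) *\<^sub>v ((A ^\<^sub>m j) *\<^sub>v v))"
      using spectral_norm_bound[OF C Aj(2)] by simp
    also have "\<dots> \<le> spectral_norm C * (spectral_norm (A ^\<^sub>m (2 * k - 1)) * l2_norm ((A ^\<^sub>m j) *\<^sub>v v))"
      using A by (intro mult_left_mono spectral_norm_bound[OF _ Aj(1)]) auto
    also have "\<dots> \<le> spectral_norm C * (spectral_norm (A ^\<^sub>m (2 * k - 1)) * (\<rho> ^ j * l2_norm v))"
      unfolding \<rho>_def by (intro mult_left_mono l2_norm_pow_mat_bound[OF A v]) auto
    finally show ?thesis by (simp add: K_def mult_ac)
  qed
  define e where "e j i = (SOME e. e \<in> carrier_vec n \<and> l2_norm e \<le> 1 \<and> row (F * A ^\<^sub>m j) i = (K * \<rho> ^ j) \<cdot>\<^sub>v e)" for j i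
  have e: "e j i \<in> carrier_vec n \<and> l2_norm (e j i) \<le> 1 \<and> row (F * A ^\<^sub>m j) i = (K * \<rho> ^ j) \<cdot>\<^sub>v e j i"
    if i: "i < r" for j i
  proof -
    have M: "F * A ^\<^sub>m j \<in> carrier_mat r n" using F A by auto
    have "row (F * A ^\<^sub>m j) i \<in> carrier_vec n" using M by (metis row_carrier carrier_matD(2))
    moreover have "l2_norm (row (F * A ^\<^sub>m j) i) \<le> K * \<rho> ^ j"
      using K rho bd by (intro row_norm_le_operator_bound[OF M i]) auto
    ultimately show ?thesis unfolding e_def by (rule unit_ball_factor) (rule someI, blast)
  qed
  \<comment> \<open>Any level strictly above \<open>\<eta>\<close> works; the factor 2 enters the final constant.\<close>
  define c where "c = 2 * \<eta>"
  define Y where "Y \<omega> = shock T r \<rho> c e (x 0 \<omega>) + (\<Sum>s<T. shock T r \<rho> c e (w s \<omega>))" for \<omega>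
  have Y_meas: "Y \<in> borel_measurable M"
    unfolding Y_def using e
    by (intro borel_measurable_add borel_measurable_sum measurable_shock[of _ _ n] x0 w) auto
  define bad where "bad = {\<omega> \<in> space M. 3 * real (Suc T) < Y \<omega>}"
  have bad: "bad \<in> sets M" unfolding bad_def using Y_meas by measurable
  have "prob bad \<le> exp (- 2 * real (Suc T))"
    unfolding bad_def Y_def using eta e by (intro shock_sum_tail[OF sg eta _ r rho]) (auto simp: c_def)
  also have "\<dots> \<le> exp (- 2 * real T)" by simp
  finally have pbad: "prob bad \<le> \<delta> / 4" using expT expZ by linarith

  have gridN: "768 * real (k * m) / (1 - 2 * q) \<le> real N" using N(1) by (simp add: X_def a_def)
  obtain E where E: "E \<in> sets M"
    "prob (space M - E) \<le> real (2 * N + 1) ^ (2 * k * m) * exp (- Z) + exp (- 2 * real T)"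
    "\<And>\<omega>. \<omega> \<in> E \<Longrightarrow> (\<Sum>s<T + (2 * k - 1). l2_norm (u s \<omega>)) \<le> 12 * \<gamma> * sqrt (real m) * real T"
    "\<And>\<omega> z. \<omega> \<in> E \<Longrightarrow> z \<in> carrier_vec (2 * k * m) \<Longrightarrow> \<gamma> * a * real T / 32 * l2_norm z \<le>
      (\<Sum>\<tau><T. signed_size (clean_window k (\<lambda>t. \<xi> t \<omega>) \<tau>)
        (z \<bullet> stacked_input k m (\<lambda>t. u t \<omega>) (\<tau> + (2 * k - 1))))"
  proof (rule model.uniform_lower_bound[OF Tk gridN, folded a_def, folded Z_def], goal_cases)
    case (1 E)
    show ?case by (rule 1(1)) (fact 1)+
  qed

  show ?thesis unfolding holds_with_prob_at_least_def
  proof (intro bexI[of _ "E - bad"] conjI ballI allI impI)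
    show "E - bad \<in> sets M" using E(1) bad by (rule sets.Diff)
    have "space M - (E - bad) = (space M - E) \<union> bad"
      using sets.sets_into_space[OF bad] by auto
    then have "prob (space M - (E - bad)) \<le> prob (space M - E) + prob bad"
      using measure_Un_le[of "space M - E" M bad] E(1) bad by auto
    also have "\<dots> \<le> \<delta>" using E(2) expgrid expT expZ pbad delta by linarith
    finally show "1 - \<delta> \<le> prob (E - bad)"
      using prob_compl[of "E - bad"] E(1) bad by auto
    fix \<omega> G assume \<omega>: "\<omega> \<in> E - bad" and G: "lad_solution k r m T (\<lambda>t. y t \<omega>) (\<lambda>t. u t \<omega>) G"
    have sp: "\<omega> \<in> space M" using \<omega> sets.sets_into_space[OF E(1)] by auto
    have x0c: "x 0 \<omega> \<in> carrier_vec n" and wc: "\<And>t. w t \<omega> \<in> carrier_vec n" and uc: "\<And>t. u t \<omega> \<in> carrier_vec m"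
      using random_vec_carrier[OF x0 sp] random_vec_carrier[OF w sp]
        random_vec_carrier[OF model.measurable_input sp] by auto
    define R where "R = K / (1 - \<rho>) * (12 * sqrt (real r) * real T * (\<eta> + \<gamma> * sqrt (real m) * spectral_norm B))"
    have inputs: "(\<Sum>s<T. l2_norm (u s \<omega>)) \<le> 12 * \<gamma> * sqrt (real m) * real T"
    proof -
      have "(\<Sum>s<T. l2_norm (u s \<omega>)) \<le> (\<Sum>s<T + (2 * k - 1). l2_norm (u s \<omega>))"
        by (intro sum_mono2) auto
      also have "\<dots> \<le> 12 * \<gamma> * sqrt (real m) * real T" using \<omega> E(3) by blast
      finally show ?thesis .
    qed
    have shocks: "Y \<omega> \<le> 6 * real T"
      using \<omega> sp T1 by (simp add: bad_def)
    have "(\<Sum>\<tau><T. l2_norm (F *\<^sub>v x \<tau> \<omega>)) \<le> K / (1 - \<rho>) *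
        (sqrt (real r) * c * Y \<omega> + spectral_norm B * (\<Sum>s<T. l2_norm (u s \<omega>)))"
      unfolding Y_def \<rho>_def using e eta
      by (intro state_sum_bound[OF sys[OF sp] A stable B F r _ x0c wc uc K])
        (auto simp: c_def \<rho>_def[symmetric] intro: bd)
    also have "\<dots> \<le> R"
      unfolding R_def
    proof (rule mult_left_mono)
      have "sqrt (real r) * c * Y \<omega> \<le> sqrt (real r) * c * (6 * real T)"
        using shocks eta by (intro mult_left_mono) (auto simp: c_def)
      moreover have "spectral_norm B * (\<Sum>s<T. l2_norm (u s \<omega>)) \<le>
          spectral_norm B * (12 * \<gamma> * sqrt (real m) * real T)"
        by (intro mult_left_mono inputs) simp
      moreover have "spectral_norm B * (12 * \<gamma> * sqrt (real m) * real T) \<le>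
          sqrt (real r) * (spectral_norm B * (12 * \<gamma> * sqrt (real m) * real T))"
        using r gamma mult_right_mono[of 1 "sqrt (real r)" "spectral_norm B * (12 * \<gamma> * sqrt (real m) * real T)"] by simp
      ultimately show "sqrt (real r) * c * Y \<omega> + spectral_norm B * (\<Sum>s<T. l2_norm (u s \<omega>)) \<le>
          12 * sqrt (real r) * real T * (\<eta> + \<gamma> * sqrt (real m) * spectral_norm B)"
        by (simp add: c_def algebra_simps)
    qed (use K rho in auto)
    finally have R: "(\<Sum>\<tau><T. l2_norm ((C * A ^\<^sub>m (2 * k - 1)) *\<^sub>v x \<tau> \<omega>)) \<le> R" unfolding F_def .
    have clean: "w (\<tau> + l) \<omega> = 0\<^sub>v n" if "clean_window k (\<lambda>t. \<xi> t \<omega>) \<tau>" "l < 2 * k - 1" for \<tau> l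
    proof -
      have "\<not> \<xi> (\<tau> + l) \<omega>" using that by (simp add: clean_window_def)
      then show ?thesis using pa sp by (simp add: probabilistic_attacks_def)
    qed
    have "frobenius_norm (markov_parameters k r m A B C D - G) \<le> 2 * R / (\<gamma> * a * real T / 32)"
    proof (rule lad_error_bound[OF sys[OF sp] k m A B C D x0c wc uc clean _ _ R G])
      show "0 < \<gamma> * a * real T / 32" using gamma a T1 by simp
      fix z :: "real vec" assume "z \<in> carrier_vec (2 * k * m)"
      then show "\<gamma> * a * real T / 32 * l2_norm z \<le>
          (\<Sum>\<tau><T. (if clean_window k (\<lambda>t. \<xi> t \<omega>) \<tau> then 1 else - 1) *
            \<bar>z \<bullet> stacked_input k m (\<lambda>t. u t \<omega>) (\<tau> + (2 * k - 1))\<bar>)"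
        using E(4)[of \<omega> z] \<omega> unfolding signed_size_def by blast
    qed
    also have "\<dots> = 768 * error_rate k m r q \<eta> \<gamma> A B C"
    proof -
      have rate: "error_rate k m r q \<eta> \<gamma> A B C =
          K * sqrt (real r) / ((1 - \<rho>) * a) * (\<eta> / \<gamma> + sqrt (real m) * spectral_norm B)"
        by (simp add: error_rate_def K_def \<rho>_def a_def)
      have scale: "2 * (K / s * (12 * g * t * (\<eta> + \<gamma> * h * b))) / (\<gamma> * a * t / 32) =
          768 * (K * g / (s * a) * (\<eta> / \<gamma> + h * b))" if "s \<noteq> 0" "t \<noteq> 0" for s g t h b :: real
        using that gamma a by (simp add: field_simps)
      show ?thesis unfolding R_def rate by (rule scale) (use rho T1 in auto)
    qed
    finally show "frobenius_norm (markov_parameters k r m A B C D - G) \<le> 768 * error_rate k m r q \<eta> \<gamma> A B C" .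
  qed
qed

theorem theorem3:
  shows "\<exists>c1>0. \<exists>c2>0.
    \<forall>(n::nat) (m::nat) (r::nat) (k::nat) (T::nat) (A::real mat) (B::real mat) (C::real mat) (D::real mat)
      (p::real) (q::real) (\<eta>::real) (\<gamma>::real) (\<delta>::real) (M::'a measure)
      (x::nat \<Rightarrow> 'a \<Rightarrow> real vec) (y::nat \<Rightarrow> 'a \<Rightarrow> real vec) (u::nat \<Rightarrow> 'a \<Rightarrow> real vec)
      (w::nat \<Rightarrow> 'a \<Rightarrow> real vec) (\<xi>::nat \<Rightarrow> 'a \<Rightarrow> bool).
      n \<ge> 1 \<longrightarrow> m \<ge> 1 \<longrightarrow> r \<ge> 1 \<longrightarrow> k \<ge> 1 \<longrightarrow>
      A \<in> carrier_mat n n \<longrightarrow> B \<in> carrier_mat n m \<longrightarrow>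
      C \<in> carrier_mat r n \<longrightarrow> D \<in> carrier_mat r m \<longrightarrow>
      spectral_norm A < 1 \<longrightarrow>
      \<eta> > 0 \<longrightarrow> \<gamma> > 0 \<longrightarrow> 0 \<le> p \<longrightarrow> p < 1 / (4 * real k - 2) \<longrightarrow>
      q = 1 - (1 - p) ^ (2 * k - 1) \<longrightarrow>
      0 < \<delta> \<longrightarrow> \<delta> \<le> 1 \<longrightarrow>
      prob_space M \<longrightarrow>
      (\<forall>\<omega>\<in>space M. linear_system A B C D (\<lambda>t. x t \<omega>) (\<lambda>t. y t \<omega>) (\<lambda>t. u t \<omega>) (\<lambda>t. w t \<omega>)) \<longrightarrow>
      sub_gaussian_attacks M n \<eta> (x 0) w \<longrightarrow>
      probabilistic_attacks M n p (x 0) w \<xi> \<longrightarrow>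
      gaussian_inputs M m \<gamma> u \<longrightarrow>
      inputs_indep_attack_times M m u \<xi> \<longrightarrow>
      real T \<ge> c1 * max 1 (sample_rate k m r q \<delta>) \<longrightarrow>
      q < 1 / 2 \<and>
      holds_with_prob_at_least M (1 - \<delta>) (\<lambda>\<omega>.
        \<forall>G. lad_solution k r m T (\<lambda>t. y t \<omega>) (\<lambda>t. u t \<omega>) G \<longrightarrow>
          frobenius_norm (markov_parameters k r m A B C D - G) \<le> c2 * error_rate k m r q \<eta> \<gamma> A B C)"
proof (rule exI[of _ 7000], rule conjI, simp, rule exI[of _ 768], rule conjI, simp, intro allI impI conjI)
  fix n m r k T :: nat and A B C D :: "real mat" and p q \<eta> \<gamma> \<delta> :: real and M :: "'a measure"
    and x y u w :: "nat \<Rightarrow> 'a \<Rightarrow> real vec" and \<xi> :: "nat \<Rightarrow> 'a \<Rightarrow> bool"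
  assume n: "n \<ge> 1" and m: "m \<ge> 1" and r: "r \<ge> 1" and k: "k \<ge> 1"
    and A: "A \<in> carrier_mat n n" and B: "B \<in> carrier_mat n m"
    and C: "C \<in> carrier_mat r n" and D: "D \<in> carrier_mat r m"
    and stable: "spectral_norm A < 1" and eta: "\<eta> > 0" and gamma: "\<gamma> > 0"
    and p: "0 \<le> p" "p < 1 / (4 * real k - 2)" and q: "q = 1 - (1 - p) ^ (2 * k - 1)"
    and delta: "0 < \<delta>" "\<delta> \<le> 1" and M: "prob_space M"
    and sys: "\<forall>\<omega>\<in>space M. linear_system A B C D (\<lambda>t. x t \<omega>) (\<lambda>t. y t \<omega>) (\<lambda>t. u t \<omega>) (\<lambda>t. w t \<omega>)"
    and sg: "sub_gaussian_attacks M n \<eta> (x 0) w" and pa: "probabilistic_attacks M n p (x 0) w \<xi>"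
    and gi: "gaussian_inputs M m \<gamma> u" and ii: "inputs_indep_attack_times M m u \<xi>"
    and T: "real T \<ge> 7000 * max 1 (sample_rate k m r q \<delta>)"
  show "q < 1 / 2" using attacked_window_rate_less_half(2)[OF k p] q by simp
  interpret prob_space M by (rule M)
  show "holds_with_prob_at_least M (1 - \<delta>) (\<lambda>\<omega>.
        \<forall>G. lad_solution k r m T (\<lambda>t. y t \<omega>) (\<lambda>t. u t \<omega>) G \<longrightarrow>
          frobenius_norm (markov_parameters k r m A B C D - G) \<le> 768 * error_rate k m r q \<eta> \<gamma> A B C)"
    by (rule lad_estimation_error[where x = x and y = y and u = u and w = w and \<xi> = \<xi>,
          OF m r k A B C D stable eta gamma p q delta _ sg pa gi ii T])
      (use sys in blast)
qed

end
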